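(* Let $\Sigma\subseteq\mathrm{PG}(4,q^5)$ be a canonical $\mathbb F_q$-subgeometry and $\Gamma$ a plane such that $\mathbb L=\wp_\Gamma(\Sigma)$ is a maximum scattered linear set of $\mathrm{PG}(1,q^5)$ not of pseudoregulus type. Let $1\neq\sigma\in\mathbb G$, and let $A$ and $B$ be the points $\Gamma\cap\Gamma^{\sigma^4}$ and $\Gamma\cap\Gamma^{\sigma^3}$ respectively. Then $\mathbb L$ is of LP type if and only if $\langle A_2,A_4\rangle\cap\Gamma\neq\emptyset$ or $\langle B_3,B_4\rangle\cap\Gamma\neq\emptyset$.
   Context: $q$ is a prime power; $\mathrm N_{q^5/q}(x)=x^{1+q+q^2+q^3+q^4}$. An $\mathbb F_q$-linear set of rank 5 in $\mathrm{PG}(1,q^5)$ is $L_U=\{\langle v\rangle_{\mathbb F_{q^5}}:v\in U\setminus\{0\}\}$ for a 5-dimensional $\mathbb F_q$-subspace $U\subseteq\mathbb F_{q^5}^2$; maximum scattered means having $(q^5-1)/(q-1)$ points. Pseudoregulus type: $\mathrm{P\Gamma L}(2,q^5)$-equivalent to $\{\langle(x,x^{q^s})\rangle_{\mathbb F_{q^5}}:x\neq0\}$, $\gcd(s,5)=1$; LP type: equivalent to $\{\langle(x,x^{q^s}+\delta x^{q^{5-s}})\rangle_{\mathbb F_{q^5}}:x\neq0\}$, $\gcd(s,5)=1$, $\mathrm N_{q^5/q}(\delta)\notin\{0,1\}$. A canonical $\mathbb F_q$-subgeometry of $\mathrm{PG}(4,q^5)$ is the image under a projectivity of the set of points with coordinates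 in $\mathbb F_q$; $\Gamma\cap\Sigma=\emptyset$ and $\wp_\Gamma(\Sigma)$ is the projection of $\Sigma$ from $\Gamma$ onto a line disjoint from $\Gamma$. $\mathbb G$ is the subgroup of $\mathrm{P\Gamma L}(5,q^5)$ fixing $\Sigma$ pointwise (cyclic of order 5). Under the hypotheses the intersections $\Gamma\cap\Gamma^{\sigma^4}$ and $\Gamma\cap\Gamma^{\sigma^3}$ are single points. For a point $X$, $X_i=X^{\sigma^i}$; $\langle\ \rangle$ denotes projective span. *)

theory Defs
  imports "HOL-Analysis.Analysis" "HOL-Number_Theory.Prime_Powers"
begin

text \<open>
  Points of \<open>PG(n-1, F)\<close> are the one-dimensional subspaces of \<open>F\<^sup>n\<close>; all other projective
  objects (subspaces, subgeometries, linear sets) are sets of points, so the projective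
  intersection is the set-theoretic one and "disjoint" means an empty intersection.
\<close>

definition pg_points :: "('a::field ^ 'n) set set" where
  "pg_points = {P. vec.subspace P \<and> vec.dim P = 1}"

definition pt :: "'a::field ^ 'n \<Rightarrow> ('a ^ 'n) set" where
  "pt v = vec.span {v}"

definition pg_subspace :: "nat \<Rightarrow> ('a::field ^ 'n) set set \<Rightarrow> bool" where
  "pg_subspace d \<Gamma> \<longleftrightarrow>
     (\<exists>W. vec.subspace W \<and> vec.dim W = d + 1 \<and> \<Gamma> = {P \<in> pg_points. P \<subseteq> W})"

abbreviation pg_line :: "('a::field ^ 'n) set set \<Rightarrow> bool" where
  "pg_line \<equiv> pg_subspace 1"

abbreviation pg_plane :: "('a::field ^ 'n) set set \<Rightarrow> bool" where
  "pg_plane \<equiv> pg_subspace 2"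

definition pg_span :: "('a::field ^ 'n) set set \<Rightarrow> ('a ^ 'n) set set" where
  "pg_span S = {P \<in> pg_points. P \<subseteq> vec.span (\<Union>S)}"

definition field_automorphism :: "('a::field \<Rightarrow> 'a) \<Rightarrow> bool" where
  "field_automorphism \<theta> \<longleftrightarrow> bij \<theta> \<and> \<theta> 1 = 1 \<and>
     (\<forall>x y. \<theta> (x + y) = \<theta> x + \<theta> y) \<and> (\<forall>x y. \<theta> (x * y) = \<theta> x * \<theta> y)"

definition semilinear_bij :: "('a::field ^ 'n \<Rightarrow> 'a ^ 'n) \<Rightarrow> bool" where
  "semilinear_bij f \<longleftrightarrow> bij f \<and> (\<forall>v w. f (v + w) = f v + f w) \<and>
     (\<exists>\<theta>. field_automorphism \<theta> \<and> (\<forall>c v. f (c *s v) = \<theta> c *s f v))"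

text \<open>
  Collineations are extensional functions on the points, so that two maps of the vector space
  inducing the same permutation of the points give the same collineation.
\<close>

definition induced_collineation ::
  "('a::field ^ 'n \<Rightarrow> 'a ^ 'n) \<Rightarrow> ('a ^ 'n) set \<Rightarrow> ('a ^ 'n) set" where
  "induced_collineation f = (\<lambda>P\<in>pg_points. f ` P)"

definition PGL :: "(('a::field ^ 'n) set \<Rightarrow> ('a ^ 'n) set) set" where
  "PGL = {induced_collineation f | f. Vector_Spaces.linear (*s) (*s) f \<and> bij f}"

definition PGammaL :: "(('a::field ^ 'n) set \<Rightarrow> ('a ^ 'n) set) set" where
  "PGammaL = {induced_collineation f | f. semilinear_bij f}"

definition collineation_one :: "('a::field ^ 'n) set \<Rightarrow> ('a ^ 'n) set" where
  "collineation_one = (\<lambda>P\<in>pg_points. P)"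

definition pointwise_stabilizer ::
  "('a::field ^ 'n) set set \<Rightarrow> (('a ^ 'n) set \<Rightarrow> ('a ^ 'n) set) set" where
  "pointwise_stabilizer \<Sigma> = {\<sigma> \<in> PGammaL. \<forall>P\<in>\<Sigma>. \<sigma> P = P}"

text \<open>The subfield with \<open>q\<close> elements, when the order of \<open>'a\<close> is a power of \<open>q\<close>.\<close>

definition Fq :: "nat \<Rightarrow> 'a::field set" where
  "Fq q = {x. x ^ q = x}"

definition canonical_subgeometry :: "nat \<Rightarrow> ('a::field ^ 'n) set set \<Rightarrow> bool" where
  "canonical_subgeometry q \<Sigma> \<longleftrightarrow>
     (\<exists>g\<in>PGL. \<Sigma> = g ` {pt v | v. v \<noteq> 0 \<and> (\<forall>i. v $ i \<in> Fq q)})"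

definition Fq_basis :: "nat \<Rightarrow> nat \<Rightarrow> (nat \<Rightarrow> 'a::field ^ 'n) \<Rightarrow> ('a ^ 'n) set \<Rightarrow> bool" where
  "Fq_basis q k b U \<longleftrightarrow>
     U = {\<Sum>i<k. c i *s b i | c. \<forall>i<k. c i \<in> Fq q} \<and>
     (\<forall>c. (\<forall>i<k. c i \<in> Fq q) \<and> (\<Sum>i<k. c i *s b i) = 0 \<longrightarrow> (\<forall>i<k. c i = 0))"

definition Fq_subspace_dim :: "nat \<Rightarrow> nat \<Rightarrow> ('a::field ^ 'n) set \<Rightarrow> bool" where
  "Fq_subspace_dim q k U \<longleftrightarrow> (\<exists>b. Fq_basis q k b U)"

definition linear_set_of :: "('a::field ^ 'n) set \<Rightarrow> ('a ^ 'n) set set" where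
  "linear_set_of U = {pt v | v. v \<in> U - {0}}"

definition max_scattered :: "nat \<Rightarrow> ('a::field ^ 2) set set \<Rightarrow> bool" where
  "max_scattered q L \<longleftrightarrow>
     (\<exists>U. Fq_subspace_dim q 5 U \<and> L = linear_set_of U) \<and>
     card L = (q ^ 5 - 1) div (q - 1)"

definition PGammaL_equivalent ::
  "('a::field ^ 'n) set set \<Rightarrow> ('a ^ 'n) set set \<Rightarrow> bool" where
  "PGammaL_equivalent L M \<longleftrightarrow> (\<exists>g\<in>PGammaL. g ` L = M)"

text \<open>
  Below \<open>s\<close> is taken modulo 5, which does not change the sets since \<open>x\<^bsup>q^5\<^esup> = x\<close>; the bound
  \<open>s < 5\<close> keeps the subtraction \<open>5 - s\<close> from truncating.
\<close>

definition pseudoregulus_type :: "nat \<Rightarrow> ('a::field ^ 2) set set \<Rightarrow> bool" where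
  "pseudoregulus_type q L \<longleftrightarrow>
     (\<exists>s<5. coprime s 5 \<and>
        PGammaL_equivalent L {pt (vector [x, x ^ (q ^ s)]) | x. x \<noteq> 0})"

definition norm5 :: "nat \<Rightarrow> 'a::field \<Rightarrow> 'a" where
  "norm5 q x = x ^ (1 + q + q ^ 2 + q ^ 3 + q ^ 4)"

definition LP_type :: "nat \<Rightarrow> ('a::field ^ 2) set set \<Rightarrow> bool" where
  "LP_type q L \<longleftrightarrow>
     (\<exists>s<5. \<exists>\<delta>. coprime s 5 \<and> norm5 q \<delta> \<notin> {0, 1} \<and>
        PGammaL_equivalent L
          {pt (vector [x, x ^ (q ^ s) + \<delta> * x ^ (q ^ (5 - s))]) | x. x \<noteq> 0})"

definition project_from ::
  "('a::field ^ 'n) set set \<Rightarrow> ('a ^ 'n) set set \<Rightarrow> ('a ^ 'n) set \<Rightarrow> ('a ^ 'n) set" where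
  "project_from \<Gamma> l P = the_elem (pg_span (insert P \<Gamma>) \<inter> l)"

text \<open>
  A coordinate system on a line \<open>l\<close>, i.e. an identification of \<open>l\<close> with \<open>PG(1, F)\<close> induced by a
  linear isomorphism onto the underlying two-dimensional space.
\<close>

definition line_coordinates ::
  "('a::field ^ 'n) set set \<Rightarrow> ('a ^ 2 \<Rightarrow> 'a ^ 'n) \<Rightarrow> bool" where
  "line_coordinates l e \<longleftrightarrow>
     Vector_Spaces.linear (*s) (*s) e \<and> inj e \<and> (\<lambda>P. e ` P) ` pg_points = l"

end

theory Submission
  imports Defs
begin

text \<open>
  A collineation \<open>\<sigma>\<close> fixing \<open>\<Sigma>\<close> pointwise is induced by a semilinear map \<open>S\<close> with companion
  automorphism \<open>\<theta>: x \<mapsto> x\<^bsup>q^s\<^esup>\<close>, and the vectors representing \<open>\<Sigma>\<close> are the fixed vectors \<open>R\<close> of \<open>S\<close>.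
  Projecting from \<open>\<Gamma>\<close> is a linear map \<open>\<phi>\<close> onto \<open>F\<^sup>2\<close> with kernel \<open>W\<close>, and \<open>L\<close> consists of the points
  \<open>\<phi> u\<close> with \<open>u \<in> R\<close>. If \<open>W\<close> meets its image under \<open>S\<close> in more than a point, then two coordinates of
  \<open>\<phi> u\<close> are related by \<open>\<theta>\<close> and \<open>L\<close> is of pseudoregulus type.

  If \<open>a\<close>, \<open>S a\<close> and a combination of \<open>S\<^sup>2 a\<close>, \<open>S\<^sup>4 a\<close> lie in \<open>W\<close>, then parametrising \<open>R\<close> by
  \<open>x \<mapsto> \<Sum>i<5. \<theta>\<^sup>i x \<cdot> S\<^sup>i a\<close> exhibits \<open>L\<close> in the form \<open>(y, \<theta> y + \<delta> \<theta>\<^sup>4 y)\<close>; the norm of \<open>\<delta>\<close> is not 1, because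
  otherwise Hilbert 90 produces two independent vectors of \<open>R\<close> with the same image point.

  Conversely, write a linear set equal to the LP one as \<open>(y, \<Sum>i<5. b\<^sub>i \<theta>\<^sup>i y)\<close>. Both sets are scattered,
  so the multisets of slopes agree, and comparing the power sums of exponents \<open>1\<close>, \<open>1 + \<theta>\<close>,
  \<open>1 + \<theta>\<^sup>2\<close> and \<open>1 + \<theta> + \<theta>\<^sup>2\<close> forces \<open>b\<^sub>0 = b\<^sub>2 = b\<^sub>3 = 0\<close>. The dual basis vector with index 2 is then
  the point sought. The condition on \<open>B\<close> is the condition on \<open>A\<close> for \<open>\<sigma>\<^sup>2\<close>, and replacing \<open>\<sigma>\<close> by its
  inverse changes neither.
\<close>

section \<open>Frobenius powers on a field of order \<open>q\<^sup>5\<close>\<close>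

definition frob :: "nat \<Rightarrow> nat \<Rightarrow> 'a::field \<Rightarrow> 'a" where
  "frob q k x = x ^ (q ^ k)"

lemma card_le_fibres:
  assumes "finite A" and "\<And>y. y \<in> f ` A \<Longrightarrow> card {x \<in> A. f x = y} \<le> k"
  shows "card A \<le> card (f ` A) * k"
proof -
  have "A = (\<Union>y\<in>f ` A. {x \<in> A. f x = y})" by auto
  then have "card A \<le> (\<Sum>y\<in>f ` A. card {x \<in> A. f x = y})"
    using card_UN_le[of "f ` A" "\<lambda>y. {x \<in> A. f x = y}"] assms(1) by simp
  also have "\<dots> \<le> (\<Sum>y\<in>f ` A. k)" by (rule sum_mono) (rule assms(2))
  finally show ?thesis by simp
qed

locale quintic_extension =
  fixes q :: nat and F :: "'a::{field,finite} itself"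
  assumes primepow_q: "primepow q" and card_field: "CARD('a) = q ^ 5"
begin

lemma q_ge_2: "q \<ge> 2"
  using primepow_gt_Suc_0[OF primepow_q] by simp

lemma power_q5: "x ^ (q ^ 5) = (x::'a)"
proof (cases "x = 0")
  case False
  \<comment> \<open>Multiplication by \<open>x\<close> permutes the nonzero elements, so it leaves
    their product unchanged.\<close>
  have "x ^ card (UNIV - {0::'a}) * \<Prod>(UNIV - {0::'a}) = (\<Prod>y\<in>UNIV - {0}. x * y)"
    by (simp add: prod.distrib)
  also have "\<dots> = \<Prod>(UNIV - {0})"
    by (rule prod.reindex_bij_witness[of _ "\<lambda>y. y / x" "\<lambda>y. x * y"]) (use False in auto)
  finally have "x ^ card (UNIV - {0::'a}) = 1" by simp
  moreover have "q ^ 5 = Suc (card (UNIV - {0::'a}))"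
    using card_field q_ge_2 by (simp add: card_Diff_singleton)
  ultimately show ?thesis by (simp only: power_Suc mult_1_right)
qed (use q_ge_2 in simp)

lemma of_nat_q5: "of_nat (q ^ 5) = (0::'a)"
proof -
  \<comment> \<open>Translation by 1 permutes the field, so the sum of all the ones
    vanishes.\<close>
  have "(\<Sum>x\<in>UNIV. x + 1) = (\<Sum>x\<in>UNIV. x::'a)"
    by (rule sum.reindex_bij_witness[of _ "\<lambda>x. x - 1" "\<lambda>x. x + 1"]) auto
  then show ?thesis by (simp add: sum.distrib card_field flip: of_nat_power)
qed

text \<open>The characteristic divides \<open>q ^ 5\<close>, hence it is the prime of which
  \<open>q\<close> is a power, and raising to \<open>q\<close> iterates the Frobenius map.\<close>

lemma add_power_q: "(x + y) ^ q = x ^ q + y ^ (q::nat)" for x y :: 'a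
proof -
  have pr: "prime CHAR('a)"
    using prime_CHAR_semidom finite_imp_CHAR_pos[where ?'a='a] by simp
  obtain p k where pk: "prime p" "k > 0" "q = p ^ k"
    using primepow_q by (auto simp: primepow_def)
  have "CHAR('a) dvd q ^ 5" using of_nat_q5 by (simp only: of_nat_eq_0_iff_char_dvd)
  then have "CHAR('a) dvd p"
    using pr pk prime_dvd_power by metis
  then have "q = CHAR('a) ^ k"
    using pk pr by (metis prime_nat_iff primes_dvd_imp_eq)
  then show ?thesis using freshmans_dream'[OF pr] by blast
qed

abbreviation "fr \<equiv> frob q"

lemma fr_0 [simp]: "fr 0 x = (x::'a)" by (simp add: frob_def)

lemma fr_fr [simp]: "fr i (fr j x) = fr (i + j) (x::'a)"
  by (simp add: frob_def power_add mult.commute flip: power_mult)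

lemma fr_5 [simp]: "fr 5 x = (x::'a)" by (simp add: frob_def power_q5)

lemma fr_mult_5 [simp]: "fr (5 * k) x = (x::'a)"
  by (induction k arbitrary: x) (auto simp flip: fr_fr)

lemma fr_cong: "i mod 5 = j mod 5 \<Longrightarrow> fr i x = fr j (x::'a)"
  by (metis fr_fr fr_mult_5 mult_div_mod_eq)

lemma fr_add: "fr i (x + y) = fr i x + fr i (y::'a)"
proof (induction i)
  case (Suc i)
  have *: "fr (Suc i) z = (fr i z) ^ q" for z :: 'a
    by (simp add: frob_def power_mult[symmetric] mult.commute)
  show ?case unfolding * Suc.IH by (rule add_power_q)
qed simp

lemma fr_zero [simp]: "fr i 0 = (0::'a)" using q_ge_2 by (simp add: frob_def)
lemma fr_one [simp]: "fr i 1 = (1::'a)" by (simp add: frob_def)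
lemma fr_mult: "fr i (x * y) = fr i x * fr i (y::'a)" by (simp add: frob_def power_mult_distrib)
lemma fr_divide: "fr i (x / y) = fr i x / fr i (y::'a)" by (simp add: frob_def power_divide)
lemma fr_eq_0_iff [simp]: "fr i x = 0 \<longleftrightarrow> x = (0::'a)" using q_ge_2 by (simp add: frob_def)

lemma fr_minus: "fr i (- x) = - fr i (x::'a)"
  by (metis add.right_inverse add_eq_0_iff fr_add fr_zero)

lemma fr_diff: "fr i (x - y) = fr i x - fr i (y::'a)"
  by (metis fr_add fr_minus uminus_add_conv_diff add.commute)

lemma fr_sum: "fr i (sum f A) = (\<Sum>a\<in>A. fr i (f a :: 'a))"
  by (induction A rule: infinite_finite_induct) (auto simp: fr_add)

lemmas fr_hom = fr_add fr_mult fr_divide fr_minus fr_diff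

lemma fr_inj: "fr i x = fr i y \<longleftrightarrow> x = (y::'a)"
  by (metis fr_diff fr_eq_0_iff right_minus_eq)

lemma Fq_iff: "x \<in> Fq q \<longleftrightarrow> fr 1 x = (x::'a)" by (simp add: Fq_def frob_def)

lemma fr_Fq: "x \<in> Fq q \<Longrightarrow> fr i x = (x::'a)"
proof (induction i)
  case (Suc i)
  then show ?case using fr_fr[of i 1 x] by (simp add: Fq_iff)
qed simp

text \<open>A relation makes the linearised polynomial with coefficients \<open>w i\<close>, of
  degree at most \<open>q ^ 4\<close>, vanish at all \<open>q ^ 5\<close> field elements.\<close>

lemma frob_independent:
  assumes "\<And>c::'a. (\<Sum>i<5. w i * fr i c) = 0" and "k < 5"
  shows "w k = 0"
proof -
  define p where "p = (\<Sum>i<5. monom (w i) (q ^ i))"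
  have inj: "q ^ i = q ^ j \<longleftrightarrow> i = j" for i j using q_ge_2 by simp
  have "degree p \<le> q ^ 4" unfolding p_def
    by (rule degree_sum_le) (use q_ge_2 in \<open>auto intro!: order.trans[OF degree_monom_le] power_increasing\<close>)
  moreover have "{x. poly p x = 0} = UNIV"
    using assms(1) by (auto simp: p_def poly_sum poly_monom frob_def)
  moreover have "q ^ 4 < q ^ 5" using q_ge_2 by (simp add: power_strict_increasing)
  ultimately have "p = 0"
    using card_poly_roots_bound[of p] card_field by (metis leD order.trans order_less_le_trans)
  moreover have "coeff p (q ^ k) = w k"
    using assms(2) by (simp add: p_def coeff_sum inj if_distrib sum.delta cong: if_cong)
  ultimately show ?thesis by simp
qed

lemma card_Fq: "card (Fq q :: 'a set) = q"
proof (rule antisym)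
  have "degree (monom 1 q + [:0, - 1::'a:]) = q"
    using q_ge_2 degree_add_eq_left[of "[:0, - 1::'a:]" "monom 1 q"] by (simp add: degree_monom_eq)
  moreover have "{x. poly (monom 1 q + [:0, - 1::'a:]) x = 0} = Fq q"
    by (auto simp: Fq_def poly_monom)
  moreover have "monom 1 q + [:0, - 1::'a:] \<noteq> 0"
    using calculation(1) q_ge_2 by (metis degree_0 not_numeral_le_zero)
  ultimately show "card (Fq q :: 'a set) \<le> q"
    by (metis card_poly_roots_bound)
next
  \<comment> \<open>The additive map \<open>x \<mapsto> x\<^sup>q - x\<close> has kernel \<open>Fq q\<close> and takes values of trace zero.\<close>
  let ?f = "\<lambda>x::'a. fr 1 x - x" and ?tr = "\<Sum>i<5. monom (1::'a) (q ^ i)"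
  have tr0: "?tr \<noteq> 0"
  proof
    assume "?tr = 0"
    then have "(\<Sum>i<5. 1 * fr i c) = 0" for c :: 'a
      by (metis (no_types, lifting) frob_def mult_1 poly_0 poly_monom poly_sum sum.cong)
    from frob_independent[OF this, of 0] show False by simp
  qed
  have "degree ?tr \<le> q ^ 4"
    by (rule degree_sum_le) (use q_ge_2 in \<open>auto intro!: order.trans[OF degree_monom_le] power_increasing\<close>)
  then have "card {x. poly ?tr x = 0} \<le> q ^ 4"
    using card_poly_roots_bound[OF tr0] by linarith
  moreover have "range ?f \<subseteq> {x. poly ?tr x = 0}"
  proof clarify
    fix x :: 'a
    have "poly ?tr (?f x) = (\<Sum>i<5. fr (Suc i) x - fr i x)"
      by (simp add: poly_sum poly_monom fr_diff flip: frob_def)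
    then show "poly ?tr (?f x) = 0" using sum_lessThan_telescope[of "\<lambda>i. fr i x" 5] by simp
  qed
  ultimately have im: "card (range ?f) \<le> q ^ 4"
    by (meson card_mono finite order.trans)
  have "card {x \<in> UNIV. ?f x = y} \<le> card (Fq q :: 'a set)" if "y \<in> range ?f" for y
  proof -
    obtain x0 where x0: "y = ?f x0" using \<open>y \<in> range ?f\<close> by auto
    have "(\<lambda>x. x - x0) ` {x. ?f x = y} \<subseteq> Fq q" by (auto simp: Fq_iff x0 fr_diff algebra_simps)
    then show ?thesis
      using card_inj_on_le[of "\<lambda>x. x - x0" "{x. ?f x = y}" "Fq q"] by (simp add: inj_on_def)
  qed
  then have "q ^ 5 \<le> card (range ?f) * card (Fq q :: 'a set)"
    using card_le_fibres[of UNIV ?f] card_field by simp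
  also have "\<dots> \<le> q ^ 4 * card (Fq q :: 'a set)" using im by simp
  finally have "q ^ 4 * q \<le> q ^ 4 * card (Fq q :: 'a set)" by (simp add: eval_nat_numeral ac_simps)
  then show "q \<le> card (Fq q :: 'a set)" using q_ge_2 by simp
qed

text \<open>As 5 is prime, \<open>k\<close> has an inverse modulo 5, and the corresponding iterate
  of \<open>fr k\<close> is \<open>fr 1\<close>.\<close>

lemma fr_fixed:
  assumes "fr k x = (x::'a)" and "k mod 5 \<noteq> 0"
  shows "x \<in> Fq q"
proof -
  have it: "fr (k * m) x = x" for m
  proof (induction m)
    case (Suc m)
    then show ?case using fr_fr[of k "k * m" x] assms(1) by simp
  qed simp
  have "k mod 5 \<in> {1, 2, 3, 4}" using assms(2) by auto
  then obtain m where "(k * m) mod 5 = 1 mod 5"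
  proof (elim insertE)
    assume "k mod 5 = 1" then show thesis using that[of 1] by simp
  next
    assume "k mod 5 = 2" then show thesis using that[of 3] by (simp add: mod_mult_left_eq[of k 5, symmetric])
  next
    assume "k mod 5 = 3" then show thesis using that[of 2] by (simp add: mod_mult_left_eq[of k 5, symmetric])
  next
    assume "k mod 5 = 4" then show thesis using that[of 4] by (simp add: mod_mult_left_eq[of k 5, symmetric])
  qed simp
  from fr_cong[OF this, of x] show ?thesis by (simp add: it Fq_iff)
qed

lemma conjugates_distinct:
  assumes x: "x \<notin> Fq q"
  shows "inj_on (\<lambda>j. fr j (x::'a)) {..<5}"
proof (rule linorder_inj_onI)
  fix i j :: nat assume ij: "i < j" "i \<in> {..<5}" "j \<in> {..<5}"
  show "fr i x \<noteq> fr j x"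
  proof
    assume "fr i x = fr j x"
    then have "fr i (fr (j - i) x) = fr i x" using ij by simp
    then have "fr (j - i) x = x" by (simp only: fr_inj)
    with fr_fixed[of "j - i" x] ij x show False by auto
  qed
qed auto

lemma Fq_diff: "x \<in> Fq q \<Longrightarrow> y \<in> Fq q \<Longrightarrow> x - y \<in> (Fq q :: 'a set)"
  by (simp add: Fq_iff fr_diff)

text \<open>An element outside \<open>Fq q\<close> has five distinct conjugates, so no nonzero
  polynomial over \<open>Fq q\<close> of degree at most 4 kills it. The \<open>q ^ 5\<close>
  combinations are therefore distinct and fill the field.\<close>

lemma power_basis:
  assumes x: "x \<notin> Fq q"
  shows "\<exists>c. (\<forall>i<5. c i \<in> Fq q) \<and> z = (\<Sum>i<5. c i * x ^ i :: 'a)"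
proof -
  let ?C = "{..<5::nat} \<rightarrow>\<^sub>E (Fq q :: 'a set)" and ?v = "\<lambda>c. \<Sum>i<5. c i * x ^ i"
  have inj: "inj_on ?v ?C"
  proof (rule inj_onI)
    fix c d assume cd: "c \<in> ?C" "d \<in> ?C" "?v c = ?v d"
    define p where "p = (\<Sum>i<5. monom (c i - d i) i)"
    have "poly p (fr j x) = 0" for j
    proof -
      have "poly p (fr j x) = (\<Sum>i<5. fr j (c i - d i) * fr j (x ^ i))"
        using cd by (auto simp: p_def poly_sum poly_monom frob_def fr_Fq[unfolded frob_def] PiE_iff
            Fq_diff mult.commute power_mult[symmetric] intro!: sum.cong)
      also have "\<dots> = fr j (?v c - ?v d)"
        by (simp add: fr_diff fr_sum fr_mult sum_subtractf algebra_simps)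
      finally show ?thesis using cd by simp
    qed
    then have "(\<lambda>j. fr j x) ` {..<5} \<subseteq> {y. poly p y = 0}" by auto
    then have "card ((\<lambda>j. fr j x) ` {..<5}) \<le> card {y. poly p y = 0}" by (intro card_mono) auto
    moreover note conjugates_distinct[OF x]
    moreover have "degree p \<le> 4" unfolding p_def
      by (rule degree_sum_le) (auto intro!: order.trans[OF degree_monom_le])
    ultimately have "p = 0" using card_poly_roots_bound[of p] by (auto simp: card_image)
    moreover have "coeff p i = c i - d i" if "i < 5" for i
      using that by (simp add: p_def coeff_sum cong: if_cong)
    ultimately show "c = d" using cd(1,2) by (intro PiE_ext[of c "{..<5}" "\<lambda>_. Fq q" d]) auto
  qed
  have "card (?v ` ?C) = CARD('a)"
    using card_image[OF inj] by (simp add: card_PiE card_Fq card_field)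
  then have "?v ` ?C = UNIV" by (intro card_subset_eq) auto
  then obtain c where "c \<in> ?C" "z = ?v c" by (metis (no_types, lifting) UNIV_I imageE)
  then show ?thesis by (intro exI[of _ c]) (auto simp: PiE_iff)
qed

text \<open>An element \<open>x\<close> outside \<open>Fq q\<close> satisfies a monic relation of
  degree 5 over \<open>Fq q\<close>, whose roots are its five conjugates. The automorphism must send
  \<open>x\<close> to one of them, and the power basis of \<open>x\<close> determines the
  rest.\<close>

lemma automorphism_frob:
  assumes "field_automorphism \<rho>" and fixed: "\<And>x::'a. x \<in> Fq q \<Longrightarrow> \<rho> x = x"
  obtains s where "s < 5" "\<rho> = fr s"
proof -
  have \<rho>: "\<rho> (x + y) = \<rho> x + \<rho> y" "\<rho> (x * y) = \<rho> x * \<rho> y" "\<rho> 1 = 1" for x y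
    using assms(1) by (auto simp: field_automorphism_def)
  have \<rho>0: "\<rho> 0 = 0" using \<rho>(1)[of 0 0] by (simp only: add_0_right add_cancel_right_right)
  have \<rho>pow: "\<rho> (x ^ n) = \<rho> x ^ n" for x n by (induction n) (auto simp: \<rho>)
  have \<rho>sum: "\<rho> (sum f A) = (\<Sum>a\<in>A. \<rho> (f a))" for f and A :: "nat set"
    by (induction A rule: infinite_finite_induct) (auto simp: \<rho> \<rho>0)
  have "card (Fq q :: 'a set) < CARD('a)"
    using q_ge_2 power_strict_increasing[of 1 5 q] by (simp add: card_Fq card_field)
  then obtain x :: 'a where x: "x \<notin> Fq q" by (metis UNIV_eq_I less_irrefl)
  obtain c where c: "\<And>i. i < 5 \<Longrightarrow> c i \<in> Fq q" "x ^ 5 = (\<Sum>i<5. c i * x ^ i)"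
    using power_basis[OF x, of "x ^ 5"] by auto
  define p where "p = monom 1 5 - (\<Sum>i<5. monom (c i) i)"
  have "coeff p 5 = 1" by (simp add: p_def coeff_sum)
  then have p0: "p \<noteq> 0" by auto
  have "degree p \<le> 5" unfolding p_def
    by (intro degree_diff_le degree_sum_le) (auto intro!: order.trans[OF degree_monom_le])
  then have few: "card {y. poly p y = 0} \<le> 5" using card_poly_roots_bound[OF p0] by simp
  have "\<rho> x ^ 5 = (\<Sum>i<5. c i * \<rho> x ^ i)"
    using arg_cong[OF c(2), of \<rho>] c(1) by (simp add: \<rho>sum \<rho> \<rho>pow fixed cong: sum.cong_simp)
  then have r1: "poly p (\<rho> x) = 0" by (simp add: p_def poly_sum poly_monom)
  have r2: "poly p (fr j x) = 0" for j
  proof -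
    have frpow: "fr j (x ^ n) = fr j x ^ n" for n by (induction n) (auto simp: fr_mult)
    have "fr j x ^ 5 = (\<Sum>i<5. c i * fr j x ^ i)"
      using arg_cong[OF c(2), of "fr j"] c(1)
      by (simp add: fr_sum fr_mult fr_Fq frpow cong: sum.cong_simp)
    then show ?thesis by (simp add: p_def poly_sum poly_monom)
  qed
  note inj = conjugates_distinct[OF x]
  have "\<rho> x \<in> (\<lambda>j. fr j x) ` {..<5}"
  proof (rule ccontr)
    assume n: "\<rho> x \<notin> (\<lambda>j. fr j x) ` {..<5}"
    have "card (insert (\<rho> x) ((\<lambda>j. fr j x) ` {..<5})) = 6"
      using n inj by (simp add: card_image)
    moreover have "insert (\<rho> x) ((\<lambda>j. fr j x) ` {..<5}) \<subseteq> {y. poly p y = 0}"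
      using r1 r2 by auto
    ultimately have "6 \<le> card {y. poly p y = 0}" by (metis card_mono finite)
    with few show False by simp
  qed
  then obtain s where s: "s < 5" "\<rho> x = fr s x" by auto
  have "\<rho> z = fr s z" for z
  proof -
    have frpow: "fr s (x ^ n) = fr s x ^ n" for n by (induction n) (auto simp: fr_mult)
    obtain d where d: "\<And>i. i < 5 \<Longrightarrow> d i \<in> Fq q" "z = (\<Sum>i<5. d i * x ^ i)"
      using power_basis[OF x, of z] by auto
    show ?thesis unfolding d(2)
      using d(1) by (simp add: \<rho>sum \<rho> \<rho>pow fixed s(2) fr_sum fr_mult fr_Fq frpow cong: sum.cong_simp)
  qed
  with s(1) that show ?thesis by blast
qed

end

section \<open>Base \<open>q\<close> digits of sums of three powers of \<open>q\<close>\<close>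

lemma digit_unique:
  fixes q :: nat
  assumes "a + q * x = b + q * y" "a < q" "b < q"
  shows "a = b \<and> x = y"
proof -
  have "a = b" using arg_cong[OF assms(1), of "\<lambda>z. z mod q"] assms(2,3) by simp
  with assms show ?thesis by auto
qed

lemma inj_on_mult_mod_5:
  fixes s :: nat
  assumes "s < 5" "s \<noteq> 0"
  shows "inj_on (\<lambda>n. s * n mod 5) {..<5}"
proof -
  have l5: "n \<in> {0, 1, 2, 3, 4}" if "n < 5" for n :: nat using that by auto
  have "\<forall>s\<in>{1, 2, 3, 4::nat}. \<forall>m\<in>{0, 1, 2, 3, 4}. \<forall>n\<in>{0, 1, 2, 3, 4}. s * m mod 5 = s * n mod 5 \<longrightarrow> m = n"
    by code_simp
  moreover have "s \<in> {1, 2, 3, 4}" using assms by auto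
  ultimately show ?thesis by (meson inj_onI l5 lessThan_iff)
qed

text \<open>For \<open>q\<close> equal to 2 or 3 carries can occur, so these cases are enumerated.
  The pairs \<open>(u, v)\<close> are the residues of \<open>s\<close> and \<open>2 * s\<close>
  modulo 5 for the four nonzero \<open>s\<close>.\<close>

lemma power_triple_sum_unique_small:
  "\<forall>q\<in>{2, 3::nat}. \<forall>(u, v)\<in>{(1, 2), (2, 4), (3, 1), (4, 3)}.
     \<forall>i\<in>{0, 1, 2, 3, 4}. \<forall>j\<in>{0, 1, 2, 3, 4}. \<forall>k\<in>{0, 1, 2, 3, 4}.
       (q ^ i + q ^ j + q ^ k) mod (q ^ 5 - 1) = (q ^ 0 + q ^ u + q ^ v) mod (q ^ 5 - 1) \<longrightarrow>
       {0, u, v} \<subseteq> {i, j, k :: nat}"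
  by simp

text \<open>Separates, as functions on the nonzero elements, the monomial
  \<open>x * th 1 x * th 2 x\<close> from every product of three conjugates that is not a
  rearrangement of it.\<close>

lemma power_triple_sum_unique:
  fixes q s a b c :: nat
  assumes q: "q \<ge> 2" and s: "s < 5" "s \<noteq> 0" and abc: "a < 5" "b < 5" "c < 5"
    and eq: "(q ^ (s * a mod 5) + q ^ (s * b mod 5) + q ^ (s * c mod 5)) mod (q ^ 5 - 1) =
     (q ^ (s * 0 mod 5) + q ^ (s * 1 mod 5) + q ^ (s * 2 mod 5)) mod (q ^ 5 - 1)"
  shows "{a, b, c} = {0, 1, 2}"
proof -
  have "(\<lambda>n. s * n mod 5) ` {0, 1, 2} \<subseteq> (\<lambda>n. s * n mod 5) ` {a, b, c}"
    \<comment> \<open>For \<open>q \<ge> 4\<close> the base-\<open>q\<close> digits are at most 3, so no carry occurs.\<close>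
  proof (cases "q \<le> 3")
    case True
    have l5: "n mod 5 \<in> {0, 1, 2, 3, 4}" for n :: nat using mod_less_divisor[of 5 n] by force
    have "s \<in> {1, 2, 3, 4}" and q23: "q \<in> {2, 3}" using s True q by auto
    then have uv: "(s * 1 mod 5, s * 2 mod 5) \<in> {(1, 2), (2, 4), (3, 1), (4, 3)}" by auto
    have "{0, s * 1 mod 5, s * 2 mod 5} \<subseteq> {s * a mod 5, s * b mod 5, s * c mod 5}"
      using power_triple_sum_unique_small[THEN bspec, OF q23, THEN bspec, OF uv, unfolded prod.case,
          THEN bspec, OF l5, THEN bspec, OF l5, THEN bspec, OF l5, THEN mp, of "s * a" "s * b" "s * c"]
        eq[unfolded mult_0_right mod_0] by blast
    then show ?thesis by simp
  next
    case False
    \<comment> \<open>\<open>d a b c i\<close> counts how often the exponent \<open>i\<close>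
      occurs; this is the digit of the sum in position \<open>i\<close>.\<close>
    define d :: "nat \<Rightarrow> nat \<Rightarrow> nat \<Rightarrow> nat \<Rightarrow> nat"
      where "d a b c i = of_bool (s * a mod 5 = i) + of_bool (s * b mod 5 = i) + of_bool (s * c mod 5 = i)"
      for a b c i :: nat
    have d3: "d a b c i < q" for a b c i using False by (auto simp: d_def)
    have single: "q ^ k = of_bool (k = 0) + q * (of_bool (k = 1) + q * (of_bool (k = 2)
        + q * (of_bool (k = 3) + q * of_bool (k = 4))))" if "k < 5" for k :: nat
      using that by (auto simp: eval_nat_numeral less_Suc_eq)
    have horner: "q ^ (s * a mod 5) + q ^ (s * b mod 5) + q ^ (s * c mod 5) =
        d a b c 0 + q * (d a b c 1 + q * (d a b c 2 + q * (d a b c 3 + q * d a b c 4)))" for a b c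
      by (subst (1 2 3) single) (simp_all add: d_def algebra_simps)
    \<comment> \<open>The sums stay below the modulus, so the congruence is an equality of
      numbers.\<close>
    have small: "q ^ (s * a mod 5) + q ^ (s * b mod 5) + q ^ (s * c mod 5) < q ^ 5 - 1" for a b c
    proof -
      have le: "q ^ (s * x mod 5) \<le> q ^ 4" for x using False by (intro power_increasing) auto
      have "q ^ (s * a mod 5) + q ^ (s * b mod 5) + q ^ (s * c mod 5) \<le> 3 * q ^ 4"
        using le[of a] le[of b] le[of c] by linarith
      moreover have "4 * q ^ 4 \<le> q * q ^ 4" using False by simp
      moreover have "q ^ 4 > 1" using False by (intro one_less_power) auto
      moreover have "q ^ 5 = q * q ^ 4" by (simp add: eval_nat_numeral)
      ultimately show ?thesis by linarith
    qed
    have "q ^ (s * a mod 5) + q ^ (s * b mod 5) + q ^ (s * c mod 5) =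
        q ^ (s * 0 mod 5) + q ^ (s * 1 mod 5) + q ^ (s * 2 mod 5)"
      using eq small by (metis mod_less)
    then have deq: "\<forall>i\<in>{0, 1, 2, 3, 4}. d a b c i = d 0 1 2 i"
      unfolding horner using d3 by (auto dest!: digit_unique)
    have dpos: "d a b c i > 0 \<longleftrightarrow> i \<in> (\<lambda>n. s * n mod 5) ` {a, b, c}" for a b c i
      by (auto simp: d_def)
    have "i \<in> (\<lambda>n. s * n mod 5) ` {a, b, c} \<longleftrightarrow> i \<in> (\<lambda>n. s * n mod 5) ` {0, 1, 2}" for i
    proof (cases "i < 5")
      case True
      then have "i \<in> {0, 1, 2, 3, 4}" by auto
      with deq show ?thesis unfolding dpos[symmetric] by metis
    qed auto
    then show ?thesis by blast
  qed
  then have "{0, 1, 2} \<subseteq> {a, b, c}"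
    using inj_on_image_subset_iff[OF inj_on_mult_mod_5[OF s], of "{0, 1, 2}" "{a, b, c}"] abc by auto
  moreover have "card {a, b, c} \<le> card {0, 1, 2::nat}" by (simp add: card_insert_if)
  ultimately show ?thesis by (metis card_seteq finite.emptyI finite.insertI)
qed

lemma sum_lessThan_5: "(\<Sum>i<5::nat. f i) = f 0 + f 1 + f 2 + f 3 + f 4"
  and prod_lessThan_5: "(\<Prod>i<5::nat. g i) = g 0 * g 1 * g 2 * g 3 * g 4"
  by (simp_all add: eval_nat_numeral)

section \<open>A generator of the Galois group, the norm and Hilbert 90\<close>

locale frobenius_generator = quintic_extension q F
  for q and F :: "'a::{field,finite} itself" +
  fixes s :: nat
  assumes s: "s < 5" "s \<noteq> 0"
begin

declare add_2_eq_Suc [simp del] add_2_eq_Suc' [simp del]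

text \<open>The \<open>k\<close>-th power of the companion automorphism \<theta>. Every nonzero
  \<open>s\<close> below 5 yields a generator of the Galois group, so all exponents can be counted
  in powers of \<theta> modulo 5.\<close>

definition th :: "nat \<Rightarrow> 'a \<Rightarrow> 'a" where "th k = fr (s * k)"

lemma th_0 [simp]: "th 0 x = x" by (simp add: th_def)
lemma th_th [simp]: "th i (th j x) = th (i + j) x" by (simp add: th_def distrib_left)
lemma th_Suc_Suc_0 [simp]: "th (Suc (Suc 0)) x = th 2 x" by (simp add: numeral_2_eq_2)
lemma th_add: "th i (x + y) = th i x + th i y" by (simp add: th_def fr_hom)
lemma th_mult: "th i (x * y) = th i x * th i y" by (simp add: th_def fr_hom)
lemma th_divide: "th i (x / y) = th i x / th i y" by (simp add: th_def fr_hom)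
lemma th_minus: "th i (- x) = - th i x" by (simp add: th_def fr_hom)
lemma th_diff: "th i (x - y) = th i x - th i y" by (simp add: th_def fr_hom)
lemma th_sum: "th i (sum f A) = (\<Sum>a\<in>A. th i (f a))" by (simp add: th_def fr_sum)
lemma th_zero [simp]: "th i 0 = 0" by (simp add: th_def)
lemma th_one [simp]: "th i 1 = 1" by (simp add: th_def)
lemma th_eq_0_iff [simp]: "th i x = 0 \<longleftrightarrow> x = 0" by (simp add: th_def)
lemma th_inj: "th i x = th i y \<longleftrightarrow> x = y" by (simp add: th_def fr_inj)
lemmas th_hom = th_add th_mult th_divide th_minus th_diff

lemma th_reduce [simp]: "5 \<le> k \<Longrightarrow> th k x = th (k - 5) x"
proof -
  assume "5 \<le> k"
  then have "s * k = s * (k - 5) + 5 * s" by (simp add: algebra_simps flip: distrib_left)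
  then show ?thesis unfolding th_def by (intro fr_cong) simp
qed

lemma th_Fq: "x \<in> Fq q \<Longrightarrow> th k x = x" by (simp add: th_def fr_Fq)

lemma th_1_fixed: "th 1 x = x \<longleftrightarrow> x \<in> Fq q"
  using fr_fixed[of s x] s by (auto simp: th_def fr_Fq)

text \<open>Multiplication by \<open>s\<close> permutes the exponents modulo 5, so this is the
  independence of the Frobenius powers in another order.\<close>

lemma th_independent:
  assumes "\<And>c. (\<Sum>i<5. w i * th i c) = 0" and "k < 5"
  shows "w k = 0"
proof -
  let ?f = "\<lambda>n. s * n mod 5"
  have inj: "inj_on ?f {..<5}" by (rule inj_on_mult_mod_5[OF s])
  have im: "?f ` {..<5} = {..<5}" by (rule endo_inj_surj[OF _ _ inj]) auto
  define w' where "w' j = w (inv_into {..<5} ?f j)" for j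
  have w': "w' (?f i) = w i" if "i < 5" for i using that inv_into_f_f[OF inj, of i] by (simp add: w'_def)
  have "(\<Sum>j<5. w' j * fr j c) = 0" for c
  proof -
    have "(\<Sum>j<5. w' j * fr j c) = (\<Sum>i<5. w' (?f i) * fr (?f i) c)"
      by (subst im[symmetric], subst sum.reindex[OF inj]) simp
    also have "\<dots> = (\<Sum>i<5. w i * th i c)"
      by (rule sum.cong) (auto simp: w' th_def intro!: arg_cong2[of _ _ _ _ "(*)"] fr_cong)
    finally show ?thesis using assms(1) by simp
  qed
  from frob_independent[OF this, of "?f k"] show ?thesis using assms(2) w' by simp
qed

lemma th_independent_vec:
  fixes w :: "nat \<Rightarrow> 'a ^ 'n"
  assumes "\<And>c. (\<Sum>i<5. th i c *s w i) = 0" and "k < 5"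
  shows "w k = 0"
proof (rule vec_eq_iff[THEN iffD2], rule allI)
  fix j
  have "(\<Sum>i<5. w i $ j * th i c) = 0" for c
    using arg_cong[OF assms(1)[of c], of "\<lambda>v. v $ j"] by (simp add: sum_component mult.commute)
  from th_independent[OF this assms(2)] show "w k $ j = 0 $ j" by simp
qed

definition nrm :: "'a \<Rightarrow> 'a" where "nrm x = (\<Prod>i<5. th i x)"

lemma nrm_explicit: "nrm x = x * th 1 x * th 2 x * th 3 x * th 4 x"
  by (simp add: nrm_def prod_lessThan_5)

text \<open>The powers of \<theta> run through the same five automorphisms as the powers of
  Frobenius.\<close>

lemma norm5_eq_nrm: "norm5 q x = nrm x"
proof -
  let ?f = "\<lambda>n. s * n mod 5"
  have inj: "inj_on ?f {..<5}" by (rule inj_on_mult_mod_5[OF s])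
  have im: "?f ` {..<5} = {..<5}" by (rule endo_inj_surj[OF _ _ inj]) auto
  have "norm5 q x = (\<Prod>j<5. fr j x)"
    by (simp add: norm5_def frob_def prod_lessThan_5 power_add)
  also have "\<dots> = (\<Prod>i<5. fr (?f i) x)"
    by (subst im[symmetric], subst prod.reindex[OF inj]) simp
  also have "\<dots> = nrm x"
    unfolding nrm_def th_def by (rule prod.cong) (auto intro!: fr_cong)
  finally show ?thesis .
qed

lemma nrm_Fq: "nrm x \<in> Fq q"
  unfolding th_1_fixed[symmetric] by (simp add: nrm_explicit th_hom mult_ac)

text \<open>\<open>D c\<close> is a Lagrange resolvent: as \<open>th 4\<close> is the inverse of
  \<theta>, applying it and multiplying by \<delta> shifts the five terms cyclically, and norm one
  closes the cycle. Independence makes some resolvent nonzero.\<close>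

lemma hilbert_90:
  assumes "nrm \<delta> = 1"
  obtains D where "D \<noteq> 0" "D = \<delta> * th 4 D"
proof -
  define w where "w = (\<lambda>i::nat. 1)(1 := \<delta> * th 4 \<delta> * th 3 \<delta> * th 2 \<delta>, 2 := \<delta> * th 4 \<delta> * th 3 \<delta>,
     3 := \<delta> * th 4 \<delta>, 4 := \<delta>)"
  define D where "D c = (\<Sum>i<5. w i * th i c)" for c
  have D: "D c = c + \<delta> * th 4 c + \<delta> * th 4 \<delta> * th 3 c + \<delta> * th 4 \<delta> * th 3 \<delta> * th 2 c
      + \<delta> * th 4 \<delta> * th 3 \<delta> * th 2 \<delta> * th 1 c" for c
    by (simp add: D_def w_def sum_lessThan_5)
  have N: "\<delta> * th 4 \<delta> * th 3 \<delta> * th 2 \<delta> * th 1 \<delta> = 1"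
    using assms by (simp add: nrm_explicit mult_ac)
  have "D c = \<delta> * th 4 (D c)" for c
    unfolding D using N by (simp add: th_hom algebra_simps)
  moreover have "\<exists>c. D c \<noteq> 0"
    using th_independent[of w 0] by (auto simp: D_def w_def)
  ultimately show ?thesis using that by blast
qed

text \<open>With \<open>y = x * z\<close> the two sides differ by
  \<open>E - \<delta> * th 4 E\<close>, where \<open>E = x * th 1 x * (th 1 z - z)\<close>. For a
  fixed \<open>z\<close> outside \<open>Fq q\<close>, \<open>x\<close> is chosen so that
  \<open>E\<close> is an \<open>Fq q\<close>-multiple of the solution \<open>D\<close> of Hilbert
  90.\<close>

lemma lp_not_scattered:
  assumes "nrm \<delta> = 1"
  obtains x y where "x \<noteq> 0" "y \<noteq> 0" "y / x \<notin> Fq q"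
    "x * (th 1 y + \<delta> * th 4 y) = y * (th 1 x + \<delta> * th 4 x)"
proof -
  obtain D where D: "D \<noteq> 0" "D = \<delta> * th 4 D" using hilbert_90[OF assms] .
  have "card (Fq q :: 'a set) < CARD('a)"
    using q_ge_2 power_strict_increasing[of 1 5 q] by (simp add: card_Fq card_field)
  then obtain z :: 'a where z: "z \<notin> Fq q" by (metis UNIV_eq_I less_irrefl)
  then have z1: "th 1 z - z \<noteq> 0" using th_1_fixed by auto
  \<comment> \<open>With \<open>\<theta>\<close> the generator, \<open>(1 + \<theta>)(1 + \<theta>\<^sup>2) = (1 + \<theta> + \<theta>\<^sup>2 + \<theta>\<^sup>3 + \<theta>\<^sup>4) - \<theta>\<^sup>4\<close>, so \<open>x\<^bsup>1+\<theta>\<^esup>\<close> takes every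
    value up to a factor in \<open>Fq q\<close>.\<close>
  define w where "w = th 1 (D / (th 1 z - z))"
  define x where "x = 1 / (w * th 2 w)"
  have w0: "w \<noteq> 0" using D z1 by (simp add: w_def)
  have n0: "nrm w \<noteq> 0" using w0 by (simp add: nrm_explicit)
  have x0: "x \<noteq> 0" using w0 by (simp add: x_def)
  have w4: "th 4 w = D / (th 1 z - z)" by (simp add: w_def)
  have "x * th 1 x = th 4 w / nrm w"
    using w0 by (simp add: x_def th_hom nrm_explicit divide_simps)
  then have E: "x * th 1 x * (th 1 z - z) = D / nrm w" unfolding w4 using z1 by simp
  have E4: "th 4 (x * th 1 x * (th 1 z - z)) = th 4 D / nrm w"
    unfolding E by (simp add: th_divide th_Fq[OF nrm_Fq])
  have "x * (th 1 (x * z) + \<delta> * th 4 (x * z)) - x * z * (th 1 x + \<delta> * th 4 x) =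
     x * th 1 x * (th 1 z - z) - \<delta> * th 4 (x * th 1 x * (th 1 z - z))"
    by (simp add: th_hom algebra_simps)
  also have "\<dots> = 0" unfolding E4 unfolding E by (simp add: D(2)[symmetric])
  finally have "x * (th 1 (x * z) + \<delta> * th 4 (x * z)) = x * z * (th 1 x + \<delta> * th 4 x)" by simp
  moreover have "x * z \<noteq> 0" "x * z / x \<notin> Fq q" using x0 z by (auto simp: Fq_iff)
  ultimately show ?thesis using that x0 by blast
qed

section \<open>Sums of products of conjugates over the nonzero elements\<close>

lemma card_nonzero: "card (UNIV - {0::'a}) = q ^ 5 - 1"
  by (simp add: card_field)

text \<open>With \<open>r\<close> the residue of \<open>m - n\<close>, all \<open>q ^ 5 - 1\<close>
  nonzero elements satisfy \<open>y ^ r = 1\<close>, which are too many roots unless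
  \<open>r = 0\<close>.\<close>

lemma power_nonzero_eq_imp_cong:
  assumes "\<And>y::'a. y \<noteq> 0 \<Longrightarrow> y ^ m = y ^ n" and "n \<le> m"
  shows "m mod (q ^ 5 - 1) = n mod (q ^ 5 - 1)"
proof -
  define r where "r = (m - n) mod (q ^ 5 - 1)"
  have N: "y ^ (q ^ 5 - 1) = 1" if "y \<noteq> 0" for y :: 'a
    using power_q5[of y] that q_ge_2 by (simp add: power_diff)
  have "y ^ r = 1" if "y \<noteq> 0" for y :: 'a
  proof -
    have "y ^ (m - n) = 1" using assms that by (simp add: power_diff)
    moreover have "y ^ (m - n) = y ^ ((q ^ 5 - 1) * ((m - n) div (q ^ 5 - 1)) + r)"
      by (simp add: r_def)
    ultimately show ?thesis by (simp only: power_add power_mult N[OF that] power_one mult_1)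
  qed
  then have sub: "UNIV - {0} \<subseteq> {y. poly (monom 1 r + [:- 1::'a:]) y = 0}" by (auto simp: poly_monom)
  have q5: "q ^ 5 > 1" using q_ge_2 one_less_power[of q 5] by simp
  have "r = 0"
  proof (rule ccontr)
    assume "r \<noteq> 0"
    then have d: "degree (monom 1 r + [:- 1::'a:]) = r"
      using degree_add_eq_left[of "[:- 1::'a:]" "monom 1 r"] by (simp add: degree_monom_eq)
    then have "monom 1 r + [:- 1::'a:] \<noteq> 0" using \<open>r \<noteq> 0\<close> by (metis degree_0)
    from card_poly_roots_bound[OF this] have "card (UNIV - {0::'a}) \<le> r"
      using card_mono[OF _ sub] d by simp
    moreover have "r < q ^ 5 - 1" unfolding r_def using q5 by simp
    ultimately show False by (simp add: card_field)
  qed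
  then have "(q ^ 5 - 1) dvd (m - n)" by (simp add: r_def mod_eq_0_iff_dvd)
  then show ?thesis using assms(2) by (metis mod_eq_dvd_iff_nat)
qed

text \<open>The quotient is a multiplicative character. If it is trivial, the sum is the image of
  \<open>q ^ 5 - 1\<close> in the field, that is \<open>- 1\<close>; otherwise it is a nontrivial
  character sum.\<close>

lemma sum_th_quotient:
  assumes "a < 5" "b < 5" "c < 5"
  shows "(\<Sum>x\<in>UNIV - {0}. th a x * th b x * th c x / (x * th 1 x * th 2 x)) =
     (if {0, 1, 2} \<subseteq> {a, b, c} then - 1 else 0)"
proof (cases "{0, 1, 2} \<subseteq> {a, b, c}")
  case True
  then have "0 \<in> {a, b, c}" "1 \<in> {a, b, c}" "2 \<in> {a, b, c}" by simp_all
  then have "th a x * th b x * th c x = x * th 1 x * th 2 x" for x by (auto simp: mult_ac)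
  note e = this
  have "(\<Sum>x\<in>UNIV - {0}. th a x * th b x * th c x / (x * th 1 x * th 2 x)) = (\<Sum>x\<in>UNIV - {0::'a}. 1)"
    unfolding e by (rule sum.cong) auto
  moreover have "of_nat (q ^ 5 - 1) + 1 = (of_nat (q ^ 5) :: 'a)"
    using q_ge_2 by (simp add: of_nat_diff)
  ultimately show ?thesis using True card_nonzero of_nat_q5 by (simp add: add_eq_0_iff2)
next
  case False
  have th_pow: "th k x = x ^ (q ^ (s * k mod 5))" for k x
    unfolding th_def frob_def[symmetric] by (rule fr_cong) simp
  let ?m = "q ^ (s * a mod 5) + q ^ (s * b mod 5) + q ^ (s * c mod 5)"
  let ?n = "q ^ (s * 0 mod 5) + q ^ (s * 1 mod 5) + q ^ (s * 2 mod 5)"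
  have t: "th a x * th b x * th c x / (x * th 1 x * th 2 x) = x ^ ?m / x ^ ?n" for x
    using th_pow[of 0 x] by (simp add: th_pow power_add)
  have "\<exists>y::'a. y \<noteq> 0 \<and> y ^ ?m \<noteq> y ^ ?n"
  proof (rule ccontr)
    assume "\<not> ?thesis"
    then have "?m mod (q ^ 5 - 1) = ?n mod (q ^ 5 - 1)"
      using power_nonzero_eq_imp_cong[of ?m ?n] power_nonzero_eq_imp_cong[of ?n ?m]
      by (metis nat_le_linear)
    from power_triple_sum_unique[OF q_ge_2 s assms this] False show False by simp
  qed
  then obtain y :: 'a where y: "y \<noteq> 0" "y ^ ?m \<noteq> y ^ ?n" by blast
  define S where "S = (\<Sum>x\<in>UNIV - {0::'a}. x ^ ?m / x ^ ?n)"
  \<comment> \<open>Substituting \<open>y * x\<close> multiplies the sum by a factor different from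
    1.\<close>
  have "S = (\<Sum>x\<in>UNIV - {0}. (y * x) ^ ?m / (y * x) ^ ?n)" unfolding S_def
    by (rule sum.reindex_bij_witness[of _ "\<lambda>x. y * x" "\<lambda>x. x / y"]) (use y in auto)
  also have "\<dots> = y ^ ?m / y ^ ?n * S"
    by (simp only: S_def sum_distrib_left power_mult_distrib times_divide_times_eq)
  finally have "S = 0" using y by (simp add: field_simps del: power_add)
  then show ?thesis using False by (simp only: t S_def if_False)
qed

text \<open>The second and third factors have the shape of linearised polynomials after
  \<open>th 1\<close> and \<open>th 2\<close>, hence the shifted indices. Only terms whose exponents
  are a permutation of 0, 1, 2 survive the summation, each with the factor
  \<open>- 1\<close>.\<close>

lemma sum_triple:
  fixes u v w :: "nat \<Rightarrow> 'a"
  shows "(\<Sum>x\<in>UNIV - {0}. (\<Sum>k<5. u k * th k x) * (\<Sum>l<5. v l * th (Suc l) x) * (\<Sum>m<5. w m * th (m + 2) x)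
      / (x * th 1 x * th 2 x)) =
    - (\<Sum>k<5. \<Sum>l<5. \<Sum>m<5. if {0, 1, 2} \<subseteq> {k, Suc l mod 5, (m + 2) mod 5} then u k * v l * w m else 0)"
    (is "?L = ?R")
proof -
  have md: "th k x = th (k mod 5) x" for k x
    unfolding th_def by (rule fr_cong) (simp add: mod_mult_right_eq)
  have "?L = (\<Sum>x\<in>UNIV - {0}. \<Sum>k<5. \<Sum>l<5. \<Sum>m<5. u k * v l * w m *
      (th k x * th (Suc l mod 5) x * th ((m + 2) mod 5) x / (x * th 1 x * th 2 x)))"
    by (subst (2) md, subst (3) md)
      (simp add: sum_product sum_divide_distrib sum_distrib_left sum_distrib_right mult_ac,
        rule sum.cong[OF refl], rule sum.swap)
  also have "\<dots> = (\<Sum>k<5. \<Sum>l<5. \<Sum>m<5. \<Sum>x\<in>UNIV - {0}. u k * v l * w m *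
      (th k x * th (Suc l mod 5) x * th ((m + 2) mod 5) x / (x * th 1 x * th 2 x)))"
    by (subst sum.swap, intro sum.cong refl, subst sum.swap, intro sum.cong refl, rule sum.swap)
  also have "\<dots> = (\<Sum>k<5. \<Sum>l<5. \<Sum>m<5. u k * v l * w m *
      (if {0, 1, 2} \<subseteq> {k, Suc l mod 5, (m + 2) mod 5} then - 1 else 0))"
    unfolding sum_distrib_left[symmetric] by (intro sum.cong refl, subst sum_th_quotient) auto
  also have "\<dots> = ?R" unfolding sum_negf[symmetric] by (intro sum.cong refl) auto
  finally show ?thesis .
qed

end

section \<open>Slopes of linear sets and power sums\<close>

text \<open>Equality case of the fibre count: it turns the number of points of a scattered set into
  the exact size of every fibre.\<close>

lemma card_fibres_eq:
  assumes "finite A" and "card A = card (f ` A) * k"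
    and "\<And>y. y \<in> f ` A \<Longrightarrow> k \<le> card {x \<in> A. f x = y}" and "y \<in> f ` A"
  shows "card {x \<in> A. f x = y} = k"
proof -
  have "card A = (\<Sum>y\<in>f ` A. card {x \<in> A. f x = y})"
    using sum.image_gen[OF assms(1), of "\<lambda>_. 1::nat" f] by simp
  then have "(\<Sum>y\<in>f ` A. k) = (\<Sum>y\<in>f ` A. card {x \<in> A. f x = y})" using assms(2) by simp
  from sum_mono_inv[OF this assms(3,4)] assms(1) show ?thesis by simp
qed

context frobenius_generator
begin

lemma card_Fq_nonzero: "card (Fq q - {0::'a}) = q - 1"
  by (subst card_Diff_singleton) (simp_all add: card_Fq Fq_iff)

lemma repunit_mult: "(q ^ 5 - 1) div (q - 1) * (q - 1) = q ^ 5 - 1"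
proof -
  have "q ^ 5 - 1 = (q - 1) * (1 + q + q ^ 2 + q ^ 3 + q ^ 4)"
    using q_ge_2 by (simp add: eval_nat_numeral algebra_simps)
  then have "(q - 1) dvd (q ^ 5 - 1)" by simp
  then show ?thesis by simp
qed

text \<open>The nonzero \<open>Fq q\<close>-multiples of an element share its slope, and the number
  of slopes leaves room for nothing else.\<close>

lemma homogeneous_fibre:
  assumes "\<And>t y. t \<in> Fq q \<Longrightarrow> g (t * y) = t * g y"
    and "card ((\<lambda>y::'a. g y / y) ` (UNIV - {0})) = (q ^ 5 - 1) div (q - 1)"
    and "c \<in> (\<lambda>y. g y / y) ` (UNIV - {0})"
  shows "card {y \<in> UNIV - {0}. g y / y = c} = q - 1"
proof (rule card_fibres_eq)
  show "card (UNIV - {0::'a}) = card ((\<lambda>y. g y / y) ` (UNIV - {0})) * (q - 1)"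
    unfolding assms(2) card_nonzero repunit_mult ..
  fix c assume "c \<in> (\<lambda>y. g y / y) ` (UNIV - {0})"
  then obtain y where y: "y \<noteq> 0" "c = g y / y" by auto
  have "(\<lambda>t. t * y) ` (Fq q - {0}) \<subseteq> {y \<in> UNIV - {0}. g y / y = c}"
    using y assms(1) by auto
  then have "card ((\<lambda>t. t * y) ` (Fq q - {0})) \<le> card {y \<in> UNIV - {0}. g y / y = c}"
    by (intro card_mono) auto
  moreover have "card ((\<lambda>t. t * y) ` (Fq q - {0})) = q - 1"
    using y by (subst card_image) (auto simp: inj_on_def card_Fq_nonzero)
  ultimately show "q - 1 \<le> card {y \<in> UNIV - {0}. g y / y = c}" by simp
qed (use assms(3) in auto)

text \<open>Both functions take each slope exactly \<open>q - 1\<close> times, so both sums are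
  \<open>q - 1\<close> times the sum of \<open>h\<close> over the common slope set.\<close>

lemma power_sums_eq:
  assumes "\<And>t y. t \<in> Fq q \<Longrightarrow> g1 (t * y) = t * g1 y"
    and "\<And>t y. t \<in> Fq q \<Longrightarrow> g2 (t * y) = t * g2 y"
    and "(\<lambda>y::'a. g1 y / y) ` (UNIV - {0}) = (\<lambda>y. g2 y / y) ` (UNIV - {0})"
    and "card ((\<lambda>y. g1 y / y) ` (UNIV - {0})) = (q ^ 5 - 1) div (q - 1)"
  shows "(\<Sum>y\<in>UNIV - {0}. h (g1 y / y) :: 'a) = (\<Sum>y\<in>UNIV - {0}. h (g2 y / y))"
proof -
  have *: "(\<Sum>y\<in>UNIV - {0}. h (g y / y)) = (\<Sum>c\<in>(\<lambda>y. g y / y) ` (UNIV - {0}). of_nat (q - 1) * h c)"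
    if "\<And>t y. t \<in> Fq q \<Longrightarrow> g (t * y) = t * g y"
      "card ((\<lambda>y. g y / y) ` (UNIV - {0})) = (q ^ 5 - 1) div (q - 1)" for g :: "'a \<Rightarrow> 'a"
  proof -
    have "(\<Sum>y\<in>UNIV - {0}. h (g y / y)) = (\<Sum>c\<in>(\<lambda>y. g y / y) ` (UNIV - {0}).
        sum (\<lambda>y. h (g y / y)) {y. y \<in> UNIV - {0} \<and> g y / y = c})"
      by (rule sum.image_gen) simp
    also have "\<dots> = (\<Sum>c\<in>(\<lambda>y. g y / y) ` (UNIV - {0}). of_nat (q - 1) * h c)"
      by (rule sum.cong[OF refl]) (use homogeneous_fibre[OF that] in simp)
    finally show ?thesis .
  qed
  show ?thesis using *[OF assms(1,4)] *[OF assms(2)] assms(3,4) by simp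
qed

text \<open>Each sum is an instance of \<open>sum_triple\<close>. Once \<open>b 0\<close> vanishes,
  few of the permutations of 0, 1, 2 contribute, and the results isolate products of the other
  coefficients.\<close>

lemma power_sum_coefficients:
  fixes b :: "nat \<Rightarrow> 'a"
  defines "G \<equiv> \<lambda>x. (\<Sum>k<5. b k * th k x) / x"
  shows "(\<Sum>x\<in>UNIV - {0}. G x) = - b 0"
    and "b 0 = 0 \<Longrightarrow> (\<Sum>x\<in>UNIV - {0}. G x * th 1 (G x)) = - (b 1 * th 1 (b 4))"
    and "b 0 = 0 \<Longrightarrow> (\<Sum>x\<in>UNIV - {0}. G x * th 2 (G x)) = - (b 2 * th 2 (b 3))"
    and "b 0 = 0 \<Longrightarrow> (\<Sum>x\<in>UNIV - {0}. G x * th 1 (G x) * th 2 (G x)) =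
      - (b 1 * th 1 (b 1) * th 2 (b 3) + b 2 * th 1 (b 4) * th 2 (b 4))"
proof -
  \<comment> \<open>Coefficients of the identity polynomial: they supply the numerators
    \<open>th 1 x\<close> and \<open>th 2 x\<close> when fewer than three conjugates of
    \<open>G\<close> are multiplied.\<close>
  define e :: "nat \<Rightarrow> 'a" where "e = (\<lambda>k. if k = 0 then 1 else 0)"
  have e: "(\<Sum>l<5. e l * th (Suc l) x) = th 1 x" "(\<Sum>l<5. e l * th (l + 2) x) = th 2 x" for x
    by (simp_all add: e_def sum_lessThan_5)
  have G1: "th 1 (G x) = (\<Sum>l<5. th 1 (b l) * th (Suc l) x) / th 1 x" for x
    by (simp add: G_def th_divide th_sum th_mult)
  have G2: "th 2 (G x) = (\<Sum>l<5. th 2 (b l) * th (l + 2) x) / th 2 x" for x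
    by (simp add: G_def th_divide th_sum th_mult add.commute)
  have "(\<Sum>x\<in>UNIV - {0}. G x) = (\<Sum>x\<in>UNIV - {0}. (\<Sum>k<5. b k * th k x) *
      (\<Sum>l<5. e l * th (Suc l) x) * (\<Sum>m<5. e m * th (m + 2) x) / (x * th 1 x * th 2 x))"
    unfolding e by (rule sum.cong) (auto simp: G_def)
  also have "\<dots> = - b 0" unfolding sum_triple by (simp add: sum_lessThan_5 e_def)
  finally show "(\<Sum>x\<in>UNIV - {0}. G x) = - b 0" .
  assume b0: "b 0 = 0"
  have "(\<Sum>x\<in>UNIV - {0}. G x * th 1 (G x)) = (\<Sum>x\<in>UNIV - {0}. (\<Sum>k<5. b k * th k x) *
      (\<Sum>l<5. th 1 (b l) * th (Suc l) x) * (\<Sum>m<5. e m * th (m + 2) x) / (x * th 1 x * th 2 x))"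
    unfolding e G1 by (rule sum.cong) (auto simp: G_def)
  also have "\<dots> = - (b 1 * th 1 (b 4))" unfolding sum_triple by (simp add: sum_lessThan_5 e_def b0)
  finally show "(\<Sum>x\<in>UNIV - {0}. G x * th 1 (G x)) = - (b 1 * th 1 (b 4))" .
  have "(\<Sum>x\<in>UNIV - {0}. G x * th 2 (G x)) = (\<Sum>x\<in>UNIV - {0}. (\<Sum>k<5. b k * th k x) *
      (\<Sum>l<5. e l * th (Suc l) x) * (\<Sum>m<5. th 2 (b m) * th (m + 2) x) / (x * th 1 x * th 2 x))"
    unfolding e G2 by (rule sum.cong) (auto simp: G_def)
  also have "\<dots> = - (b 2 * th 2 (b 3))" unfolding sum_triple by (simp add: sum_lessThan_5 e_def b0)
  finally show "(\<Sum>x\<in>UNIV - {0}. G x * th 2 (G x)) = - (b 2 * th 2 (b 3))" .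
  have "(\<Sum>x\<in>UNIV - {0}. G x * th 1 (G x) * th 2 (G x)) = (\<Sum>x\<in>UNIV - {0}. (\<Sum>k<5. b k * th k x) *
      (\<Sum>l<5. th 1 (b l) * th (Suc l) x) * (\<Sum>m<5. th 2 (b m) * th (m + 2) x) / (x * th 1 x * th 2 x))"
    unfolding G1 G2 by (rule sum.cong) (auto simp: G_def)
  also have "\<dots> = - (b 1 * th 1 (b 1) * th 2 (b 3) + b 2 * th 1 (b 4) * th 2 (b 4))"
    unfolding sum_triple by (simp add: sum_lessThan_5 b0)
  finally show "(\<Sum>x\<in>UNIV - {0}. G x * th 1 (G x) * th 2 (G x)) =
      - (b 1 * th 1 (b 1) * th 2 (b 3) + b 2 * th 1 (b 4) * th 2 (b 4))" .
qed

text \<open>The four power sums of the LP slopes are 0, \<open>- th 1 \<delta>\<close>, 0 and 0.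
  They give in turn \<open>b 0 = 0\<close>, then that \<open>b 1\<close> and \<open>b 4\<close> are
  nonzero, then that \<open>b 2\<close> or \<open>b 3\<close> vanishes; in the last sum the
  remaining one carries a nonzero factor.\<close>

lemma lp_ratio_coefficients:
  fixes b :: "nat \<Rightarrow> 'a"
  assumes \<delta>: "\<delta> \<noteq> 0"
    and eq: "(\<lambda>y. (\<Sum>k<5. b k * th k y) / y) ` (UNIV - {0}) = (\<lambda>y. (th 1 y + \<delta> * th 4 y) / y) ` (UNIV - {0})"
    and card: "card ((\<lambda>y. (\<Sum>k<5. b k * th k y) / y) ` (UNIV - {0})) = (q ^ 5 - 1) div (q - 1)"
  shows "b 0 = 0" "b 1 \<noteq> 0" "b 2 = 0" "b 3 = 0" "b 4 \<noteq> 0"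
proof -
  define d :: "nat \<Rightarrow> 'a" where "d = (\<lambda>k. if k = 1 then 1 else if k = 4 then \<delta> else 0)"
  have d: "th 1 y + \<delta> * th 4 y = (\<Sum>k<5. d k * th k y)" for y
    by (simp add: d_def sum_lessThan_5)
  have hom: "(\<Sum>k<5. f k * th k (t * y)) = t * (\<Sum>k<5. f k * th k y)" if "t \<in> Fq q" for f t y
    using that by (simp add: th_mult th_Fq sum_distrib_left mult_ac)
  note tr = power_sums_eq[OF hom[of _ b] hom[of _ d] eq[unfolded d] card]
  have "- b 0 = - d 0"
    unfolding power_sum_coefficients(1)[symmetric] using tr[where h = "\<lambda>c. c"] by simp
  then show b0: "b 0 = 0" by (simp add: d_def)
  have d0: "d 0 = 0" by (simp add: d_def)
  have "- (b 1 * th 1 (b 4)) = - (d 1 * th 1 (d 4))"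
    unfolding power_sum_coefficients(2)[where b = b, OF b0, symmetric]
      power_sum_coefficients(2)[where b = d, OF d0, symmetric]
    using tr[where h = "\<lambda>c. c * th 1 c"] by simp
  then have b14: "b 1 * th 1 (b 4) \<noteq> 0" using \<delta> by (simp add: d_def)
  then show b1: "b 1 \<noteq> 0" and b4: "b 4 \<noteq> 0" by auto
  have "- (b 2 * th 2 (b 3)) = - (d 2 * th 2 (d 3))"
    unfolding power_sum_coefficients(3)[where b = b, OF b0, symmetric]
      power_sum_coefficients(3)[where b = d, OF d0, symmetric]
    using tr[where h = "\<lambda>c. c * th 2 c"] by simp
  then have b23: "b 2 = 0 \<or> b 3 = 0" by (simp add: d_def)
  have "- (b 1 * th 1 (b 1) * th 2 (b 3) + b 2 * th 1 (b 4) * th 2 (b 4)) =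
      - (d 1 * th 1 (d 1) * th 2 (d 3) + d 2 * th 1 (d 4) * th 2 (d 4))"
    unfolding power_sum_coefficients(4)[where b = b, OF b0, symmetric]
      power_sum_coefficients(4)[where b = d, OF d0, symmetric]
    using tr[where h = "\<lambda>c. c * th 1 c * th 2 c"] by simp
  then have "b 1 * th 1 (b 1) * th 2 (b 3) + b 2 * th 1 (b 4) * th 2 (b 4) = 0"
    by (simp add: d_def neg_eq_iff_add_eq_0)
  with b23 b1 b4 show "b 2 = 0" "b 3 = 0" by auto
qed

end

section \<open>Points and collineations\<close>

lemma pt_eq_range: "pt v = range (\<lambda>c. c *s v)"
  by (simp add: pt_def vec.span_singleton)

lemma pt_eq_iff:
  fixes v w :: "'a::field ^ 'n"
  assumes "v \<noteq> 0" "w \<noteq> 0"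
  shows "pt v = pt w \<longleftrightarrow> (\<exists>c. c \<noteq> 0 \<and> w = c *s v)"
proof
  assume "pt v = pt w"
  then have "w \<in> pt v" by (metis pt_def insertI1 vec.span_base)
  then obtain c where "w = c *s v" by (auto simp: pt_eq_range)
  with assms show "\<exists>c. c \<noteq> 0 \<and> w = c *s v" by auto
next
  assume "\<exists>c. c \<noteq> 0 \<and> w = c *s v"
  then obtain c where c: "c \<noteq> 0" "w = c *s v" by auto
  show "pt v = pt w" unfolding pt_eq_range
  proof (intro subset_antisym image_subsetI)
    fix x
    show "x *s v \<in> range (\<lambda>x. x *s w)" using c by (intro image_eqI[of _ _ "x / c"]) auto
    show "x *s w \<in> range (\<lambda>x. x *s v)" using c by (intro image_eqI[of _ _ "x * c"]) auto
  qed
qed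

lemma pg_points_eq: "pg_points = pt ` (UNIV - {0})"
proof (intro set_eqI iffI)
  fix P :: "('a ^ 'n) set" assume "P \<in> pg_points"
  then have P: "vec.subspace P" "vec.dim P = 1" by (auto simp: pg_points_def)
  obtain B where B: "B \<subseteq> P" "vec.independent B" "P \<subseteq> vec.span B" "card B = 1"
    using vec.basis_exists[of P] P(2) by metis
  then obtain b where b: "B = {b}" by (auto simp: card_1_singleton_iff)
  have "P = pt b" using B b P(1) by (metis pt_def subset_antisym vec.span_minimal)
  moreover have "b \<noteq> 0" using B(2) b vec.dependent_zero by auto
  ultimately show "P \<in> pt ` (UNIV - {0})" by auto
next
  fix P :: "('a ^ 'n) set" assume "P \<in> pt ` (UNIV - {0})"
  then obtain v where v: "v \<noteq> 0" "P = pt v" by auto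
  then have "vec.dim P = 1"
    unfolding pt_def using vec.dim_span_eq_card_independent[of "{v}"] vec.dependent_single[of v] by simp
  then show "P \<in> pg_points" using v by (simp add: pg_points_def pt_def)
qed

definition dot2 :: "'a::field ^ 2 \<Rightarrow> 'a ^ 2 \<Rightarrow> 'a" where
  "dot2 c z = c $ 1 * z $ 1 + c $ 2 * z $ 2"

text \<open>For nonzero \<open>c\<close> it spans the kernel of \<open>dot2 c\<close>. Up to sign,
  \<open>dot2 c (perp2 m)\<close> is the determinant of \<open>c\<close> and \<open>m\<close>, so
  its being nonzero expresses that the two functionals are independent.\<close>

definition perp2 :: "'a::field ^ 2 \<Rightarrow> 'a ^ 2" where
  "perp2 c = vector [- c $ 2, c $ 1]"

lemma dot2_simps [simp]:
  "dot2 c (v + w) = dot2 c v + dot2 c w" "dot2 c (k *s w) = k * dot2 c w" "dot2 c 0 = 0"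
  "dot2 (perp2 c) c = 0" "dot2 c (perp2 c) = 0"
  by (simp_all add: dot2_def perp2_def algebra_simps)

lemma perp2_eq_0_iff [simp]: "perp2 c = 0 \<longleftrightarrow> c = 0"
  by (auto simp: perp2_def vec_eq_iff forall_2)

lemma dot2_eq_0_imp_perp2:
  assumes "c \<noteq> 0" "dot2 c z = 0"
  obtains k where "z = k *s perp2 c"
proof (cases "c $ 1 = 0")
  case True
  then have "c $ 2 \<noteq> 0" using assms(1) by (auto simp: vec_eq_iff forall_2)
  with True assms(2) have "z = (- z $ 1 / c $ 2) *s perp2 c"
    by (simp add: dot2_def perp2_def vec_eq_iff forall_2)
  then show ?thesis using that by blast
next
  case False
  with assms(2) have "z = (z $ 2 / c $ 1) *s perp2 c"
    by (simp add: dot2_def perp2_def vec_eq_iff forall_2 field_simps eq_neg_iff_add_eq_0)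
  then show ?thesis using that by blast
qed

lemma ex_dot2_eq_0: "\<exists>c. c \<noteq> 0 \<and> dot2 c (z :: 'a::field ^ 2) = 0"
proof (cases "z = 0")
  case True
  then show ?thesis by (intro exI[of _ 1]) auto
next
  case False
  then show ?thesis by (intro exI[of _ "perp2 z"]) auto
qed

lemma linear_dot2_pair:
  "Vector_Spaces.linear (*s) (*s) (\<lambda>z. vector [dot2 c z, dot2 m z] :: 'a::field ^ 2)"
  by unfold_locales (auto simp: vec_eq_iff forall_2)

lemma inj_dot2_pair:
  assumes "dot2 c (perp2 m) \<noteq> 0"
  shows "inj (\<lambda>z. vector [dot2 c z, dot2 m z] :: 'a::field ^ 2)"
proof (rule injI)
  fix x y :: "'a ^ 2"
  assume "(vector [dot2 c x, dot2 m x] :: 'a ^ 2) = vector [dot2 c y, dot2 m y]"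
  then have e: "dot2 c x = dot2 c y" "dot2 m x = dot2 m y" by (auto simp: vec_eq_iff forall_2)
  have m: "m \<noteq> 0"
  proof
    assume "m = 0"
    then have "perp2 m = 0" by simp
    with assms show False by simp
  qed
  have "dot2 m (x - y) = 0" using e(2) by (simp add: dot2_def algebra_simps)
  then obtain k where k: "x - y = k *s perp2 m" using dot2_eq_0_imp_perp2[OF m] by blast
  have "dot2 c (x - y) = 0" using e(1) by (simp add: dot2_def algebra_simps)
  then have "k = 0" using assms unfolding k by simp
  then show "x = y" using k by simp
qed

lemma image_pt:
  assumes "\<And>c. f (c *s v) = \<rho> c *s f v" and "surj \<rho>"
  shows "f ` pt v = pt (f v)"
proof -
  have "f ` pt v = (\<lambda>c. c *s f v) ` range \<rho>" by (auto simp: pt_eq_range assms(1) image_iff)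
  then show ?thesis by (simp add: assms(2) pt_eq_range)
qed

lemma linear_imp_PGammaL_equivalent:
  fixes g :: "'a::field ^ 'n \<Rightarrow> 'a ^ 'n"
  assumes g: "Vector_Spaces.linear (*s) (*s) g" "inj g" and X: "0 \<notin> X"
  shows "PGammaL_equivalent (pt ` X) (pt ` g ` X)"
proof -
  interpret g: Vector_Spaces.linear "(*s)" "(*s)" g by (rule g(1))
  have "surj g" using vec.linear_inj_imp_surj g by blast
  then have "semilinear_bij g" unfolding semilinear_bij_def field_automorphism_def
    using g(2) by (auto simp: bij_def g.add g.scale intro!: exI[of _ "\<lambda>x. x"])
  then have "induced_collineation g \<in> PGammaL" by (auto simp: PGammaL_def)
  moreover have "induced_collineation g (pt x) = pt (g x)" if "x \<in> X" for x
  proof -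
    have "pt x \<in> pg_points" using that X by (auto simp: pg_points_eq)
    then show ?thesis
      using image_pt[of g x "\<lambda>c. c"] by (simp add: induced_collineation_def g.scale)
  qed
  then have "induced_collineation g ` pt ` X = pt ` g ` X" by (force simp: image_iff)
  ultimately show ?thesis unfolding PGammaL_equivalent_def by blast
qed

text \<open>The five functionals together form an injective, hence bijective, linear map; the dual
  basis consists of the preimages of the unit vectors.\<close>

lemma dual_basis:
  fixes \<psi> :: "nat \<Rightarrow> 'a::field ^ 5 \<Rightarrow> 'a"
  assumes add: "\<And>k v w. \<psi> k (v + w) = \<psi> k v + \<psi> k w"
    and scale: "\<And>k c v. \<psi> k (c *s v) = c * \<psi> k v"
    and inj: "\<And>v. (\<And>k. k < 5 \<Longrightarrow> \<psi> k v = 0) \<Longrightarrow> v = 0"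
  obtains e where "\<And>j k. j < 5 \<Longrightarrow> k < 5 \<Longrightarrow> \<psi> j (e k) = of_bool (j = k)"
proof -
  \<comment> \<open>\<open>\<pi>\<close> translates between the index type \<open>5\<close> and the
    numbers below 5.\<close>
  obtain \<pi> :: "5 \<Rightarrow> nat" where \<pi>: "bij_betw \<pi> UNIV {..<5}"
    using ex_bij_betw_finite_nat[of "UNIV :: 5 set"] by (auto simp: atLeast0LessThan)
  have \<pi>ex: "\<exists>i. k = \<pi> i" if "k < 5" for k
    using that \<pi> by (auto simp: bij_betw_def image_def set_eq_iff)
  define \<Psi> :: "'a ^ 5 \<Rightarrow> 'a ^ 5" where "\<Psi> v = (\<chi> i. \<psi> (\<pi> i) v)" for v
  have lin: "Vector_Spaces.linear (*s) (*s) \<Psi>"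
    by unfold_locales (auto simp: \<Psi>_def vec_eq_iff add scale)
  interpret P: Vector_Spaces.linear "(*s)" "(*s)" \<Psi> by (rule lin)
  have "inj \<Psi>" unfolding P.inj_iff_eq_0
  proof (intro allI impI)
    fix v assume "\<Psi> v = 0"
    then have "\<psi> (\<pi> i) v = 0" for i by (auto simp: \<Psi>_def vec_eq_iff)
    then have "\<psi> k v = 0" if "k < 5" for k using \<pi>ex[OF that] by auto
    then show "v = 0" by (rule inj)
  qed
  then have "surj \<Psi>" using vec.linear_inj_imp_surj lin by blast
  define e where "e k = inv \<Psi> (\<chi> i. of_bool (\<pi> i = k))" for k
  have e: "\<Psi> (e k) = (\<chi> i. of_bool (\<pi> i = k))" for k
    unfolding e_def by (rule surj_f_inv_f[OF \<open>surj \<Psi>\<close>])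
  have "\<psi> j (e k) = of_bool (j = k)" if "j < 5" for j k
  proof -
    obtain i where i: "j = \<pi> i" using \<pi>ex[OF \<open>j < 5\<close>] by auto
    from arg_cong[OF e[of k], of "\<lambda>v. v $ i"] show ?thesis by (simp add: \<Psi>_def i)
  qed
  then show ?thesis using that by blast
qed

text \<open>Transports the number of points of a linear set to its image under a coordinate change
  or to its set of slopes.\<close>

lemma card_image_eq_same_kernel:
  assumes "\<And>x y. x \<in> A \<Longrightarrow> y \<in> A \<Longrightarrow> f x = f y \<longleftrightarrow> g x = g y"
  shows "card (f ` A) = card (g ` A)"
proof (rule bij_betw_same_card[of "\<lambda>z. g (inv_into A f z)"], rule bij_betw_imageI)
  have i: "inv_into A f (f x) \<in> A" "f (inv_into A f (f x)) = f x" if "x \<in> A" for x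
    using that by (auto intro: inv_into_into f_inv_into_f)
  have *: "g (inv_into A f (f x)) = g x" if "x \<in> A" for x
    using i[OF that] assms that by blast
  show "inj_on (\<lambda>z. g (inv_into A f z)) (f ` A)" by (auto simp: inj_on_def * assms)
  show "(\<lambda>z. g (inv_into A f z)) ` f ` A = g ` A" by (force simp: * image_iff)
qed

section \<open>Scattered linear sets as projections of a subgeometry\<close>

text \<open>The fixed vectors of \<open>S\<close> represent the subgeometry, and
  \<open>card_fixed\<close> says that they have dimension 5 over \<open>Fq q\<close>. The kernel of
  \<phi> is the plane of projection: \<open>\<phi>_fixed\<close> says that it misses the
  subgeometry, and \<open>card_points\<close> that the projected set is maximum scattered.\<close>

locale scattered_projection = frobenius_generator q F s
  for q and F :: "'a::{field,finite} itself" and s +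
  fixes S :: "'a ^ 5 \<Rightarrow> 'a ^ 5" and \<phi> :: "'a ^ 5 \<Rightarrow> 'a ^ 2"
  assumes S_add: "S (v + w) = S v + S w"
    and S_scale: "S (c *s v) = frob q s c *s S v"
    and S_5: "(S ^^ 5) v = v"
    and card_fixed: "card {v. S v = v} = q ^ 5"
    and linear_\<phi>: "Vector_Spaces.linear (*s) (*s) \<phi>"
    and surj_\<phi>: "surj \<phi>"
    and dim_ker: "vec.dim {v. \<phi> v = 0} = 3"
    and \<phi>_fixed: "S v = v \<Longrightarrow> v \<noteq> 0 \<Longrightarrow> \<phi> v \<noteq> 0"
    and card_points: "card (pt ` \<phi> ` ({v. S v = v} - {0})) = (q ^ 5 - 1) div (q - 1)"
begin

sublocale \<phi>: Vector_Spaces.linear "(*s)" "(*s)" \<phi> by (rule linear_\<phi>)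

abbreviation "R \<equiv> {v. S v = v}"
abbreviation "L \<equiv> pt ` \<phi> ` (R - {0})"

lemma S_zero [simp]: "S 0 = 0" using S_scale[of 0 0] by simp

lemma S_minus: "S (- v) = - S v"
  by (metis S_add S_zero add.right_inverse add_eq_0_iff)

lemma S_diff: "S (v - w) = S v - S w"
  using S_add[of v "- w"] by (simp add: S_minus)

lemma S_th: "S (c *s v) = th 1 c *s S v" by (simp add: S_scale th_def)

lemma Spow_add: "(S ^^ k) (v + w) = (S ^^ k) v + (S ^^ k) w"
  by (induction k) (auto simp: S_add)

lemma Spow_th: "(S ^^ k) (c *s v) = th k c *s (S ^^ k) v"
  by (induction k) (auto simp: S_th add.commute)

lemma Spow_5_add: "(S ^^ (k + 5)) v = (S ^^ k) v"
  by (simp only: funpow_add o_apply S_5)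

lemma Spow_mod: "(S ^^ (k mod 5)) v = (S ^^ k) v"
  by (rule funpow_mod_eq[OF S_5])

lemma Spow_eq_0_iff: "(S ^^ k) v = 0 \<longleftrightarrow> v = 0"
proof
  assume "(S ^^ k) v = 0"
  moreover have z: "(S ^^ m) 0 = 0" for m by (induction m) auto
  ultimately have "(S ^^ (4 * k)) ((S ^^ k) v) = 0" by simp
  then have "(S ^^ (4 * k + k)) v = 0" by (simp only: funpow_add o_apply)
  moreover have "(4 * k + k) mod 5 = 0" by simp
  ultimately show "v = 0" using Spow_mod[of "4 * k + k" v] by simp
next
  assume "v = 0" then show "(S ^^ k) v = 0" by (induction k arbitrary: v) auto
qed

text \<open>\<open>S\<close> moves each summand to the next one, and \<open>S_5\<close> closes the
  cycle.\<close>

lemma trace_vector_fixed: "S (\<Sum>i<5. th i c *s (S ^^ i) v) = (\<Sum>i<5. th i c *s (S ^^ i) v)"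
proof -
  have "(S ^^ 5) v = v" by (rule S_5)
  then have S5: "S (S (S (S (S v)))) = v" by (simp add: eval_nat_numeral)
  have it: "(S ^^ 2) v = S (S v)" "(S ^^ 3) v = S (S (S v))" "(S ^^ 4) v = S (S (S (S v)))"
    by (simp_all add: eval_nat_numeral)
  show ?thesis by (simp add: sum_lessThan_5 S_add S_th it S5 ac_simps)
qed

text \<open>The fixed vectors span the whole space: evaluated at trace vectors, the hypothesis is a
  relation between the powers of \<theta> with coefficients \<open>h ((S ^^ i) v)\<close>, which
  must all vanish.\<close>

lemma functional_vanishing_on_fixed:
  assumes "\<And>v w. h (v + w) = h v + h w" and "\<And>c v. h (c *s v) = c * (h v :: 'a)"
    and "\<And>u. S u = u \<Longrightarrow> h u = 0"
  shows "h v = 0"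
proof -
  have h0: "h 0 = 0" using assms(2)[of 0 0] by simp
  have hs: "h (sum f A) = (\<Sum>a\<in>A. h (f a))" for f and A :: "nat set"
    by (induction A rule: infinite_finite_induct) (auto simp: h0 assms(1))
  have "(\<Sum>i<5. h ((S ^^ i) v) * th i c) = 0" for c
    using assms(3)[OF trace_vector_fixed[of c v]] by (simp add: hs assms(2) mult.commute)
  from th_independent[OF this, of 0] show ?thesis by simp
qed

lemma trace_vectors_vanish:
  assumes "\<And>c. (\<Sum>i<5. th i c *s (S ^^ i) v) = 0"
  shows "v = 0"
  using th_independent_vec[of "\<lambda>i. (S ^^ i) v" 0] assms by simp

lemma fixed_scale: "S v = v \<Longrightarrow> t \<in> Fq q \<Longrightarrow> S (t *s v) = t *s v"
  by (simp add: S_th th_Fq)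

text \<open>The fibre over each point contains \<open>q - 1\<close> multiples by
  \<open>Fq q\<close>; these already use up all nonzero fixed vectors.\<close>

lemma scattered:
  assumes v: "S v = v" "v \<noteq> 0" and w: "S w = w" "w \<noteq> 0" and eq: "pt (\<phi> v) = pt (\<phi> w)"
  obtains t where "t \<in> Fq q" "w = t *s v"
proof -
  let ?A = "R - {0}" and ?f = "\<lambda>v. pt (\<phi> v)"
  have img: "?f ` ?A = L" by auto
  have fib: "(\<lambda>t. t *s v) ` (Fq q - {0}) \<subseteq> {x \<in> ?A. ?f x = ?f v}"
    "card ((\<lambda>t. t *s v) ` (Fq q - {0})) = q - 1" if "v \<in> ?A" for v
  proof -
    show "(\<lambda>t. t *s v) ` (Fq q - {0}) \<subseteq> {x \<in> ?A. ?f x = ?f v}"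
    proof (intro image_subsetI CollectI conjI)
      fix t :: 'a assume t: "t \<in> Fq q - {0}"
      then show "t *s v \<in> ?A" using that fixed_scale[of v t] by simp
      show "?f (t *s v) = ?f v"
        using t that \<phi>_fixed[of v] by (subst eq_commute, subst pt_eq_iff) (auto simp: \<phi>.scale)
    qed
    show "card ((\<lambda>t. t *s v) ` (Fq q - {0})) = q - 1"
      using that by (subst card_image) (auto simp: inj_on_def card_Fq_nonzero)
  qed
  have "card {x \<in> ?A. ?f x = ?f v} = q - 1"
  proof (rule card_fibres_eq)
    have "card ?A = q ^ 5 - 1" by (subst card_Diff_singleton) (simp_all add: card_fixed)
    then show "card ?A = card (?f ` ?A) * (q - 1)"
      unfolding img card_points repunit_mult .
    fix y assume "y \<in> ?f ` ?A"
    then obtain x where "x \<in> ?A" "y = ?f x" by auto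
    with fib[of x] card_mono[OF _ fib(1)[of x]] show "q - 1 \<le> card {x \<in> ?A. ?f x = y}" by simp
  qed (use v in auto)
  with fib[of v] v have "(\<lambda>t. t *s v) ` (Fq q - {0}) = {x \<in> ?A. ?f x = ?f v}"
    by (intro card_subset_eq) auto
  moreover have "w \<in> {x \<in> ?A. ?f x = ?f v}" using w eq by simp
  ultimately show ?thesis using that by blast
qed

text \<open>Images killed by \<open>dot2 m\<close> are multiples of \<open>perp2 m\<close>, so
  nonzero fixed vectors in this hyperplane all give the same point.\<close>

lemma fixed_in_hyperplane:
  assumes m: "m \<noteq> 0" and v: "S v = v" "v \<noteq> 0" "dot2 m (\<phi> v) = 0"
    and w: "S w = w" "dot2 m (\<phi> w) = 0"
  obtains t where "t \<in> Fq q" "w = t *s v"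
proof (cases "w = 0")
  case True
  then show ?thesis using that[of 0] by (simp add: Fq_iff)
next
  case False
  obtain k l where k: "\<phi> v = k *s perp2 m" and l: "\<phi> w = l *s perp2 m"
    using dot2_eq_0_imp_perp2[OF m] v w by metis
  have n: "\<phi> v \<noteq> 0" "\<phi> w \<noteq> 0" using \<phi>_fixed v w False by auto
  then have "k \<noteq> 0" "l \<noteq> 0" using k l by auto
  then have "pt (\<phi> v) = pt (\<phi> w)"
    unfolding pt_eq_iff[OF n] by (intro exI[of _ "l / k"]) (simp add: k l)
  with scattered[OF v(1,2) w(1) False] that show ?thesis by blast
qed

lemma coprime_s: "coprime s 5"
proof -
  have "s \<in> {1, 2, 3, 4}" using s by auto
  then show ?thesis
    by (elim insertE emptyE) (simp_all add: coprime_iff_gcd_eq_1 gcd_non_0_nat)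
qed

lemma zero_notin_image: "0 \<notin> \<phi> ` (R - {0})"
proof
  assume "0 \<in> \<phi> ` (R - {0})"
  then obtain u where "0 = \<phi> u" "u \<in> R - {0}" by (rule imageE)
  with \<phi>_fixed[of u] show False by simp
qed

text \<open>In the coordinates given by \<open>c\<close> and \<open>m\<close> every point of
  \<open>L\<close> is spanned by some \<open>(x, th 1 x)\<close>. There are at most as many such
  points as points of \<open>L\<close>, so the inclusion is an equality.\<close>

lemma pseudoregulus_criterion:
  assumes c: "dot2 c (perp2 m) \<noteq> 0"
    and rel: "\<And>u. S u = u \<Longrightarrow> dot2 m (\<phi> u) = th 1 (dot2 c (\<phi> u))"
  shows "pseudoregulus_type q L"
proof -
  let ?g = "\<lambda>z. vector [dot2 c z, dot2 m z] :: 'a ^ 2"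
  let ?pr = "\<lambda>x. vector [x, x ^ (q ^ s)] :: 'a ^ 2"
  have prn: "?pr x \<noteq> 0" if "x \<noteq> 0" for x using that by (auto simp: vec_eq_iff forall_2)
  have gn: "?g z \<noteq> 0" if "z \<noteq> 0" for z
  proof
    assume "?g z = 0"
    then have "?g z = ?g 0" by (simp add: vec_eq_iff forall_2)
    with injD[OF inj_dot2_pair[OF c]] that show False by blast
  qed
  have gpr: "\<exists>x\<noteq>0. ?g z = ?pr x" if z: "z \<in> \<phi> ` (R - {0})" for z
  proof -
    obtain u where u: "S u = u" "u \<noteq> 0" "z = \<phi> u" using z by auto
    have e: "?g z = ?pr (dot2 c z)" using rel[OF u(1)] u(3) by (simp add: th_def frob_def)
    moreover have "dot2 c z \<noteq> 0"
    proof
      assume "dot2 c z = 0"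
      then have "?g z = 0" using rel[OF u(1)] unfolding u(3) by (simp add: vec_eq_iff forall_2)
      then show False using gn[of z] \<phi>_fixed[OF u(1,2)] u(3) by simp
    qed
    ultimately show ?thesis by blast
  qed
  have sub: "pt ` ?g ` \<phi> ` (R - {0}) \<subseteq> {pt (?pr x) | x. x \<noteq> 0}"
    using gpr by (force simp: image_iff)
  \<comment> \<open>The \<open>q - 1\<close> nonzero \<open>Fq q\<close>-multiples of
    \<open>x\<close> all give the same point.\<close>
  have "card {pt (?pr x) | x. x \<noteq> 0} \<le> (q ^ 5 - 1) div (q - 1)"
  proof -
    let ?P = "\<lambda>x. pt (?pr x)"
    have img: "{?P x | x. x \<noteq> 0} = ?P ` (UNIV - {0})" by auto
    have "q - 1 \<le> card {x \<in> UNIV - {0}. ?P x = y}" if y: "y \<in> ?P ` (UNIV - {0})" for y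
    proof -
      obtain x where x: "x \<noteq> 0" "y = ?P x" using y by auto
      have "(\<lambda>t. t * x) ` (Fq q - {0}) \<subseteq> {x \<in> UNIV - {0}. ?P x = y}"
      proof (intro image_subsetI CollectI conjI)
        fix t :: 'a assume t: "t \<in> Fq q - {0}"
        then show "t * x \<in> UNIV - {0}" using x by simp
        have "?pr (t * x) = t *s ?pr x"
          using t fr_Fq[of t s] by (simp add: vec_eq_iff forall_2 power_mult_distrib frob_def)
        then show "?P (t * x) = y"
          using t x prn[of x] prn[of "t * x"] by (subst eq_commute, simp only: x(2), subst pt_eq_iff) auto
      qed
      then have "card ((\<lambda>t. t * x) ` (Fq q - {0})) \<le> card {x \<in> UNIV - {0}. ?P x = y}"
        by (intro card_mono) auto
      moreover have "card ((\<lambda>t. t * x) ` (Fq q - {0})) = q - 1"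
        using x by (subst card_image) (auto simp: inj_on_def card_Fq_nonzero)
      ultimately show ?thesis by simp
    qed
    then have "(\<Sum>y\<in>?P ` (UNIV - {0}). q - 1) \<le> (\<Sum>y\<in>?P ` (UNIV - {0}). card {x \<in> UNIV - {0}. ?P x = y})"
      by (rule sum_mono)
    also have "\<dots> = card (UNIV - {0::'a})"
      using sum.image_gen[of "UNIV - {0}" "\<lambda>_. 1::nat" ?P] by simp
    finally have "card (?P ` (UNIV - {0})) * (q - 1) \<le> (q ^ 5 - 1) div (q - 1) * (q - 1)"
      by (simp add: repunit_mult[simplified] card_field)
    then show ?thesis unfolding img using q_ge_2 by simp
  qed
  \<comment> \<open>The coordinate change is injective and linear, so it keeps distinct points
    distinct.\<close>
  moreover have "card (pt ` ?g ` \<phi> ` (R - {0})) = (q ^ 5 - 1) div (q - 1)"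
    unfolding card_points[symmetric] image_image
  proof (rule card_image_eq_same_kernel)
    fix v w assume vw: "v \<in> R - {0}" "w \<in> R - {0}"
    then have n: "\<phi> v \<noteq> 0" "\<phi> w \<noteq> 0" using \<phi>_fixed by auto
    have "?g (\<phi> w) = k *s ?g (\<phi> v) \<longleftrightarrow> \<phi> w = k *s \<phi> v" for k
    proof -
      have "k *s ?g (\<phi> v) = ?g (k *s \<phi> v)" by (simp add: vec_eq_iff forall_2)
      with inj_eq[OF inj_dot2_pair[OF c], of "\<phi> w" "k *s \<phi> v"] show ?thesis by (simp only:)
    qed
    then show "pt (?g (\<phi> v)) = pt (?g (\<phi> w)) \<longleftrightarrow> pt (\<phi> v) = pt (\<phi> w)"
      by (simp only: pt_eq_iff n gn not_False_eq_True)
  qed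
  ultimately have "pt ` ?g ` \<phi> ` (R - {0}) = {pt (?pr x) | x. x \<noteq> 0}"
    using sub by (intro card_seteq) auto
  moreover have "PGammaL_equivalent L (pt ` ?g ` \<phi> ` (R - {0}))"
    by (rule linear_imp_PGammaL_equivalent[OF linear_dot2_pair inj_dot2_pair[OF c]])
      (rule zero_notin_image)
  moreover note coprime_s
  ultimately show ?thesis unfolding pseudoregulus_type_def using s by auto
qed

text \<open>A common vector exists because two linear conditions are imposed on a space of dimension
  3. With two independent ones, a functional of \<open>\<phi> (S v)\<close> vanishes on the kernel
  of \<phi> and factors through \<phi>, which relates two coordinates of \<open>\<phi> u\<close> by
  \<theta> on fixed vectors \<open>u\<close>.\<close>

lemma kernel_meets_shift:
  assumes np: "\<not> pseudoregulus_type q L"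
  obtains a where "a \<noteq> 0" "{v. \<phi> v = 0 \<and> \<phi> (S v) = 0} = vec.span {a}"
proof -
  let ?W = "{v. \<phi> v = 0}"
  \<comment> \<open>Untwisting by \<open>th 4\<close>, the inverse of \<theta>, makes
    \<open>\<phi> (S v)\<close> linear in \<open>v\<close> without changing its zeros.\<close>
  define \<phi>' :: "'a ^ 5 \<Rightarrow> 'a ^ 2" where "\<phi>' v = (\<chi> i. th 4 (\<phi> (S v) $ i))" for v
  have lin': "Vector_Spaces.linear (*s) (*s) \<phi>'"
    by unfold_locales (auto simp: \<phi>'_def vec_eq_iff S_add S_th \<phi>.add \<phi>.scale th_hom)
  interpret \<phi>': Vector_Spaces.linear "(*s)" "(*s)" \<phi>' by (rule lin')
  have \<phi>'0: "\<phi>' v = 0 \<longleftrightarrow> \<phi> (S v) = 0" for v by (auto simp: \<phi>'_def vec_eq_iff)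
  have subW: "vec.subspace ?W" by (rule \<phi>.subspace_kernel)
  have "\<not> inj_on \<phi>' (vec.span ?W)"
  proof
    assume "inj_on \<phi>' (vec.span ?W)"
    from vec.dim_image_eq[OF lin' this] have "vec.dim (\<phi>' ` ?W) = 3" by (simp add: dim_ker)
    moreover have "vec.dim (\<phi>' ` ?W) \<le> vec.dim (UNIV :: ('a ^ 2) set)" by (rule vec.dim_subset) simp
    ultimately show False unfolding vec_dim_card by simp
  qed
  then obtain v w where "v \<in> ?W" "w \<in> ?W" "\<phi>' v = \<phi>' w" "v \<noteq> w"
    unfolding vec.span_eq_iff[THEN iffD2, OF subW] inj_on_def by blast
  then have a: "\<phi> (v - w) = 0" "\<phi>' (v - w) = 0" "v - w \<noteq> 0" by (auto simp: \<phi>.diff \<phi>'.diff)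
  define a where "a = v - w"
  have "v \<in> vec.span {a}" if v: "\<phi> v = 0" "\<phi> (S v) = 0" for v
  proof (rule ccontr)
    assume nv: "v \<notin> vec.span {a}"
    then have av: "v \<noteq> a" by (metis insertI1 vec.span_base)
    have "vec.independent {v, a}"
      using nv a by (simp add: vec.independent_insert a_def)
    moreover have "{v, a} \<subseteq> ?W" using v a by (auto simp: a_def)
    ultimately obtain B where B: "{v, a} \<subseteq> B" "B \<subseteq> ?W" "vec.independent B" "?W \<subseteq> vec.span B"
      using vec.maximal_independent_subset_extend by metis
    have cB: "card B = 3" using vec.basis_card_eq_dim[OF B(2,4,3)] dim_ker by simp
    have "card (B - {v, a}) = 1" using B(1) cB av by (subst card_Diff_subset) auto
    then obtain b where b: "B - {v, a} = {b}" by (rule card_1_singletonE)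
    \<comment> \<open>\<open>\<phi>'\<close> kills \<open>v\<close> and \<open>a\<close>, so it
      sends the kernel of \<phi> into the span of \<open>\<phi>' b\<close>, which some nonzero
      functional annihilates.\<close>
    obtain c' where c': "c' \<noteq> 0" "dot2 c' (\<phi>' b) = 0" using ex_dot2_eq_0[of "\<phi>' b"] by blast
    define h where "h x = dot2 c' (\<phi>' x)" for x
    have h: "h (x + y) = h x + h y" "h (k *s x) = k * h x" for x y k
      by (simp_all add: h_def \<phi>'.add \<phi>'.scale)
    have hB: "h x = 0" if "x \<in> B" for x
    proof -
      have "x = v \<or> x = a \<or> x = b" using that b by blast
      moreover have "h v = 0" "h a = 0" using \<phi>'0[of v] v(2) a(2) by (simp_all add: h_def a_def)
      moreover have "h b = 0" using c'(2) by (simp add: h_def)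
      ultimately show ?thesis by blast
    qed
    have "vec.subspace {x. h x = 0}"
      unfolding vec.subspace_def using h(2)[of 0 0] by (auto simp: h)
    then have "vec.span B \<subseteq> {x. h x = 0}" using hB by (intro vec.span_minimal) auto
    then have hW: "h x = 0" if "\<phi> x = 0" for x using that B(4) by auto
    obtain i1 i2 where i: "\<phi> i1 = vector [1, 0]" "\<phi> i2 = vector [0, 1]" using surj_\<phi> by (metis surjD)
    \<comment> \<open>As \<open>h\<close> vanishes on the kernel of \<phi>, it is a functional of
      \<open>\<phi> x\<close>; its coefficients are read off at preimages of the unit
      vectors.\<close>
    define c :: "'a ^ 2" where "c = vector [h i1, h i2]"
    have hc: "h x = dot2 c (\<phi> x)" for x
    proof -
      have "\<phi> (x - ((\<phi> x $ 1) *s i1 + (\<phi> x $ 2) *s i2)) = 0"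
        by (simp add: \<phi>.diff \<phi>.add \<phi>.scale i vec_eq_iff forall_2)
      then have "h (x - ((\<phi> x $ 1) *s i1 + (\<phi> x $ 2) *s i2)) = 0" by (rule hW)
      moreover have "h (x - y) = h x - h y" for x y
        using h(1)[of "x - y" y] by simp
      ultimately show ?thesis by (simp add: h c_def dot2_def mult.commute)
    qed
    define m :: "'a ^ 2" where "m = (\<chi> i. th 1 (c' $ i))"
    have m0: "m \<noteq> 0" using c'(1) by (auto simp: m_def vec_eq_iff)
    have rel: "dot2 m (\<phi> u) = th 1 (dot2 c (\<phi> u))" if "S u = u" for u
      unfolding hc[symmetric] using that by (simp add: h_def dot2_def \<phi>'_def m_def th_hom)
    show False
    proof (cases "dot2 c (perp2 m) = 0")
      case False
      then show False using pseudoregulus_criterion[OF False rel] np by blast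
    next
      case True
      then have "dot2 m (perp2 c) = 0" by (simp add: dot2_def perp2_def algebra_simps)
      then obtain k where "perp2 c = k *s perp2 m" using dot2_eq_0_imp_perp2[OF m0] by blast
      then have "c = k *s m" by (auto simp: perp2_def vec_eq_iff forall_2)
      then have ck: "dot2 c z = k * dot2 m z" for z by (simp add: dot2_def algebra_simps)
      \<comment> \<open>Proportional functionals: the values \<open>?y u\<close> solve one twisted
        fixed-point equation and so lie in a single \<open>Fq q\<close>-line. By scatteredness each
        fibre of \<open>?y\<close> has at most \<open>q\<close> elements, which leaves at most
        \<open>q ^ 2\<close> fixed vectors.\<close>
      let ?y = "\<lambda>u. dot2 m (\<phi> u)"
      have y: "?y u = th 1 k * th 1 (?y u)" if "S u = u" for u
        using rel[OF that] by (simp add: ck th_mult)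
      have "\<exists>u. S u = u \<and> ?y u \<noteq> 0"
      proof (rule ccontr)
        assume "\<not> ?thesis"
        then have "?y v = 0" for v
          using functional_vanishing_on_fixed[of ?y v] by (auto simp: \<phi>.add \<phi>.scale)
        from this[of i1] this[of i2] show False using m0
          by (auto simp: i dot2_def vec_eq_iff forall_2)
      qed
      then obtain u0 where u0: "S u0 = u0" "?y u0 \<noteq> 0" by blast
      have "?y ` R \<subseteq> (\<lambda>t. t * ?y u0) ` Fq q"
      proof (intro image_subsetI)
        fix u assume "u \<in> R"
        then have yu: "th 1 k * th 1 (?y u) = ?y u" using y[of u] by simp
        have "th 1 (?y u) * ?y u0 = th 1 (?y u) * (th 1 k * th 1 (?y u0))"
          using y[OF u0(1)] by (rule arg_cong)
        also have "\<dots> = (th 1 k * th 1 (?y u)) * th 1 (?y u0)" by (simp only: mult_ac)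
        also have "\<dots> = ?y u * th 1 (?y u0)" by (simp only: yu)
        finally have "th 1 (?y u / ?y u0) = ?y u / ?y u0"
          using u0(2) by (simp add: th_divide frac_eq_eq)
        then have "?y u / ?y u0 \<in> Fq q" by (simp only: th_1_fixed)
        then show "?y u \<in> (\<lambda>t. t * ?y u0) ` Fq q" using u0(2) by (intro image_eqI) auto
      qed
      from card_mono[OF _ this] have im: "card (?y ` R) \<le> q"
        using card_image_le[of "Fq q" "\<lambda>t. t * ?y u0"] by (simp add: card_Fq)
      have K: "card {u \<in> R. ?y u = 0} \<le> q"
      proof (cases "\<exists>u\<in>R. u \<noteq> 0 \<and> ?y u = 0")
        case True
        then obtain u where u: "S u = u" "u \<noteq> 0" "?y u = 0" by auto
        have "{u \<in> R. ?y u = 0} \<subseteq> (\<lambda>t. t *s u) ` Fq q"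
          using fixed_in_hyperplane[OF m0 u] by blast
        from card_mono[OF _ this] show ?thesis
          using card_image_le[of "Fq q" "\<lambda>t. t *s u"] by (simp add: card_Fq)
      next
        case False
        then have "{u \<in> R. ?y u = 0} \<subseteq> {0}" by auto
        then have "card {u \<in> R. ?y u = 0} \<le> card {0::'a ^ 5}" by (intro card_mono) auto
        then show ?thesis using q_ge_2 by simp
      qed
      have "card {u \<in> R. ?y u = z} \<le> q" if z: "z \<in> ?y ` R" for z
      proof -
        obtain u where u: "S u = u" "z = ?y u" using z by auto
        have "(\<lambda>x. x - u) ` {u \<in> R. ?y u = z} \<subseteq> {u \<in> R. ?y u = 0}"
          using u by (auto simp: S_diff \<phi>.diff dot2_def algebra_simps)
        then have "card {u \<in> R. ?y u = z} \<le> card {u \<in> R. ?y u = 0}"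
          by (intro card_inj_on_le[of "\<lambda>x. x - u"]) (auto simp: inj_on_def)
        with K show ?thesis by simp
      qed
      then have "card R \<le> card (?y ` R) * q" by (intro card_le_fibres) auto
      also have "\<dots> \<le> q * q" using im by simp
      finally have "q ^ 5 \<le> q ^ 2" by (simp add: card_fixed power2_eq_square)
      then show False using q_ge_2 by simp
    qed
  qed
  then have "{v. \<phi> v = 0 \<and> \<phi> (S v) = 0} \<subseteq> vec.span {a}" by blast
  moreover have "\<phi> a = 0" "\<phi> (S a) = 0" using a \<phi>'0[of a] by (simp_all add: a_def)
  then have "vec.span {a} \<subseteq> {v. \<phi> v = 0 \<and> \<phi> (S v) = 0}"
    by (auto simp: vec.span_singleton \<phi>.scale S_th)
  ultimately show ?thesis using that[of a] a(3) by (auto simp: a_def)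
qed

lemma power_5_minus_s: "x ^ (q ^ (5 - s)) = th 4 x"
proof -
  have "(5 - s) mod 5 = (s * 4) mod 5"
  proof -
    have "s \<in> {1, 2, 3, 4}" using s by auto
    then show ?thesis by auto
  qed
  from fr_cong[OF this, of x] show ?thesis by (simp add: th_def frob_def)
qed

text \<open>The combination \<open>w\<close> makes the images of \<open>a2\<close> and
  \<open>a4\<close> dependent, hence multiples of one vector \<open>r\<close>. With
  \<open>p\<close>, the image of \<open>a3\<close>, it forms the frame in which \<open>L\<close>
  takes LP form.\<close>

lemma lp_if_collinear:
  assumes np: "\<not> pseudoregulus_type q L"
    and a: "a \<noteq> 0" "\<phi> a = 0" "\<phi> (S a) = 0"
    and w: "\<alpha> *s (S ^^ 2) a + \<beta> *s (S ^^ 4) a \<noteq> 0" "\<phi> (\<alpha> *s (S ^^ 2) a + \<beta> *s (S ^^ 4) a) = 0"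
  shows "LP_type q L"
proof -
  define a2 a3 a4 where "a2 = (S ^^ 2) a" and "a3 = (S ^^ 3) a" and "a4 = (S ^^ 4) a"
  have \<phi>w: "\<alpha> *s \<phi> a2 + \<beta> *s \<phi> a4 = 0" using w(2) by (simp add: a2_def a4_def \<phi>.add \<phi>.scale)
  have "\<exists>c. c \<noteq> 0 \<and> dot2 c (\<phi> a2) = 0 \<and> dot2 c (\<phi> a4) = 0"
  proof (cases "\<alpha> = 0")
    case True
    then have "\<beta> \<noteq> 0" using w(1) by auto
    obtain c where c: "c \<noteq> 0" "dot2 c (\<phi> a2) = 0" using ex_dot2_eq_0[of "\<phi> a2"] by blast
    have "\<beta> * dot2 c (\<phi> a4) = 0" using arg_cong[OF \<phi>w, of "dot2 c"] True by simp
    with c \<open>\<beta> \<noteq> 0\<close> show ?thesis by auto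
  next
    case False
    obtain c where c: "c \<noteq> 0" "dot2 c (\<phi> a4) = 0" using ex_dot2_eq_0[of "\<phi> a4"] by blast
    have "\<alpha> * dot2 c (\<phi> a2) = 0" using arg_cong[OF \<phi>w, of "dot2 c"] c by simp
    with c False show ?thesis by auto
  qed
  then obtain c where c: "c \<noteq> 0" "dot2 c (\<phi> a2) = 0" "dot2 c (\<phi> a4) = 0" by blast
  define r where "r = perp2 c"
  define p where "p = \<phi> a3"
  obtain k2 where k2: "\<phi> a2 = k2 *s r" using dot2_eq_0_imp_perp2[OF c(1,2)] r_def by blast
  obtain k4 where k4: "\<phi> a4 = k4 *s r" using dot2_eq_0_imp_perp2[OF c(1,3)] r_def by blast
  \<comment> \<open>Trace vectors will parametrise the fixed vectors; in their images the terms of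
    \<open>a\<close> and \<open>S a\<close> drop out.\<close>
  define u where "u x = (\<Sum>i<5. th i x *s (S ^^ i) a)" for x
  have uR: "S (u x) = u x" for x unfolding u_def by (rule trace_vector_fixed)
  have \<phi>u: "\<phi> (u x) = th 3 x *s p + (k2 * th 2 x + k4 * th 4 x) *s r" for x
    unfolding u_def sum_lessThan_5
    by (simp add: \<phi>.add \<phi>.scale a a2_def[symmetric] a3_def[symmetric] a4_def[symmetric] p_def[symmetric] k2 k4
        vec_eq_iff algebra_simps)
  have cr: "dot2 c r = 0" by (simp add: r_def)
  define w0 where "w0 = dot2 c p"
  \<comment> \<open>Otherwise all \<open>u x\<close> lie in one hyperplane and are
    \<open>Fq q\<close>-multiples of a single \<open>u x0\<close>. Independence applied to the 2 by
    2 minors then makes \<open>a\<close> proportional to \<open>u x0\<close>, but \<phi> kills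
    \<open>a\<close> and not \<open>u x0\<close>.\<close>
  have w0: "w0 \<noteq> 0"
  proof
    assume w00: "w0 = 0"
    have cu: "dot2 c (\<phi> (u x)) = 0" for x using w00 cr by (simp add: \<phi>u w0_def)
    obtain x0 where x0: "u x0 \<noteq> 0" using trace_vectors_vanish[of a] a(1) u_def by auto
    then obtain j where j: "u x0 $ j \<noteq> 0" by (auto simp: vec_eq_iff)
    have "a $ k * u x0 $ j = a $ j * u x0 $ k" for k
    proof -
      have "(\<Sum>i<5. ((S ^^ i) a $ k * u x0 $ j - (S ^^ i) a $ j * u x0 $ k) * th i x) = 0" for x
      proof -
        obtain t where t: "u x = t *s u x0"
          using fixed_in_hyperplane[OF c(1) uR x0 cu uR cu] by blast
        have "(\<Sum>i<5. ((S ^^ i) a $ k * u x0 $ j - (S ^^ i) a $ j * u x0 $ k) * th i x) =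
            u x $ k * u x0 $ j - u x $ j * u x0 $ k"
          by (simp add: u_def[of x] sum_component sum_distrib_left sum_subtractf algebra_simps)
        then show ?thesis by (simp add: t)
      qed
      from th_independent[OF this, of 0] show ?thesis by simp
    qed
    then have ja: "(u x0 $ j) *s a = (a $ j) *s u x0" by (simp add: vec_eq_iff mult.commute)
    from arg_cong[OF this, of \<phi>] have "(a $ j) *s \<phi> (u x0) = 0" by (simp add: \<phi>.scale a)
    then have "a $ j = 0" using \<phi>_fixed[OF uR x0] by simp
    with ja j a(1) show False by simp
  qed
  have cu: "dot2 c (\<phi> (u x)) = th 3 x * w0" for x by (simp add: \<phi>u cr w0_def)
  have inj_u: "inj u"
  proof (rule injI)
    fix x y assume "u x = u y"
    then have "th 3 x * w0 = th 3 y * w0" using cu by metis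
    then show "x = y" using w0 th_inj by simp
  qed
  have "range u = R"
  proof (rule card_subset_eq)
    show "card (range u) = card R" using inj_u by (simp add: card_image card_field card_fixed)
  qed (use uR in auto)
  moreover have u00: "u 0 = 0" by (simp add: u_def)
  ultimately have uim: "u ` (UNIV - {0}) = R - {0}" using inj_u by (simp add: image_set_diff)
  have th2im: "th 2 ` (UNIV - {0}) = UNIV - {0}"
  proof (intro set_eqI iffI)
    fix x assume "x \<in> UNIV - {0::'a}"
    then show "x \<in> th 2 ` (UNIV - {0})" by (intro image_eqI[of _ _ "th 3 x"]) auto
  qed auto
  \<comment> \<open>Putting \<open>x = th 2 y\<close> turns the coefficient of \<open>p\<close> into
    \<open>y\<close> and leaves the exponents 4 and 1 at \<open>r\<close>.\<close>
  define f where "f y = y *s p + (k2 * th 4 y + k4 * th 1 y) *s r" for y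
  have f_u: "f y = \<phi> (u (th 2 y))" for y by (simp add: \<phi>u f_def)
  have fim: "\<phi> ` (R - {0}) = f ` (UNIV - {0})"
    unfolding uim[symmetric] by (subst (1) th2im[symmetric]) (simp add: image_image f_u)
  define c' where "c' = perp2 p"
  have c'r: "dot2 c' r = w0" by (simp add: c'_def r_def w0_def perp2_def dot2_def algebra_simps)
  have c'p: "dot2 c' p = 0" by (simp add: c'_def)
  have df: "dot2 c (f y) = y * w0" "dot2 c' (f y) = (k2 * th 4 y + k4 * th 1 y) * w0" for y
    by (simp_all add: f_def cr c'r c'p w0_def distrib_right)
  have Rf: "\<exists>y. \<phi> v = f y" if "S v = v" for v
  proof (cases "v = 0")
    case True
    then show ?thesis by (intro exI[of _ 0]) (simp add: f_def)
  next
    case False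
    then have "\<phi> v \<in> \<phi> ` (R - {0})" using that by blast
    then show ?thesis unfolding fim by blast
  qed
  \<comment> \<open>\<open>n\<close> and \<open>m k\<close> are the coordinates dual to the frame
    \<open>p\<close>, \<open>k *s r\<close>.\<close>
  define n where "n = (1 / w0) *s c"
  have nf: "dot2 n (f y) = y" for y
    using df(1)[of y] w0 by (simp add: n_def dot2_def field_simps)
  define m where "m k = (1 / (k * w0)) *s c'" for k
  have mf: "dot2 (m k) (f y) = (k2 * th 4 y + k4 * th 1 y) / k" for k y
  proof -
    have "dot2 (m k) z = dot2 c' z / (k * w0)" for z by (simp add: m_def dot2_def add_divide_distrib)
    then show ?thesis using w0 by (simp add: df)
  qed
  have pc: "dot2 c (perp2 c') \<noteq> 0"
    using w0 by (simp add: c'_def w0_def dot2_def perp2_def algebra_simps neg_eq_iff_add_eq_0)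
  have nm: "dot2 n (perp2 (m k)) \<noteq> 0" "dot2 (m k) (perp2 n) \<noteq> 0" if "k \<noteq> 0" for k
  proof -
    have "dot2 n (perp2 (m k)) = dot2 c (perp2 c') / (w0 * (k * w0))"
      using w0 that by (simp add: n_def m_def perp2_def dot2_def field_simps)
    then show *: "dot2 n (perp2 (m k)) \<noteq> 0" using pc w0 that by simp
    have "dot2 (m k) (perp2 n) = - dot2 n (perp2 (m k))" by (simp add: perp2_def dot2_def)
    with * show "dot2 (m k) (perp2 n) \<noteq> 0" by simp
  qed
  \<comment> \<open>If both coefficients vanish, \<phi> is not surjective. If only \<open>k4\<close>
    does, then \<open>y = th 1 (th 4 y)\<close> gives the pseudoregulus relation with the two
    coordinates interchanged.\<close>
  have k4n: "k4 \<noteq> 0"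
  proof
    assume k40: "k4 = 0"
    show False
    proof (cases "k2 = 0")
      case True
      have "dot2 c' (\<phi> v) = 0" for v
      proof (rule functional_vanishing_on_fixed[of "\<lambda>v. dot2 c' (\<phi> v)"])
        fix u assume "S u = u"
        from Rf[OF this] show "dot2 c' (\<phi> u) = 0" using True k40 by (auto simp: df)
      qed (simp_all add: \<phi>.add \<phi>.scale)
      moreover obtain v where "\<phi> v = r" using surj_\<phi> by (metis surjD)
      ultimately show False using c'r w0 by metis
    next
      case False
      have "dot2 n (\<phi> u) = th 1 (dot2 (m k2) (\<phi> u))" if "S u = u" for u
        using Rf[OF that] False k40 by (auto simp: nf mf)
      from pseudoregulus_criterion[OF nm(2)[OF False] this] np show False by blast
    qed
  qed
  \<comment> \<open>With \<open>k2 = 0\<close> the second coordinate is \<open>th 1 y\<close>, again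
    a pseudoregulus relation.\<close>
  have k2n: "k2 \<noteq> 0"
  proof
    assume k20: "k2 = 0"
    have "dot2 (m k4) (\<phi> u) = th 1 (dot2 n (\<phi> u))" if "S u = u" for u
      using Rf[OF that] k4n k20 by (auto simp: nf mf)
    from pseudoregulus_criterion[OF nm(1)[OF k4n] this] np show False by blast
  qed
  define \<delta> where "\<delta> = k2 / k4"
  let ?g = "\<lambda>z. vector [dot2 n z, dot2 (m k4) z] :: 'a ^ 2"
  have gf: "?g (f y) = vector [y, y ^ (q ^ s) + \<delta> * y ^ (q ^ (5 - s))]" for y
    using k4n by (simp add: nf mf power_5_minus_s \<delta>_def add_divide_distrib th_def frob_def add.commute)
  have "PGammaL_equivalent L (pt ` ?g ` \<phi> ` (R - {0}))"
    by (rule linear_imp_PGammaL_equivalent[OF linear_dot2_pair inj_dot2_pair[OF nm(1)[OF k4n]]])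
      (rule zero_notin_image)
  moreover have "pt ` ?g ` \<phi> ` (R - {0}) =
      {pt (vector [x, x ^ (q ^ s) + \<delta> * x ^ (q ^ (5 - s))]) | x. x \<noteq> 0}"
    unfolding fim image_image gf by auto
  moreover have "norm5 q \<delta> \<noteq> 0"
    using k2n k4n by (simp add: norm5_def \<delta>_def)
  moreover have "norm5 q \<delta> \<noteq> 1"
  proof
    assume "norm5 q \<delta> = 1"
    then have "nrm \<delta> = 1" by (simp add: norm5_eq_nrm)
    then obtain x y where xy: "x \<noteq> 0" "y \<noteq> 0" "y / x \<notin> Fq q"
      "x * (th 1 y + \<delta> * th 4 y) = y * (th 1 x + \<delta> * th 4 x)"
      by (rule lp_not_scattered)
    have fd: "f z = z *s p + (k4 * (th 1 z + \<delta> * th 4 z)) *s r" for z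
      using k4n by (simp add: f_def \<delta>_def algebra_simps)
    have "th 1 y + \<delta> * th 4 y = y / x * (th 1 x + \<delta> * th 4 x)"
      using xy by (simp add: field_simps)
    then have fyx: "f y = (y / x) *s f x" unfolding fd using xy(1)
      by (simp add: vec_eq_iff algebra_simps)
    let ?U = "u (th 2 x)" and ?V = "u (th 2 y)"
    have U0: "?U \<noteq> 0" "?V \<noteq> 0"
      using xy inj_u u00 by (metis injD th_eq_0_iff)+
    have "\<phi> ?U \<noteq> 0" "\<phi> ?V \<noteq> 0" using \<phi>_fixed[OF uR] U0 by auto
    then have "pt (\<phi> ?U) = pt (\<phi> ?V)" unfolding f_u[symmetric]
      by (subst pt_eq_iff) (use fyx xy in \<open>auto intro!: exI[of _ "y / x"]\<close>)
    then obtain t where t: "t \<in> Fq q" "?V = t *s ?U"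
      using scattered[OF uR U0(1) uR U0(2)] by blast
    from arg_cong[OF t(2), of "\<lambda>v. dot2 c (\<phi> v)"] have "y * w0 = t * (x * w0)"
      by (simp add: \<phi>.scale f_u[symmetric] df)
    then have "y / x = t" using xy(1) w0 by (simp add: field_simps)
    with t(1) xy(3) show False by simp
  qed
  ultimately show ?thesis unfolding LP_type_def using s coprime_s by auto
qed

text \<open>Once the companion automorphism of the equivalence is removed, \<open>\<chi>1\<close>
  and \<open>\<chi>2\<close> are linear coordinates with LP slopes. Expressing
  \<open>\<chi>2\<close> by \<open>\<chi>1\<close> on fixed vectors gives coefficients
  \<open>b k\<close> to which the power sum comparison applies.\<close>

lemma collinear_if_lp:
  assumes \<delta>: "\<delta> \<noteq> 0"
    and equiv: "PGammaL_equivalent L {pt (vector [x, x ^ (q ^ s) + \<delta> * x ^ (q ^ (5 - s))]) | x. x \<noteq> 0}"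
  obtains a \<alpha> \<beta> where "a \<noteq> 0" "\<phi> a = 0" "\<phi> (S a) = 0"
    "\<alpha> *s (S ^^ 2) a + \<beta> *s (S ^^ 4) a \<noteq> 0" "\<phi> (\<alpha> *s (S ^^ 2) a + \<beta> *s (S ^^ 4) a) = 0"
proof -
  let ?lp = "\<lambda>x. vector [x, th 1 x + \<delta> * th 4 x] :: 'a ^ 2"
  obtain h where h: "semilinear_bij h" "induced_collineation h ` L = pt ` ?lp ` (UNIV - {0})"
  proof -
    have "{pt (vector [x, x ^ (q ^ s) + \<delta> * x ^ (q ^ (5 - s))] :: 'a ^ 2) | x. x \<noteq> 0} = pt ` ?lp ` (UNIV - {0})"
      unfolding power_5_minus_s by (auto simp: th_def frob_def)
    with equiv that show ?thesis by (auto simp: PGammaL_equivalent_def PGammaL_def)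
  qed
  obtain \<rho> where \<rho>: "field_automorphism \<rho>" and h_scale: "\<And>c v. h (c *s v) = \<rho> c *s h v"
    and h_add: "\<And>v w. h (v + w) = h v + h w" and h_bij: "bij h"
    using h(1) by (auto simp: semilinear_bij_def)
  have \<rho>_bij: "bij \<rho>" and \<rho>_add: "\<rho> (x + y) = \<rho> x + \<rho> y" and \<rho>_mult: "\<rho> (x * y) = \<rho> x * \<rho> y"
    and \<rho>_one: "\<rho> 1 = 1" for x y
    using \<rho> by (auto simp: field_automorphism_def)
  define \<rho>' where "\<rho>' = inv \<rho>"
  have \<rho>\<rho>': "\<rho> (\<rho>' x) = x" and \<rho>'\<rho>: "\<rho>' (\<rho> x) = x" for x
    using \<rho>_bij by (simp_all add: \<rho>'_def bij_is_surj surj_f_inv_f bij_is_inj)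
  have \<rho>'_add: "\<rho>' (x + y) = \<rho>' x + \<rho>' y" for x y
    using \<rho>_add[of "\<rho>' x" "\<rho>' y"] \<rho>'\<rho>[of "\<rho>' x + \<rho>' y"] by (simp add: \<rho>\<rho>')
  have \<rho>'_mult: "\<rho>' (x * y) = \<rho>' x * \<rho>' y" for x y
    using \<rho>_mult[of "\<rho>' x" "\<rho>' y"] \<rho>'\<rho>[of "\<rho>' x * \<rho>' y"] by (simp add: \<rho>\<rho>')
  have \<rho>'_one: "\<rho>' 1 = 1" using \<rho>'\<rho>[of 1] by (simp add: \<rho>_one)
  have \<rho>0: "\<rho> 0 = 0" using \<rho>_add[of 0 0] by (simp only: add_0_right add_cancel_right_right)
  have \<rho>'0: "\<rho>' x = 0 \<longleftrightarrow> x = 0" for x using \<rho>\<rho>'[of x] \<rho>'\<rho>[of 0] \<rho>0 by auto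
  have \<rho>'_pow: "\<rho>' (x ^ n) = \<rho>' x ^ n" for x n by (induction n) (auto simp: \<rho>'_mult \<rho>'_one)
  have \<rho>'_th: "\<rho>' (th i x) = th i (\<rho>' x)" for i x by (simp add: th_def frob_def \<rho>'_pow)
  define \<delta>' where "\<delta>' = \<rho>' \<delta>"
  let ?f = "\<lambda>y. th 1 y + \<delta>' * th 4 y"
  \<comment> \<open>Applying \<open>\<rho>'\<close> makes the coordinates of
    \<open>h (\<phi> v)\<close> linear. It commutes with the powers of \<theta>, so the LP form
    survives with \<open>\<delta>'\<close> in place of \<delta>.\<close>
  define \<chi>1 \<chi>2 where "\<chi>1 v = \<rho>' (h (\<phi> v) $ 1)" and "\<chi>2 v = \<rho>' (h (\<phi> v) $ 2)" for v
  have \<chi>_add: "\<chi>1 (v + w) = \<chi>1 v + \<chi>1 w" "\<chi>2 (v + w) = \<chi>2 v + \<chi>2 w" for v w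
    by (simp_all add: \<chi>1_def \<chi>2_def \<phi>.add h_add \<rho>'_add)
  have \<chi>_scale: "\<chi>1 (k *s v) = k * \<chi>1 v" "\<chi>2 (k *s v) = k * \<chi>2 v" for k v
    by (simp_all add: \<chi>1_def \<chi>2_def \<phi>.scale h_scale \<rho>'_mult \<rho>'\<rho>)
  have h0: "h 0 = 0" using h_scale[of 0 0] by (simp add: \<rho>0)
  have h_eq_0: "h z = 0 \<longleftrightarrow> z = 0" for z using h_bij h0 by (metis bij_is_inj injD)
  have \<chi>_ker: "\<phi> v = 0" if "\<chi>1 v = 0" "\<chi>2 v = 0" for v
  proof -
    have "h (\<phi> v) = 0" using that by (simp add: \<chi>1_def \<chi>2_def \<rho>'0 vec_eq_iff forall_2)
    then show ?thesis by (simp add: h_eq_0)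
  qed
  have coll: "induced_collineation h (pt z) = pt (h z)" if "z \<noteq> 0" for z
  proof -
    have "pt z \<in> pg_points" using that by (auto simp: pg_points_eq)
    then show ?thesis
      using image_pt[of h z \<rho>] h_scale \<rho>_bij by (simp add: induced_collineation_def bij_is_surj)
  qed
  have pts: "pt ` h ` \<phi> ` (R - {0}) = pt ` ?lp ` (UNIV - {0})"
  proof -
    have "induced_collineation h (pt z) = pt (h z)" if "z \<in> \<phi> ` (R - {0})" for z
    proof (rule coll, rule notI)
      assume "z = 0"
      then show False using that zero_notin_image by blast
    qed
    then have "(\<lambda>z. induced_collineation h (pt z)) ` \<phi> ` (R - {0}) = (\<lambda>z. pt (h z)) ` \<phi> ` (R - {0})"
      by (rule image_cong[OF refl])
    then have "induced_collineation h ` L = pt ` h ` \<phi> ` (R - {0})"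
      by (simp only: image_image)
    with h(2) show ?thesis by simp
  qed
  have lpn: "?lp x \<noteq> 0" if "x \<noteq> 0" for x using that by (auto simp: vec_eq_iff forall_2)
  have ratio: "\<chi>1 v \<noteq> 0 \<and> \<chi>2 v / \<chi>1 v = ?f (\<rho>' x) / \<rho>' x"
    if v: "v \<in> R - {0}" "x \<noteq> 0" "pt (h (\<phi> v)) = pt (?lp x)" for v x
  proof -
    have "h (\<phi> v) \<noteq> 0" using \<phi>_fixed[of v] v(1) by (auto simp: h_eq_0)
    then obtain k where k: "k \<noteq> 0" "h (\<phi> v) = k *s ?lp x"
      using v(3) pt_eq_iff[OF lpn[OF v(2)]] by metis
    have "\<chi>1 v = \<rho>' k * \<rho>' x" "\<chi>2 v = \<rho>' k * ?f (\<rho>' x)"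
      by (simp_all add: \<chi>1_def \<chi>2_def k \<rho>'_mult \<rho>'_add \<rho>'_th \<delta>'_def)
    then show ?thesis using k v(2) by (simp add: \<rho>'0)
  qed
  have \<chi>1n: "\<chi>1 v \<noteq> 0" if v: "v \<in> R - {0}" for v
  proof -
    have "pt (h (\<phi> v)) \<in> pt ` ?lp ` (UNIV - {0})" unfolding pts[symmetric] using v by blast
    then show ?thesis using ratio[OF v] by auto
  qed
  have rim: "(\<lambda>v. \<chi>2 v / \<chi>1 v) ` (R - {0}) = (\<lambda>y. ?f y / y) ` (UNIV - {0})"
  proof (intro subset_antisym image_subsetI)
    fix v assume v: "v \<in> R - {0}"
    then have "pt (h (\<phi> v)) \<in> pt ` ?lp ` (UNIV - {0})" unfolding pts[symmetric] by blast
    then obtain x where "x \<noteq> 0" "pt (h (\<phi> v)) = pt (?lp x)" by auto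
    with ratio[OF v] \<rho>'0[of x] show "\<chi>2 v / \<chi>1 v \<in> (\<lambda>y. ?f y / y) ` (UNIV - {0})" by blast
  next
    fix y assume y: "y \<in> UNIV - {0::'a}"
    have \<rho>y: "\<rho> y \<noteq> 0" using y \<rho>'0[of "\<rho> y"] by (simp add: \<rho>'\<rho>)
    then have "pt (?lp (\<rho> y)) \<in> pt ` h ` \<phi> ` (R - {0})" unfolding pts by blast
    then obtain v where v: "v \<in> R - {0}" "pt (h (\<phi> v)) = pt (?lp (\<rho> y))" by auto
    have "?f y / y = \<chi>2 v / \<chi>1 v" using ratio[OF v(1) \<rho>y v(2)] by (simp add: \<rho>'\<rho>)
    then show "?f y / y \<in> (\<lambda>v. \<chi>2 v / \<chi>1 v) ` (R - {0})" using v(1) by (rule image_eqI)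
  qed
  \<comment> \<open>\<open>\<chi>1\<close> has no zero among the nonzero fixed vectors, so slopes
    correspond one to one to points of \<open>L\<close>.\<close>
  have rcard: "card ((\<lambda>v. \<chi>2 v / \<chi>1 v) ` (R - {0})) = (q ^ 5 - 1) div (q - 1)"
    unfolding card_points[symmetric] image_image
  proof (rule card_image_eq_same_kernel)
    fix v w assume vw: "v \<in> R - {0}" "w \<in> R - {0}"
    then have n: "\<phi> v \<noteq> 0" "\<phi> w \<noteq> 0" using \<phi>_fixed by auto
    show "\<chi>2 v / \<chi>1 v = \<chi>2 w / \<chi>1 w \<longleftrightarrow> pt (\<phi> v) = pt (\<phi> w)"
    proof
      assume e: "\<chi>2 v / \<chi>1 v = \<chi>2 w / \<chi>1 w"
      define k where "k = \<chi>1 w / \<chi>1 v"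
      have "\<chi>1 (w - k *s v) = 0" "\<chi>2 (w - k *s v) = 0"
      proof -
        have d: "\<chi>1 (x - y) = \<chi>1 x - \<chi>1 y" "\<chi>2 (x - y) = \<chi>2 x - \<chi>2 y" for x y
          using \<chi>_add[of "x - y" y] by simp_all
        show "\<chi>1 (w - k *s v) = 0" "\<chi>2 (w - k *s v) = 0"
          using e \<chi>1n[OF vw(1)] \<chi>1n[OF vw(2)] by (simp_all add: d \<chi>_scale k_def field_simps)
      qed
      then have "\<phi> w = k *s \<phi> v" using \<chi>_ker[of "w - k *s v"] by (simp add: \<phi>.diff \<phi>.scale)
      moreover have "k \<noteq> 0" using \<chi>1n vw by (simp add: k_def)
      ultimately show "pt (\<phi> v) = pt (\<phi> w)" using pt_eq_iff[OF n] by blast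
    next
      assume "pt (\<phi> v) = pt (\<phi> w)"
      then obtain k where "k \<noteq> 0" "\<phi> w = k *s \<phi> v" using pt_eq_iff[OF n] by blast
      then have "\<chi>1 w = k * \<chi>1 v" "\<chi>2 w = k * \<chi>2 v"
        by (simp_all add: \<chi>1_def \<chi>2_def h_scale \<rho>'_mult \<rho>'\<rho>)
      with \<open>k \<noteq> 0\<close> show "\<chi>2 v / \<chi>1 v = \<chi>2 w / \<chi>1 w" by simp
    qed
  qed
  have \<chi>z: "\<chi>1 0 = 0" "\<chi>2 0 = 0" using \<chi>_scale[of 0 0] by simp_all
  \<comment> \<open>\<open>\<chi>1\<close> identifies the fixed vectors with the field: it is
    additive, has no nonzero root there, and both sets have \<open>q ^ 5\<close> elements.\<close>
  have \<chi>1_inj: "inj_on \<chi>1 R"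
  proof (rule inj_onI)
    fix v w assume vw: "v \<in> R" "w \<in> R" "\<chi>1 v = \<chi>1 w"
    have "\<chi>1 (v - w) = 0" using \<chi>_add(1)[of "v - w" w] vw(3) by simp
    moreover have "v - w \<in> R" using vw by (simp add: S_diff)
    ultimately have "v - w = 0" using \<chi>1n[of "v - w"] by blast
    then show "v = w" by simp
  qed
  have \<chi>1_R: "\<chi>1 ` R = UNIV"
    using card_image[OF \<chi>1_inj] by (intro card_subset_eq) (auto simp: card_fixed card_field)
  have \<chi>1_R0: "\<chi>1 ` (R - {0}) = UNIV - {0}"
    using \<chi>1_R inj_on_image_set_diff[OF \<chi>1_inj, of R "{0}"] \<chi>z by simp
  \<comment> \<open>The linear functional that agrees with \<open>th k (\<chi>1 u)\<close> on fixed
    \<open>u\<close>: \<open>th k\<close> undoes the twist of \<open>S ^^ (5 - k)\<close>.\<close>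
  define \<psi> where "\<psi> k v = th k (\<chi>1 ((S ^^ (5 - k)) v))" for k v
  have \<psi>_add: "\<psi> k (v + w) = \<psi> k v + \<psi> k w" for k v w
    by (simp add: \<psi>_def Spow_add \<chi>_add th_add)
  have \<psi>_scale: "\<psi> k (c *s v) = c * \<psi> k v" if "k < 5" for k c v
  proof -
    have "th k (th (5 - k) c) = c" using that by simp
    then show ?thesis by (simp add: \<psi>_def Spow_th \<chi>_scale th_mult del: th_th)
  qed
  \<comment> \<open>A common zero makes \<open>\<chi>1\<close> vanish at all trace vectors of
    \<open>v\<close>. These are fixed, hence zero, and so is \<open>v\<close>.\<close>
  have \<psi>_inj: "v = 0" if \<psi>0: "\<And>k. k < 5 \<Longrightarrow> \<psi> k v = 0" for v
  proof -
    have z: "\<chi>1 ((S ^^ i) v) = 0" if "i < 5" for i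
    proof (cases "i = 0")
      case True
      then show ?thesis using \<psi>0[of 0] S_5 by (simp add: \<psi>_def)
    next
      case False
      then show ?thesis using \<psi>0[of "5 - i"] that by (simp add: \<psi>_def)
    qed
    have "(\<Sum>i<5. th i c *s (S ^^ i) v) = 0" for c
    proof -
      have "\<chi>1 (\<Sum>i<5. th i c *s (S ^^ i) v) = 0"
        unfolding sum_lessThan_5 \<chi>_add \<chi>_scale using z z[of 0] z[of 1] by simp
      then show ?thesis using \<chi>1n[of "\<Sum>i<5. th i c *s (S ^^ i) v"] trace_vector_fixed[of c v] by blast
    qed
    then show "v = 0" by (rule trace_vectors_vanish)
  qed
  \<comment> \<open>\<open>dual_basis\<close> asks for linearity at every index, so zero functionals
    are put from 5 on.\<close>
  define \<psi>' where "\<psi>' k = (if k < 5 then \<psi> k else (\<lambda>_. 0))" for k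
  obtain e where "\<And>j k. j < 5 \<Longrightarrow> k < 5 \<Longrightarrow> \<psi>' j (e k) = of_bool (j = k)"
    by (rule dual_basis[of \<psi>']) (use \<psi>_add \<psi>_scale \<psi>_inj in \<open>auto simp: \<psi>'_def\<close>)
  then have e: "\<psi> j (e k) = of_bool (j = k)" if "j < 5" "k < 5" for j k
    using that by (auto simp: \<psi>'_def)
  have \<psi>_eq: "v = w" if "\<And>k. k < 5 \<Longrightarrow> \<psi> k v = \<psi> k w" for v w
  proof -
    have "\<psi> k (v - w) = 0" if "k < 5" for k
      using \<psi>_add[of k "v - w" w] \<open>\<And>k. k < 5 \<Longrightarrow> \<psi> k v = \<psi> k w\<close>[OF that] by simp
    then have "v - w = 0" by (rule \<psi>_inj)
    then show ?thesis by simp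
  qed
  have expand: "v = (\<Sum>k<5. \<psi> k v *s e k)" for v
    by (rule \<psi>_eq) (auto simp: sum_lessThan_5 \<psi>_add \<psi>_scale e less_Suc_eq eval_nat_numeral)
  \<comment> \<open>On a fixed vector with \<open>\<chi>1 u = y\<close>, the expansion of
    \<open>\<chi>2\<close> becomes the sum of the \<open>b k * th k y\<close>.\<close>
  define b where "b k = \<chi>2 (e k)" for k
  have \<chi>2_sum: "\<chi>2 v = (\<Sum>k<5. b k * \<psi> k v)" for v
    by (subst expand[of v]) (simp add: sum_lessThan_5 \<chi>_add \<chi>_scale b_def mult.commute)
  have \<psi>_R: "\<psi> k u = th k (\<chi>1 u)" if "S u = u" for k u
  proof -
    have "(S ^^ m) u = u" for m using that by (induction m) auto
    then show ?thesis by (simp add: \<psi>_def)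
  qed
  have "(\<lambda>v. \<chi>2 v / \<chi>1 v) ` (R - {0}) = (\<lambda>v. (\<Sum>k<5. b k * th k (\<chi>1 v)) / \<chi>1 v) ` (R - {0})"
    by (rule image_cong) (auto simp: \<chi>2_sum \<psi>_R)
  also have "\<dots> = (\<lambda>y. (\<Sum>k<5. b k * th k y) / y) ` (UNIV - {0})"
    unfolding \<chi>1_R0[symmetric] image_image ..
  finally have im: "(\<lambda>v. \<chi>2 v / \<chi>1 v) ` (R - {0}) = (\<lambda>y. (\<Sum>k<5. b k * th k y) / y) ` (UNIV - {0})" .
  have "\<delta>' \<noteq> 0" using \<delta> by (simp add: \<delta>'_def \<rho>'0)
  note coeffs = lp_ratio_coefficients[OF this rim[unfolded im] rcard[unfolded im]]
  have \<psi>_S: "\<psi> j (S v) = th 1 (\<psi> (if j = 0 then 4 else j - 1) v)" if "j < 5" for j v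
  proof (cases j)
    case 0
    have "(S ^^ 5) (S v) = S v" by (rule S_5)
    then show ?thesis using 0 by (simp add: \<psi>_def)
  next
    case (Suc i)
    have "(S ^^ (5 - j)) (S v) = (S ^^ (5 - i)) v"
    proof -
      have "5 - i = Suc (5 - j)" using Suc that by simp
      then show ?thesis by (simp only: funpow_Suc_right o_apply)
    qed
    then show ?thesis using Suc by (simp add: \<psi>_def)
  qed
  \<comment> \<open>Composition with \<open>S\<close> shifts the functionals cyclically up to
    \<theta>, so \<open>S\<close> permutes the dual basis.\<close>
  have Se: "S (e k) = e (if k = 4 then 0 else k + 1)" if "k < 5" for k
    by (rule \<psi>_eq) (use that in \<open>auto simp: \<psi>_S e split: if_splits\<close>)
  have S2: "(S ^^ 2) (e 2) = e 4" "(S ^^ 4) (e 2) = e 1"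
    by (simp_all add: eval_nat_numeral Se[unfolded eval_nat_numeral])
  have \<psi>00: "\<chi>1 v = \<psi> 0 v" for v using S_5 by (simp add: \<psi>_def)
  show ?thesis
  \<comment> \<open>The kernel of \<phi> contains the common zeros of \<open>\<chi>1\<close> and
    \<open>\<chi>2\<close>. Among them are \<open>e 2\<close> and \<open>e 3\<close>, as
    \<open>b 2 = b 3 = 0\<close>; the weights \<open>b 1\<close> and \<open>- b 4\<close> cancel the
    values of \<open>\<chi>2\<close> at \<open>e 4\<close> and \<open>e 1\<close>.\<close>
  proof (rule that[of "e 2" "b 1" "- b 4"])
    show "e 2 \<noteq> 0" using e[of 2 2] \<psi>_scale[of 2 0 0] by auto
    show "\<phi> (e 2) = 0" by (rule \<chi>_ker) (use e[of 0 2] coeffs in \<open>simp_all add: \<psi>00 b_def\<close>)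
    have "S (e 2) = e 3" using Se[of 2] by simp
    moreover have "\<phi> (e 3) = 0" by (rule \<chi>_ker) (use e[of 0 3] coeffs in \<open>simp_all add: \<psi>00 b_def\<close>)
    ultimately show "\<phi> (S (e 2)) = 0" by simp
    let ?w = "b 1 *s (S ^^ 2) (e 2) + (- b 4) *s (S ^^ 4) (e 2)"
    have "(1::nat) < 5" by simp
    then have "\<psi> 1 ?w = - b 4" unfolding S2 \<psi>_add \<psi>_scale[OF \<open>1 < 5\<close>] using e[of 1 4] e[of 1 1] by simp
    then show "?w \<noteq> 0" using coeffs(5) \<psi>_scale[of 1 0 0] by auto
    show "\<phi> ?w = 0" unfolding S2
    proof (rule \<chi>_ker)
      show "\<chi>1 (b 1 *s e 4 + (- b 4) *s e 1) = 0"
        unfolding \<chi>_add \<chi>_scale unfolding \<psi>00 using e[of 0 4] e[of 0 1] by simp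
      show "\<chi>2 (b 1 *s e 4 + (- b 4) *s e 1) = 0"
        unfolding \<chi>_add \<chi>_scale b_def[symmetric] by simp
    qed
  qed
qed

text \<open>As \<open>j\<close> is invertible modulo 5, \<open>S\<close> is in turn a power of
  \<open>S ^^ j\<close>, so the fixed vectors and the projected set stay the same. This makes the
  results for \<open>S\<close> available for every generator.\<close>

lemma scattered_projection_power:
  assumes j: "j < 5" "j \<noteq> 0"
  shows "scattered_projection q (s * j mod 5) (S ^^ j) \<phi>"
    and "{v. (S ^^ j) v = v} = R"
proof -
  have "j \<in> {1, 2, 3, 4}" using j by auto
  then obtain m where m: "(m * j) mod 5 = 1"
  proof (elim insertE emptyE)
    assume "j = 1" then show thesis using that[of 1] by simp
  next
    assume "j = 2" then show thesis using that[of 3] by simp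
  next
    assume "j = 3" then show thesis using that[of 2] by simp
  next
    assume "j = 4" then show thesis using that[of 4] by simp
  qed
  show RR: "{v. (S ^^ j) v = v} = R"
  proof (intro set_eqI iffI CollectI; elim CollectE)
    fix v assume v: "(S ^^ j) v = v"
    then have "((S ^^ j) ^^ m) v = v" by (induction m) auto
    then have "(S ^^ (m * j)) v = v" by (simp add: funpow_mult mult.commute)
    then show "S v = v" using Spow_mod[of "m * j" v] m by simp
  next
    fix v assume "S v = v"
    then show "(S ^^ j) v = v" by (induction j) auto
  qed
  show "scattered_projection q (s * j mod 5) (S ^^ j) \<phi>"
  proof unfold_locales
    show "s * j mod 5 < 5" by simp
    have "s \<in> {1, 2, 3, 4}" using s by auto
    with \<open>j \<in> {1, 2, 3, 4}\<close> show "s * j mod 5 \<noteq> 0" by auto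
    fix v w c
    show "(S ^^ j) (v + w) = (S ^^ j) v + (S ^^ j) w" by (rule Spow_add)
    have "th j c = fr (s * j mod 5) c" unfolding th_def by (rule fr_cong) simp
    then show "(S ^^ j) (c *s v) = fr (s * j mod 5) c *s (S ^^ j) v" by (simp add: Spow_th)
    have "(S ^^ (j * 5)) v = v" using Spow_mod[of "j * 5" v] by simp
    then show "((S ^^ j) ^^ 5) v = v" by (simp add: funpow_mult)
    show "card {v. (S ^^ j) v = v} = q ^ 5" unfolding RR by (rule card_fixed)
    show "surj \<phi>" by (rule surj_\<phi>)
    show "vec.dim {v. \<phi> v = 0} = 3" by (rule dim_ker)
    show "card (pt ` \<phi> ` ({v. (S ^^ j) v = v} - {0})) = (q ^ 5 - 1) div (q - 1)"
      unfolding RR by (rule card_points)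
    assume "(S ^^ j) v = v" "v \<noteq> 0"
    moreover from this(1) have "v \<in> R" using RR by blast
    ultimately show "\<phi> v \<noteq> 0" using \<phi>_fixed by simp
  qed
qed

text \<open>
  \<open>shift_collinear 1\<close> is the condition on \<open>A\<close>; with \<open>S ^^ 2\<close> in place of \<open>S\<close>, the points \<open>B\<^sub>4, B\<^sub>3\<close> are the second
  and fourth images of \<open>B\<close>, so \<open>shift_collinear 2\<close> is the condition on \<open>B\<close>.
\<close>

definition shift_collinear :: "nat \<Rightarrow> bool" where
  "shift_collinear j \<longleftrightarrow> (\<exists>a \<alpha> \<beta>. a \<noteq> 0 \<and> \<phi> a = 0 \<and> \<phi> ((S ^^ j) a) = 0 \<and>
     \<alpha> *s (S ^^ (2 * j)) a + \<beta> *s (S ^^ (4 * j)) a \<noteq> 0 \<and>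
     \<phi> (\<alpha> *s (S ^^ (2 * j)) a + \<beta> *s (S ^^ (4 * j)) a) = 0)"

lemma Spow_Spow: "(S ^^ m) ((S ^^ n) v) = (S ^^ (m + n)) v" by (simp add: funpow_add)

lemma Spow_reduce: "5 \<le> k \<Longrightarrow> (S ^^ k) v = (S ^^ (k - 5)) v"
  using Spow_5_add[of "k - 5" v] by simp

text \<open>\<open>(S ^^ j) a\<close> replaces \<open>a\<close>: its second and fourth images under
  \<open>S ^^ (5 - j)\<close> are the fourth and second images of \<open>a\<close> under
  \<open>S ^^ j\<close>.\<close>

lemma shift_collinear_inverse:
  assumes "shift_collinear j" and j: "j < 5"
  shows "shift_collinear (5 - j)"
proof -
  obtain a \<alpha> \<beta> where a: "a \<noteq> 0" "\<phi> a = 0" "\<phi> ((S ^^ j) a) = 0"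
    and w: "\<alpha> *s (S ^^ (2 * j)) a + \<beta> *s (S ^^ (4 * j)) a \<noteq> 0"
      "\<phi> (\<alpha> *s (S ^^ (2 * j)) a + \<beta> *s (S ^^ (4 * j)) a) = 0"
    using assms(1) by (auto simp: shift_collinear_def)
  have "(S ^^ (2 * (5 - j))) ((S ^^ j) a) = (S ^^ (4 * j)) a"
    unfolding Spow_Spow
  proof (subst (1 2) Spow_mod[symmetric], rule arg_cong[where f = "\<lambda>n. (S ^^ n) a"])
    show "(2 * (5 - j) + j) mod 5 = (4 * j) mod 5"
    proof -
      have "j \<in> {0, 1, 2, 3, 4}" using j by auto
      then show ?thesis by auto
    qed
  qed
  moreover have "(S ^^ (4 * (5 - j))) ((S ^^ j) a) = (S ^^ (2 * j)) a"
    unfolding Spow_Spow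
  proof (subst (1 2) Spow_mod[symmetric], rule arg_cong[where f = "\<lambda>n. (S ^^ n) a"])
    show "(4 * (5 - j) + j) mod 5 = (2 * j) mod 5"
    proof -
      have "j \<in> {0, 1, 2, 3, 4}" using j by auto
      then show ?thesis by auto
    qed
  qed
  moreover have "(S ^^ (5 - j)) ((S ^^ j) a) = a" unfolding Spow_Spow using j S_5 by simp
  ultimately show ?thesis unfolding shift_collinear_def
    using a w by (intro exI[of _ "(S ^^ j) a"] exI[of _ \<beta>] exI[of _ \<alpha>]) (simp add: Spow_eq_0_iff add.commute)
qed

text \<open>The exponent of an LP form is an arbitrary nonzero residue, hence the companion exponent
  of some \<open>S ^^ j\<close>; passing to the inverse reduces \<open>j\<close> to 1 or 2.\<close>

lemma lp_type_iff_collinear: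
  assumes np: "\<not> pseudoregulus_type q L"
  shows "LP_type q L \<longleftrightarrow> shift_collinear 1 \<or> shift_collinear 2"
proof
  assume "LP_type q L"
  then obtain s' \<delta> where s': "s' < 5" "coprime s' 5" and \<delta>: "norm5 q \<delta> \<noteq> 0"
    and eq: "PGammaL_equivalent L {pt (vector [x, x ^ (q ^ s') + \<delta> * x ^ (q ^ (5 - s'))]) | x. x \<noteq> 0}"
    unfolding LP_type_def by auto
  have \<delta>0: "\<delta> \<noteq> 0" using \<delta> by (auto simp: norm5_def)
  have s'0: "s' \<noteq> 0"
  proof
    assume "s' = 0"
    with s'(2) show False by simp
  qed
  have "(\<lambda>n. s * n mod 5) ` {..<5} = {..<5}"
    by (rule endo_inj_surj[OF _ _ inj_on_mult_mod_5[OF s]]) auto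
  then have "s' \<in> (\<lambda>n. s * n mod 5) ` {..<5}" using s'(1) by simp
  then obtain j where j: "j < 5" "s' = s * j mod 5" by auto
  have j0: "j \<noteq> 0" using j s'0 by (intro notI) simp
  interpret T: scattered_projection q F "s * j mod 5" "S ^^ j" \<phi>
    by (rule scattered_projection_power(1)[OF j(1) j0])
  from scattered_projection_power(2)[OF j(1) j0] eq
  have "PGammaL_equivalent (pt ` \<phi> ` ({v. (S ^^ j) v = v} - {0}))
      {pt (vector [x, x ^ (q ^ (s * j mod 5)) + \<delta> * x ^ (q ^ (5 - s * j mod 5))]) | x. x \<noteq> 0}"
    by (simp only: j(2))
  from T.collinear_if_lp[OF \<delta>0 this] obtain a \<alpha> \<beta> where "a \<noteq> 0" "\<phi> a = 0" "\<phi> ((S ^^ j) a) = 0"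
    "\<alpha> *s ((S ^^ j) ^^ 2) a + \<beta> *s ((S ^^ j) ^^ 4) a \<noteq> 0"
    "\<phi> (\<alpha> *s ((S ^^ j) ^^ 2) a + \<beta> *s ((S ^^ j) ^^ 4) a) = 0" .
  then have cj: "shift_collinear j"
    unfolding shift_collinear_def funpow_mult mult.commute[of j] by blast
  have "j = 1 \<or> j = 2 \<or> j = 3 \<or> j = 4" using j(1) j0 by auto
  with cj shift_collinear_inverse[OF cj j(1)] show "shift_collinear 1 \<or> shift_collinear 2" by auto
next
  have "LP_type q L" if j: "j < 5" "j \<noteq> 0" and cj: "shift_collinear j" for j
  proof -
    interpret T: scattered_projection q F "s * j mod 5" "S ^^ j" \<phi>
      by (rule scattered_projection_power(1)[OF j])
    obtain a \<alpha> \<beta> where a: "a \<noteq> 0" "\<phi> a = 0" "\<phi> ((S ^^ j) a) = 0"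
      "\<alpha> *s ((S ^^ j) ^^ 2) a + \<beta> *s ((S ^^ j) ^^ 4) a \<noteq> 0"
      "\<phi> (\<alpha> *s ((S ^^ j) ^^ 2) a + \<beta> *s ((S ^^ j) ^^ 4) a) = 0"
      using cj unfolding shift_collinear_def funpow_mult mult.commute[of j] by blast
    have "\<not> pseudoregulus_type q T.L" unfolding scattered_projection_power(2)[OF j] by (rule np)
    from T.lp_if_collinear[OF this a] show ?thesis
      by (simp only: scattered_projection_power(2)[OF j])
  qed
  from this[of 1] this[of 2] show "LP_type q L" if "shift_collinear 1 \<or> shift_collinear 2" using that by auto
qed

lemma kernel_meets_power:
  assumes np: "\<not> pseudoregulus_type q L" and j: "j < 5" "j \<noteq> 0"
  obtains a where "a \<noteq> 0" "{v. \<phi> v = 0 \<and> \<phi> ((S ^^ j) v) = 0} = vec.span {a}"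
proof -
  interpret T: scattered_projection q F "s * j mod 5" "S ^^ j" \<phi>
    by (rule scattered_projection_power(1)[OF j])
  have "\<not> pseudoregulus_type q T.L" unfolding scattered_projection_power(2)[OF j] by (rule np)
  then show ?thesis by (rule T.kernel_meets_shift) (rule that)
qed

text \<open>The vector is unique up to a scalar, which semilinearity absorbs into the two
  coefficients.\<close>

lemma shift_collinear_iff:
  assumes a: "a \<noteq> 0" "{v. \<phi> v = 0 \<and> \<phi> ((S ^^ j) v) = 0} = vec.span {a}"
  shows "shift_collinear j \<longleftrightarrow> (\<exists>\<alpha> \<beta>. \<alpha> *s (S ^^ (2 * j)) a + \<beta> *s (S ^^ (4 * j)) a \<noteq> 0 \<and>
     \<phi> (\<alpha> *s (S ^^ (2 * j)) a + \<beta> *s (S ^^ (4 * j)) a) = 0)"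
proof
  assume "shift_collinear j"
  then obtain b \<alpha> \<beta> where b: "b \<noteq> 0" "\<phi> b = 0" "\<phi> ((S ^^ j) b) = 0"
    and w: "\<alpha> *s (S ^^ (2 * j)) b + \<beta> *s (S ^^ (4 * j)) b \<noteq> 0"
      "\<phi> (\<alpha> *s (S ^^ (2 * j)) b + \<beta> *s (S ^^ (4 * j)) b) = 0"
    by (auto simp: shift_collinear_def)
  have "b \<in> vec.span {a}" unfolding a(2)[symmetric] using b by simp
  then obtain k where "b = k *s a" by (auto simp: vec.span_singleton)
  with w show "\<exists>\<alpha> \<beta>. \<alpha> *s (S ^^ (2 * j)) a + \<beta> *s (S ^^ (4 * j)) a \<noteq> 0 \<and>
     \<phi> (\<alpha> *s (S ^^ (2 * j)) a + \<beta> *s (S ^^ (4 * j)) a) = 0"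
    by (intro exI[of _ "\<alpha> * th (2 * j) k"] exI[of _ "\<beta> * th (4 * j) k"])
      (simp add: Spow_th)
next
  have "a \<in> {v. \<phi> v = 0 \<and> \<phi> ((S ^^ j) v) = 0}" unfolding a(2) by (simp add: vec.span_base)
  then show "shift_collinear j" if "\<exists>\<alpha> \<beta>. \<alpha> *s (S ^^ (2 * j)) a + \<beta> *s (S ^^ (4 * j)) a \<noteq> 0 \<and>
     \<phi> (\<alpha> *s (S ^^ (2 * j)) a + \<beta> *s (S ^^ (4 * j)) a) = 0"
    using that a(1) unfolding shift_collinear_def by blast
qed

end

section \<open>Projection from a plane\<close>

lemma self_in_pt: "v \<in> pt v"
  by (simp add: pt_def vec.span_base)

lemma pt_subset_iff:
  assumes "vec.subspace W"
  shows "pt v \<subseteq> W \<longleftrightarrow> v \<in> W"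
proof
  assume "v \<in> W"
  then show "pt v \<subseteq> W" unfolding pt_def using assms by (intro vec.span_minimal) auto
qed (use self_in_pt[of v] in blast)

lemma points_in_subspace:
  assumes "vec.subspace W"
  shows "{P \<in> pg_points. P \<subseteq> W} = pt ` (W - {0})"
  using pt_subset_iff[OF assms] by (auto simp: pg_points_eq)

lemma image_pt_linear:
  assumes "Vector_Spaces.linear (*s) (*s) f"
  shows "f ` pt v = pt (f v)"
proof -
  interpret f: Vector_Spaces.linear "(*s)" "(*s)" f by (rule assms)
  show ?thesis
  proof -
    have "f ` pt v = (\<lambda>c. c *s f v) ` UNIV" unfolding pt_eq_range image_image by (simp add: f.scale)
    then show ?thesis by (simp add: pt_eq_range)
  qed
qed

lemma subspace_complement_UNIV:
  fixes W T :: "('a::field ^ 'n) set"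
  assumes "vec.subspace W" "vec.subspace T" "W \<inter> T = {0}" "vec.dim W + vec.dim T = CARD('n)"
  shows "\<exists>w\<in>W. \<exists>t\<in>T. v = w + t"
proof -
  let ?U = "{x + y | x y. x \<in> W \<and> y \<in> T}"
  have "vec.dim ?U = CARD('n)" using vec.dim_sums_Int[OF assms(1,2)] assms(3,4) by simp
  then have "vec.dim ?U = vec.dim (UNIV :: ('a ^ 'n) set)" by (simp only: vec_dim_card)
  moreover have "vec.subspace ?U" by (rule vec.subspace_sums[OF assms(1,2)])
  ultimately have "?U = UNIV" by (intro vec.subspace_dim_equal) auto
  then show ?thesis by blast
qed

lemma pg_span_pair_meets:
  fixes x y :: "'a::field ^ 'n"
  assumes "vec.subspace W"
  shows "pg_span {pt x, pt y} \<inter> pt ` (W - {0}) \<noteq> {} \<longleftrightarrow>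
    (\<exists>\<alpha> \<beta>. \<alpha> *s x + \<beta> *s y \<noteq> 0 \<and> \<alpha> *s x + \<beta> *s y \<in> W)"
proof -
  have sp: "vec.span (\<Union>{pt x, pt y}) = {\<alpha> *s x + \<beta> *s y | \<alpha> \<beta>. True}"
  proof -
    have "vec.span (\<Union>{pt x, pt y}) = vec.span (vec.span {x} \<union> vec.span {y})" by (simp add: pt_def)
    also have "\<dots> = {v + w | v w. v \<in> vec.span {x} \<and> w \<in> vec.span {y}}"
      unfolding vec.span_Un vec.span_span ..
    also have "\<dots> = {\<alpha> *s x + \<beta> *s y | \<alpha> \<beta>. True}" by (auto simp: vec.span_singleton)
    finally show ?thesis .
  qed
  have span: "pg_span {pt x, pt y} = pt ` ({\<alpha> *s x + \<beta> *s y | \<alpha> \<beta>. True} - {0})"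
    unfolding pg_span_def sp[symmetric] by (rule points_in_subspace) simp
  show ?thesis
  proof
    assume "pg_span {pt x, pt y} \<inter> pt ` (W - {0}) \<noteq> {}"
    then obtain \<alpha> \<beta> w where v: "\<alpha> *s x + \<beta> *s y \<noteq> 0" and w: "w \<in> W" "pt (\<alpha> *s x + \<beta> *s y) = pt w"
      unfolding span by auto
    have "\<alpha> *s x + \<beta> *s y \<in> W"
      using self_in_pt[of "\<alpha> *s x + \<beta> *s y"] pt_subset_iff[OF assms, of w] w by blast
    with v show "\<exists>\<alpha> \<beta>. \<alpha> *s x + \<beta> *s y \<noteq> 0 \<and> \<alpha> *s x + \<beta> *s y \<in> W" by blast
  next
    assume "\<exists>\<alpha> \<beta>. \<alpha> *s x + \<beta> *s y \<noteq> 0 \<and> \<alpha> *s x + \<beta> *s y \<in> W"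
    then obtain \<alpha> \<beta> where v: "\<alpha> *s x + \<beta> *s y \<noteq> 0" "\<alpha> *s x + \<beta> *s y \<in> W" by blast
    then have "pt (\<alpha> *s x + \<beta> *s y) \<in> pg_span {pt x, pt y} \<inter> pt ` (W - {0})" unfolding span by blast
    then show "pg_span {pt x, pt y} \<inter> pt ` (W - {0}) \<noteq> {}" by blast
  qed
qed

lemma card_vec_over:
  fixes K :: "'a::finite set"
  shows "card {v :: 'a ^ 'n. \<forall>i. v $ i \<in> K} = card K ^ CARD('n)"
proof -
  have "bij_betw vec_nth {v :: 'a ^ 'n. \<forall>i. v $ i \<in> K} (PiE UNIV (\<lambda>_. K))"
  proof (rule bij_betw_imageI)
    show "inj_on vec_nth {v :: 'a ^ 'n. \<forall>i. v $ i \<in> K}" by (auto simp: inj_on_def vec_nth_inject)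
    show "vec_nth ` {v :: 'a ^ 'n. \<forall>i. v $ i \<in> K} = PiE UNIV (\<lambda>_. K)"
    proof (intro subset_antisym subsetI)
      fix f :: "'n \<Rightarrow> 'a" assume "f \<in> PiE UNIV (\<lambda>_. K)"
      then show "f \<in> vec_nth ` {v :: 'a ^ 'n. \<forall>i. v $ i \<in> K}"
        by (intro image_eqI[of _ _ "vec_lambda f"]) (auto simp: vec_lambda_inverse)
    qed auto
  qed
  from bij_betw_same_card[OF this] show ?thesis by (simp add: card_PiE)
qed

locale complementary_projection =
  fixes W T :: "('a::field ^ 5) set" and e :: "'a ^ 2 \<Rightarrow> 'a ^ 5"
  assumes W: "vec.subspace W" "vec.dim W = 3" and T: "vec.subspace T" "vec.dim T = 2"
    and disjoint: "W \<inter> T = {0}"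
    and lin_e: "Vector_Spaces.linear (*s) (*s) e" and inj_e: "inj e" and range_e: "range e = T"
begin

sublocale e: Vector_Spaces.linear "(*s)" "(*s)" e by (rule lin_e)

text \<open>The \<open>e\<close>-coordinates of the component in \<open>T\<close> of the
  decomposition along \<open>W\<close>; \<open>proj_eqI\<close> shows that the choice is
  unique.\<close>

definition proj :: "'a ^ 5 \<Rightarrow> 'a ^ 2" where "proj v = (SOME z. v - e z \<in> W)"

lemma proj_spec: "v - e (proj v) \<in> W"
proof -
  have "\<exists>w\<in>W. \<exists>t\<in>T. v = w + t"
    by (rule subspace_complement_UNIV[OF W(1) T(1) disjoint]) (simp add: W T)
  then obtain w t where wt: "w \<in> W" "t \<in> T" "v = w + t" by blast
  then obtain z where "t = e z" using range_e by auto
  with wt have "v - e z \<in> W" by simp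
  then show ?thesis unfolding proj_def by (rule someI)
qed

lemma proj_eqI: "v - e z \<in> W \<Longrightarrow> proj v = z"
proof -
  assume "v - e z \<in> W"
  then have "(v - e z) - (v - e (proj v)) \<in> W" by (rule vec.subspace_diff[OF W(1) _ proj_spec])
  then have "e (proj v - z) \<in> W" by (simp add: e.diff)
  moreover have "e (proj v - z) \<in> T" unfolding range_e[symmetric] by (rule rangeI)
  ultimately have "e (proj v - z) \<in> W \<inter> T" by blast
  then have "e (proj v - z) = e 0" unfolding disjoint by (simp add: e.zero)
  then have "proj v - z = 0" by (rule injD[OF inj_e])
  then show "proj v = z" by simp
qed

lemma linear_proj: "Vector_Spaces.linear (*s) (*s) proj"
proof unfold_locales
  fix v w :: "'a ^ 5" and c :: 'a
  show "proj (v + w) = proj v + proj w"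
    using vec.subspace_add[OF W(1) proj_spec[of v] proj_spec[of w]]
    by (intro proj_eqI) (simp add: e.add algebra_simps)
  show "proj (c *s v) = c *s proj v"
    using vec.subspace_scale[OF W(1) proj_spec[of v], of c]
    by (intro proj_eqI) (simp add: e.scale vec.scale_right_diff_distrib)
qed

sublocale proj: Vector_Spaces.linear "(*s)" "(*s)" proj by (rule linear_proj)

lemma proj_eq_0_iff: "proj v = 0 \<longleftrightarrow> v \<in> W"
  using proj_spec[of v] proj_eqI[of v 0] by (auto simp: e.zero)

lemma proj_e: "proj (e z) = z"
  using vec.subspace_0[OF W(1)] by (intro proj_eqI) simp

text \<open>The span of the plane and the point is the preimage under \<open>proj\<close> of the
  line through \<open>proj u\<close>. Since \<open>proj\<close> inverts \<open>e\<close>, this meets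
  \<open>T\<close> only in the multiples of \<open>e (proj u)\<close>.\<close>

lemma project_from_eq:
  assumes u: "u \<notin> W"
  shows "project_from (pt ` (W - {0})) (pt ` (T - {0})) (pt u) = e ` pt (proj u)"
proof -
  let ?X = "\<Union>(insert (pt u) (pt ` (W - {0})))"
  have u0: "u \<noteq> 0" using u vec.subspace_0[OF W(1)] by auto
  have pu: "proj u \<noteq> 0" using u by (simp add: proj_eq_0_iff)
  have sp: "vec.span ?X = {v. \<exists>k. proj v = k *s proj u}"
  proof (rule vec.span_unique)
    show "?X \<subseteq> {v. \<exists>k. proj v = k *s proj u}"
    proof
      fix v assume "v \<in> ?X"
      then consider "v \<in> pt u" | w where "w \<in> W" "v \<in> pt w" by auto
      then show "v \<in> {v. \<exists>k. proj v = k *s proj u}"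
      proof cases
        case 1
        then show ?thesis by (auto simp: pt_eq_range proj.scale)
      next
        case 2
        then have "v \<in> W" using pt_subset_iff[OF W(1)] by blast
        then show ?thesis by (intro CollectI exI[of _ 0]) (simp add: proj_eq_0_iff)
      qed
    qed
    show "vec.subspace {v. \<exists>k. proj v = k *s proj u}"
    proof (rule vec.subspaceI)
      show "0 \<in> {v. \<exists>k. proj v = k *s proj u}" by (intro CollectI exI[of _ 0]) (simp add: proj.zero)
      fix x y assume "x \<in> {v. \<exists>k. proj v = k *s proj u}" "y \<in> {v. \<exists>k. proj v = k *s proj u}"
      then obtain k l where "proj x = k *s proj u" "proj y = l *s proj u" by blast
      then have "proj (x + y) = (k + l) *s proj u" by (simp add: proj.add vec.scale_left_distrib)
      then show "x + y \<in> {v. \<exists>k. proj v = k *s proj u}" by blast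
    next
      fix c x assume "x \<in> {v. \<exists>k. proj v = k *s proj u}"
      then obtain k where "proj x = k *s proj u" by blast
      then have "proj (c *s x) = (c * k) *s proj u" by (simp add: proj.scale)
      then show "c *s x \<in> {v. \<exists>k. proj v = k *s proj u}" by blast
    qed
    fix Y assume Y: "?X \<subseteq> Y" "vec.subspace Y"
    show "{v. \<exists>k. proj v = k *s proj u} \<subseteq> Y"
    proof
      fix v assume "v \<in> {v. \<exists>k. proj v = k *s proj u}"
      then obtain k where "proj v = k *s proj u" by blast
      then have w: "v - k *s u \<in> W" by (simp add: proj_eq_0_iff[symmetric] proj.diff proj.scale)
      have uY: "u \<in> Y" using Y(1) self_in_pt[of u] by blast
      have "v - k *s u \<in> Y"
      proof (cases "v - k *s u = 0")
        case True
        then show ?thesis using vec.subspace_0[OF Y(2)] by simp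
      next
        case False
        then have "v - k *s u \<in> ?X" using w self_in_pt[of "v - k *s u"] by blast
        then show ?thesis using Y(1) by blast
      qed
      then have "(v - k *s u) + k *s u \<in> Y" using uY Y(2) by (intro vec.subspace_add vec.subspace_scale)
      then show "v \<in> Y" by simp
    qed
  qed
  have sspan: "pg_span (insert (pt u) (pt ` (W - {0}))) = pt ` (vec.span ?X - {0})"
    unfolding pg_span_def by (rule points_in_subspace) simp
  have ne: "e (proj u) \<noteq> 0" using pu inj_e e.zero by (metis injD)
  have "pg_span (insert (pt u) (pt ` (W - {0}))) \<inter> pt ` (T - {0}) = {pt (e (proj u))}"
  proof (intro subset_antisym subsetI)
    fix P assume "P \<in> pg_span (insert (pt u) (pt ` (W - {0}))) \<inter> pt ` (T - {0})"
    then obtain v t where v: "P = pt v" "v \<noteq> 0" "v \<in> vec.span ?X" and t: "P = pt t" "t \<in> T" "t \<noteq> 0"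
      unfolding sspan by auto
    have "pt v \<subseteq> T" unfolding v(1)[symmetric] t(1) using t(2) pt_subset_iff[OF T(1)] by blast
    then have "v \<in> T" using pt_subset_iff[OF T(1)] by blast
    then obtain z where z: "v = e z" using range_e by auto
    from v(3) obtain k where "proj v = k *s proj u" unfolding sp by blast
    then have "v = k *s e (proj u)" by (simp add: z proj_e e.scale)
    moreover from this v(2) have "k \<noteq> 0" by auto
    ultimately have "pt (e (proj u)) = pt v" using pt_eq_iff[OF ne v(2)] by blast
    then show "P \<in> {pt (e (proj u))}" using v(1) by simp
  next
    fix P assume "P \<in> {pt (e (proj u))}"
    moreover have "e (proj u) \<in> vec.span ?X" unfolding sp by (auto simp: proj_e intro!: exI[of _ 1])
    moreover have "e (proj u) \<in> T" using range_e by auto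
    ultimately show "P \<in> pg_span (insert (pt u) (pt ` (W - {0}))) \<inter> pt ` (T - {0})"
      unfolding sspan using ne by auto
  qed
  then show ?thesis unfolding project_from_def image_pt_linear[OF lin_e] by simp
qed

end

section \<open>Collineations fixing a subgeometry pointwise\<close>

context quintic_extension
begin

text \<open>Frame argument: fixing the unit points makes the map diagonal in the coordinates of
  \<open>g\<close>, the all-one point makes the diagonal constant, and points with entries 1 and
  \<open>t\<close> make the automorphism fix \<open>Fq q\<close>. It is then a Frobenius power,
  nontrivial because \<sigma> is.\<close>

lemma pointwise_stabilizer_frobenius:
  fixes g :: "'a ^ 5 \<Rightarrow> 'a ^ 5"
  assumes g: "Vector_Spaces.linear (*s) (*s) g" "bij g"
    and \<sigma>: "\<sigma> \<in> pointwise_stabilizer ((\<lambda>v. pt (g v)) ` ({v. \<forall>i. v $ i \<in> Fq q} - {0}))"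
    and \<sigma>1: "\<sigma> \<noteq> collineation_one"
  obtains s where "s < 5" "s \<noteq> 0"
    "\<And>v. v \<noteq> 0 \<Longrightarrow> \<sigma> (pt (g v)) = pt (g (\<chi> i. fr s (v $ i)))"
proof -
  interpret g: Vector_Spaces.linear "(*s)" "(*s)" g by (rule g(1))
  let ?K = "{v :: 'a ^ 5. \<forall>i. v $ i \<in> Fq q}"
  obtain f where f: "semilinear_bij f" "\<sigma> = induced_collineation f"
    and fixes_points: "\<And>v. v \<in> ?K \<Longrightarrow> v \<noteq> 0 \<Longrightarrow> \<sigma> (pt (g v)) = pt (g v)"
    using \<sigma> by (auto simp: pointwise_stabilizer_def PGammaL_def)
  obtain \<rho> where \<rho>: "field_automorphism \<rho>" and f_scale: "\<And>c v. f (c *s v) = \<rho> c *s f v"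
    and f_add: "\<And>v w. f (v + w) = f v + f w" and f_bij: "bij f"
    using f(1) by (auto simp: semilinear_bij_def)
  have \<rho>_bij: "bij \<rho>" and \<rho>1: "\<rho> 1 = 1" using \<rho> by (auto simp: field_automorphism_def)
  have \<rho>0: "\<rho> 0 = 0"
    using \<rho> by (metis add_cancel_right_right add_0_right field_automorphism_def)
  have g_eq_0: "g v = 0 \<longleftrightarrow> v = 0" for v using g(2) g.zero by (metis bij_is_inj injD)
  have f0: "f 0 = 0" using f_scale[of 0 0] by (simp add: \<rho>0)
  have f_eq_0: "f v = 0 \<longleftrightarrow> v = 0" for v using f_bij f0 by (metis bij_is_inj injD)
  have \<sigma>_pt: "\<sigma> (pt v) = pt (f v)" if "v \<noteq> 0" for v
  proof -
    have "pt v \<in> pg_points" using that by (auto simp: pg_points_eq)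
    then show ?thesis
      using image_pt[of f v \<rho>] f_scale \<rho>_bij by (simp add: f(2) induced_collineation_def bij_is_surj)
  qed
  have fK: "\<exists>k. k \<noteq> 0 \<and> f (g v) = k *s g v" if v: "v \<in> ?K" "v \<noteq> 0" for v
  proof -
    have "pt (g v) = pt (f (g v))" using fixes_points[OF v] \<sigma>_pt[of "g v"] v g_eq_0 by simp
    moreover have "g v \<noteq> 0" "f (g v) \<noteq> 0" using v(2) by (simp_all add: g_eq_0 f_eq_0)
    ultimately show ?thesis using pt_eq_iff[of "g v" "f (g v)"] by simp
  qed
  have Fq01: "(0::'a) \<in> Fq q" "(1::'a) \<in> Fq q" by (simp_all add: Fq_iff)
  have "\<forall>i. \<exists>k. f (g (axis i 1)) = k *s g (axis i 1)"
  proof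
    fix i :: 5
    have "axis i 1 \<in> ?K" using Fq01 by (auto simp: axis_def)
    moreover have "axis i (1::'a) \<noteq> 0" by (simp add: axis_eq_0_iff)
    ultimately show "\<exists>k. f (g (axis i 1)) = k *s g (axis i 1)" using fK by blast
  qed
  then obtain c where c: "\<And>i. f (g (axis i 1)) = c i *s g (axis i 1)" by metis
  have f_sum: "f (sum h A) = (\<Sum>i\<in>A. f (h i))" for h and A :: "5 set"
    by (induction A rule: infinite_finite_induct) (auto simp: f0 f_add)
  have fg: "f (g v) = g (\<chi> i. \<rho> (v $ i) * c i)" for v
  proof -
    have "f (g v) = f (g (\<Sum>i\<in>UNIV. (v $ i) *s axis i 1))" by (simp only: basis_expansion)
    also have "\<dots> = (\<Sum>i\<in>UNIV. (\<rho> (v $ i) * c i) *s g (axis i 1))"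
      by (simp add: g.sum g.scale f_sum f_scale c)
    also have "\<dots> = g (\<Sum>i\<in>UNIV. ((\<chi> i. \<rho> (v $ i) * c i) $ i) *s axis i 1)"
      by (simp add: g.sum g.scale)
    also have "\<dots> = g (\<chi> i. \<rho> (v $ i) * c i)" by (simp only: basis_expansion)
    finally show ?thesis .
  qed
  have g_inj: "g v = g w \<longleftrightarrow> v = w" for v w using g(2) by (metis bij_is_inj injD)
  have fK': "\<exists>k. k \<noteq> 0 \<and> (\<forall>i. \<rho> (v $ i) * c i = k * v $ i)" if v: "v \<in> ?K" "v \<noteq> 0" for v
  proof -
    obtain k where k: "k \<noteq> 0" "f (g v) = k *s g v" using fK[OF v] by blast
    then have "g (\<chi> i. \<rho> (v $ i) * c i) = g (k *s v)" using fg by (simp add: g.scale)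
    then have "(\<chi> i. \<rho> (v $ i) * c i) = k *s v" by (simp only: g_inj)
    with k(1) show ?thesis by (auto simp: vec_eq_iff)
  qed
  \<comment> \<open>Here \<open>1\<close> is the all-one vector; with \<open>\<rho> 1 = 1\<close> it
    forces all \<open>c i\<close> to be equal.\<close>
  have "(1 :: 'a ^ 5) \<in> ?K" using Fq01 by simp
  from fK'[OF this] obtain k where k: "k \<noteq> 0" "\<And>i. c i = k" by (auto simp: \<rho>1)
  have "\<rho> t = t" if t: "t \<in> Fq q" for t
  proof -
    define v :: "'a ^ 5" where "v = (\<chi> i. if i = 0 then 1 else t)"
    have v0: "v $ 0 = 1" "v $ 1 = t" by (simp_all add: v_def)
    have "v \<in> ?K" using t Fq01 by (simp add: v_def)
    moreover have "v \<noteq> 0" using v0(1) by (metis zero_index zero_neq_one)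
    ultimately obtain l where l: "\<And>i. \<rho> (v $ i) * c i = l * v $ i" using fK' by blast
    from l[of 0] have "k = l" by (simp add: v0 \<rho>1 k)
    with l[of 1] k(1) show ?thesis by (simp add: v0 k)
  qed
  then obtain s where s: "s < 5" "\<rho> = fr s" using automorphism_frob[OF \<rho>] by blast
  have fg': "f (g v) = k *s g (\<chi> i. fr s (v $ i))" for v
  proof -
    have "(\<chi> i. \<rho> (v $ i) * c i) = k *s (\<chi> i. fr s (v $ i))" by (simp add: vec_eq_iff s k mult.commute)
    then show ?thesis by (simp add: fg g.scale)
  qed
  have \<sigma>g: "\<sigma> (pt (g v)) = pt (g (\<chi> i. fr s (v $ i)))" if v: "v \<noteq> 0" for v
  proof -
    have "(\<chi> i. fr s (v $ i)) \<noteq> 0" using v by (auto simp: vec_eq_iff)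
    then have "pt (g (\<chi> i. fr s (v $ i))) = pt (f (g v))"
      unfolding fg' using k(1) g_eq_0 by (subst pt_eq_iff) auto
    then show ?thesis using \<sigma>_pt[of "g v"] v g_eq_0 by simp
  qed
  have "s \<noteq> 0"
  proof
    assume "s = 0"
    have "\<sigma> P = collineation_one P" for P
    proof (cases "P \<in> pg_points")
      case True
      then obtain x where x: "P = pt x" "x \<noteq> 0" by (auto simp: pg_points_eq)
      obtain v where v: "x = g v" using g(2) by (metis bij_is_surj surjD)
      then have "v \<noteq> 0" using x g_eq_0 by auto
      from \<sigma>g[OF this] True show ?thesis using x v \<open>s = 0\<close> by (simp add: collineation_one_def)
    next
      case False
      then show ?thesis by (simp add: collineation_one_def f(2) induced_collineation_def)
    qed
    with \<sigma>1 show False by blast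
  qed
  with s(1) \<sigma>g that show ?thesis by blast
qed

end

section \<open>From points and collineations to vectors and semilinear maps\<close>

theorem theorem2p3:
  fixes q :: nat
    and \<Sigma> \<Gamma> l :: "('a::{field,finite} ^ 5) set set"
    and e :: "'a ^ 2 \<Rightarrow> 'a ^ 5"
    and L :: "('a ^ 2) set set"
    and \<sigma> :: "('a ^ 5) set \<Rightarrow> ('a ^ 5) set"
    and A B :: "('a ^ 5) set"
  assumes "primepow q" and "CARD('a) = q ^ 5"
    and "canonical_subgeometry q \<Sigma>"
    and "pg_plane \<Gamma>" and "\<Gamma> \<inter> \<Sigma> = {}"
    and "pg_line l" and "l \<inter> \<Gamma> = {}"
    and "line_coordinates l e"
    and "L = {P \<in> pg_points. e ` P \<in> project_from \<Gamma> l ` \<Sigma>}"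
    and "max_scattered q L" and "\<not> pseudoregulus_type q L"
    and "\<sigma> \<in> pointwise_stabilizer \<Sigma>" and "\<sigma> \<noteq> collineation_one"
    and "A = the_elem (\<Gamma> \<inter> (\<sigma> ^^ 4) ` \<Gamma>)"
    and "B = the_elem (\<Gamma> \<inter> (\<sigma> ^^ 3) ` \<Gamma>)"
  shows "LP_type q L \<longleftrightarrow>
           pg_span {(\<sigma> ^^ 2) A, (\<sigma> ^^ 4) A} \<inter> \<Gamma> \<noteq> {} \<or>
           pg_span {(\<sigma> ^^ 3) B, (\<sigma> ^^ 4) B} \<inter> \<Gamma> \<noteq> {}"
proof -
  interpret quintic_extension q "TYPE('a)" using assms(1,2) by unfold_locales
  let ?K = "{v :: 'a ^ 5. \<forall>i. v $ i \<in> Fq q}"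
  obtain g where g: "Vector_Spaces.linear (*s) (*s) g" "bij g"
    and \<Sigma>g: "\<Sigma> = induced_collineation g ` {pt v | v. v \<noteq> 0 \<and> (\<forall>i. v $ i \<in> Fq q)}"
    using assms(3) by (auto simp: canonical_subgeometry_def PGL_def)
  interpret g: Vector_Spaces.linear "(*s)" "(*s)" g by (rule g(1))
  have g_eq_0: "g v = 0 \<longleftrightarrow> v = 0" for v using g(2) g.zero by (metis bij_is_inj injD)
  have \<Sigma>: "\<Sigma> = (\<lambda>v. pt (g v)) ` (?K - {0})"
  proof -
    have "{pt v | v. v \<noteq> 0 \<and> (\<forall>i. v $ i \<in> Fq q)} = pt ` (?K - {0})" by auto
    moreover have "induced_collineation g (pt v) = pt (g v)" if "v \<in> ?K - {0}" for v
      using that image_pt_linear[OF g(1), of v] by (auto simp: induced_collineation_def pg_points_eq)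
    ultimately show ?thesis unfolding \<Sigma>g by (simp only: image_image cong: image_cong)
  qed
  obtain W where W: "vec.subspace W" "vec.dim W = 3" and \<Gamma>W: "\<Gamma> = {P \<in> pg_points. P \<subseteq> W}"
    using assms(4) by (auto simp: pg_subspace_def)
  have \<Gamma>: "\<Gamma> = pt ` (W - {0})" unfolding \<Gamma>W by (rule points_in_subspace[OF W(1)])
  obtain T where T: "vec.subspace T" "vec.dim T = 2" and lT: "l = {P \<in> pg_points. P \<subseteq> T}"
    using assms(6) by (auto simp: pg_subspace_def)
  have l: "l = pt ` (T - {0})" unfolding lT by (rule points_in_subspace[OF T(1)])
  have e: "Vector_Spaces.linear (*s) (*s) e" "inj e" and el: "(\<lambda>P. e ` P) ` pg_points = l"
    using assms(8) by (auto simp: line_coordinates_def)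
  interpret e: Vector_Spaces.linear "(*s)" "(*s)" e by (rule e(1))
  have range_e: "range e = T"
  proof (intro subset_antisym subsetI)
    fix x assume "x \<in> range e"
    then obtain z where z: "x = e z" by auto
    show "x \<in> T"
    proof (cases "z = 0")
      case True
      then show ?thesis using z vec.subspace_0[OF T(1)] by (simp add: e.zero)
    next
      case False
      then have "e ` pt z \<in> l" unfolding el[symmetric] by (auto simp: pg_points_eq)
      then have "pt (e z) \<subseteq> T" unfolding image_pt_linear[OF e(1)] lT by simp
      then show ?thesis using pt_subset_iff[OF T(1)] z by simp
    qed
  next
    fix x assume x: "x \<in> T"
    show "x \<in> range e"
    proof (cases "x = 0")
      case True
      then show ?thesis using e.zero by (metis rangeI)
    next
      case False
      then have "pt x \<in> (\<lambda>P. e ` P) ` pg_points" unfolding el l using x by simp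
      then show ?thesis using self_in_pt[of x] by auto
    qed
  qed
  have WT: "W \<inter> T = {0}"
  proof (intro subset_antisym subsetI)
    fix x assume x: "x \<in> W \<inter> T"
    show "x \<in> {0}"
    proof (rule ccontr)
      assume "x \<notin> {0}"
      with x have "pt x \<in> l \<inter> \<Gamma>" unfolding l \<Gamma> by auto
      with assms(7) show False by blast
    qed
  qed (use vec.subspace_0[OF W(1)] vec.subspace_0[OF T(1)] in auto)
  interpret complementary_projection W T e
    using W T WT e range_e by unfold_locales
  have notW: "g v \<notin> W" if "v \<in> ?K - {0}" for v
  proof
    assume "g v \<in> W"
    then have "pt (g v) \<in> \<Gamma> \<inter> \<Sigma>" unfolding \<Gamma> \<Sigma> using that g_eq_0[of v] by auto
    with assms(5) show False by blast
  qed
  have L: "L = pt ` proj ` g ` (?K - {0})"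
  proof -
    have pr: "project_from \<Gamma> l ` \<Sigma> = (\<lambda>v. e ` pt (proj (g v))) ` (?K - {0})"
      unfolding \<Sigma> \<Gamma> l image_image by (rule image_cong[OF refl]) (rule project_from_eq[OF notW])
    have "P \<in> L \<longleftrightarrow> P \<in> pt ` proj ` g ` (?K - {0})" for P
    proof
      assume "P \<in> L"
      then have "e ` P \<in> (\<lambda>v. e ` pt (proj (g v))) ` (?K - {0})" unfolding assms(9) pr by simp
      then obtain v where "v \<in> ?K - {0}" "e ` P = e ` pt (proj (g v))" by auto
      moreover from this(2) have "P = pt (proj (g v))" using inj_image_eq_iff[OF e(2)] by blast
      ultimately show "P \<in> pt ` proj ` g ` (?K - {0})" by blast
    next
      assume "P \<in> pt ` proj ` g ` (?K - {0})"
      then obtain v where v: "v \<in> ?K - {0}" "P = pt (proj (g v))" by auto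
      then have "proj (g v) \<noteq> 0" using notW[of v] proj_eq_0_iff[of "g v"] by simp
      with v show "P \<in> L" unfolding assms(9) pr by (auto simp: pg_points_eq)
    qed
    then show ?thesis by (rule set_eqI)
  qed
  obtain s where s: "s < 5" "s \<noteq> 0"
    and \<sigma>g: "\<And>v. v \<noteq> 0 \<Longrightarrow> \<sigma> (pt (g v)) = pt (g (\<chi> i. fr s (v $ i)))"
    using pointwise_stabilizer_frobenius[OF g assms(12)[unfolded \<Sigma>] assms(13)] by blast
  interpret frobenius_generator q "TYPE('a)" s using s by unfold_locales
  define g' where "g' = inv g"
  have gg': "g (g' x) = x" and g'g: "g' (g v) = v" for x v
    using g(2) by (simp_all add: g'_def bij_is_surj surj_f_inv_f bij_is_inj)
  \<comment> \<open>Coordinatewise \<open>fr s\<close> conjugated by \<open>g\<close>: a semilinear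
    map inducing \<sigma>, whose fixed vectors are the images of the vectors over
    \<open>Fq q\<close>.\<close>
  define S where "S x = g (\<chi> i. fr s (g' x $ i))" for x
  have g'_add: "g' (x + y) = g' x + g' y" for x y
    using g'g[of "g' x + g' y"] by (simp add: g.add gg')
  have g'_scale: "g' (c *s x) = c *s g' x" for c x
    using g'g[of "c *s g' x"] by (simp add: g.scale gg')
  have R: "{v. S v = v} = g ` ?K"
  proof (intro set_eqI iffI)
    fix x assume "x \<in> {v. S v = v}"
    then have "g (\<chi> i. fr s (g' x $ i)) = g (g' x)" by (simp add: S_def gg')
    then have "(\<chi> i. fr s (g' x $ i)) = g' x" using g(2) by (auto dest: injD[OF bij_is_inj])
    then have "fr s (g' x $ i) = g' x $ i" for i by (metis vec_lambda_beta)
    then have "g' x \<in> ?K" using fr_fixed[of s] s by auto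
    then show "x \<in> g ` ?K" using gg'[of x] by (metis image_eqI)
  next
    fix x assume "x \<in> g ` ?K"
    then obtain v where v: "x = g v" "v \<in> ?K" by auto
    then have "(\<chi> i. fr s (v $ i)) = v" by (simp add: vec_eq_iff fr_Fq)
    then show "x \<in> {v. S v = v}" by (simp add: S_def v(1) g'g)
  qed
  have R0: "{v. S v = v} - {0} = g ` (?K - {0})" unfolding R using g_eq_0 by auto
  have "scattered_projection q s S proj"
  proof unfold_locales
    fix v w :: "'a ^ 5" and c :: 'a
    have "(\<chi> i. fr s (g' (v + w) $ i)) = (\<chi> i. fr s (g' v $ i)) + (\<chi> i. fr s (g' w $ i))"
      by (simp add: vec_eq_iff g'_add fr_add)
    then show "S (v + w) = S v + S w" by (simp add: S_def g.add)
    have "(\<chi> i. fr s (g' (c *s v) $ i)) = fr s c *s (\<chi> i. fr s (g' v $ i))"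
      by (simp add: vec_eq_iff g'_scale fr_mult)
    then show "S (c *s v) = fr s c *s S v" by (simp add: S_def g.scale)
    have "(S ^^ k) v = g (\<chi> i. fr (s * k) (g' v $ i))" for k
      by (induction k) (simp_all add: S_def g'g gg' vec_lambda_eta)
    from this[of 5] show "(S ^^ 5) v = v"
      using fr_mult_5[of s] by (simp add: mult.commute gg' vec_lambda_eta)
    show "card {v. S v = v} = q ^ 5"
      unfolding R using g(2) by (simp add: card_image bij_is_inj inj_on_subset[OF bij_is_inj] card_vec_over card_Fq)
    show "surj proj" using proj_e by (metis surjI)
    show "vec.dim {v. proj v = 0} = 3" using W(2) by (simp add: proj_eq_0_iff)
    show "card (pt ` proj ` ({v. S v = v} - {0})) = (q ^ 5 - 1) div (q - 1)"
      unfolding R0 L[symmetric] using assms(10) by (simp add: max_scattered_def)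
    assume "S v = v" "v \<noteq> 0"
    then have "v \<in> g ` (?K - {0})" using R0 by blast
    then show "proj v \<noteq> 0" using notW proj_eq_0_iff by blast
  qed
  then interpret P: scattered_projection q "TYPE('a)" s S proj .
  have LP: "P.L = L" unfolding R0 L ..
  have np: "\<not> pseudoregulus_type q P.L" unfolding LP by (rule assms(11))
  have \<sigma>S: "\<sigma> (pt x) = pt (S x)" if "x \<noteq> 0" for x
    using \<sigma>g[of "g' x"] that g_eq_0[of "g' x"] by (simp add: gg' S_def)
  have \<sigma>pow: "(\<sigma> ^^ k) (pt x) = pt ((S ^^ k) x)" if "x \<noteq> 0" for k x
    using that by (induction k) (simp_all add: \<sigma>S P.Spow_eq_0_iff)
  \<comment> \<open>\<open>\<sigma> ^^ (5 - j)\<close> is the inverse of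
    \<open>\<sigma> ^^ j\<close> on points, so a point of \<Gamma> lies in that image of \<Gamma>
    exactly when \<open>S ^^ j\<close> sends its vectors into \<open>W\<close>. The exponents 4 and
    3 of \<open>A\<close> and \<open>B\<close> belong to \<open>j = 1\<close> and
    \<open>j = 2\<close>.\<close>
  have point: "the_elem (\<Gamma> \<inter> (\<sigma> ^^ (5 - j)) ` \<Gamma>) = pt a"
    if j: "j < 5" and a: "a \<noteq> 0" "{v. proj v = 0 \<and> proj ((S ^^ j) v) = 0} = vec.span {a}" for j a
  proof -
    have "\<Gamma> \<inter> (\<sigma> ^^ (5 - j)) ` \<Gamma> = {pt a}"
    proof (intro subset_antisym subsetI)
      fix X assume "X \<in> \<Gamma> \<inter> (\<sigma> ^^ (5 - j)) ` \<Gamma>"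
      then obtain v w where v: "X = pt v" "v \<in> W" "v \<noteq> 0" and w: "w \<in> W" "w \<noteq> 0"
        and "X = (\<sigma> ^^ (5 - j)) (pt w)"
        unfolding \<Gamma> by blast
      then have Xw: "X = pt ((S ^^ (5 - j)) w)" using \<sigma>pow[of w "5 - j"] by simp
      let ?u = "(S ^^ (5 - j)) w"
      have "?u \<in> W" using Xw v self_in_pt[of ?u] pt_subset_iff[OF W(1), of v] by blast
      moreover have "(S ^^ j) ?u = w" unfolding P.Spow_Spow using j P.S_5 by simp
      ultimately have "?u \<in> vec.span {a}" unfolding a(2)[symmetric] using w by (simp add: proj_eq_0_iff)
      then obtain k where k: "?u = k *s a" by (auto simp: vec.span_singleton)
      have u0: "?u \<noteq> 0" using w by (simp add: P.Spow_eq_0_iff)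
      then have "k \<noteq> 0" using k by auto
      then have "pt a = pt ?u" using pt_eq_iff[OF a(1) u0] k by blast
      then show "X \<in> {pt a}" using Xw by simp
    next
      fix X assume X: "X \<in> {pt a}"
      have "a \<in> {v. proj v = 0 \<and> proj ((S ^^ j) v) = 0}" unfolding a(2) by (simp add: vec.span_base)
      then have aW: "a \<in> W" "(S ^^ j) a \<in> W" by (simp_all add: proj_eq_0_iff)
      have n: "(S ^^ j) a \<noteq> 0" using a(1) by (simp add: P.Spow_eq_0_iff)
      have "(\<sigma> ^^ (5 - j)) (pt ((S ^^ j) a)) = pt a"
        unfolding \<sigma>pow[OF n] P.Spow_Spow using j P.S_5 by simp
      moreover have "pt ((S ^^ j) a) \<in> \<Gamma>" unfolding \<Gamma> using aW n by blast
      ultimately have "pt a \<in> (\<sigma> ^^ (5 - j)) ` \<Gamma>" by (metis image_eqI)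
      moreover have "pt a \<in> \<Gamma>" unfolding \<Gamma> using aW a(1) by blast
      ultimately show "X \<in> \<Gamma> \<inter> (\<sigma> ^^ (5 - j)) ` \<Gamma>" using X by simp
    qed
    then show ?thesis by simp
  qed
  obtain a where a: "a \<noteq> 0" "{v. proj v = 0 \<and> proj ((S ^^ 1) v) = 0} = vec.span {a}"
    by (rule P.kernel_meets_power[OF np, of 1]) auto
  obtain b where b: "b \<noteq> 0" "{v. proj v = 0 \<and> proj ((S ^^ 2) v) = 0} = vec.span {b}"
    by (rule P.kernel_meets_power[OF np, of 2]) auto
  have A: "A = pt a" using point[of 1 a] a assms(14) by simp
  have B: "B = pt b" using point[of 2 b] b assms(15) by simp
  have cA: "pg_span {(\<sigma> ^^ 2) A, (\<sigma> ^^ 4) A} \<inter> \<Gamma> \<noteq> {} \<longleftrightarrow> P.shift_collinear 1"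
    unfolding A \<sigma>pow[OF a(1)] \<Gamma> pg_span_pair_meets[OF W(1)] P.shift_collinear_iff[OF a]
    by (simp only: proj_eq_0_iff mult_1_right)
  \<comment> \<open>The fourth image of \<open>b\<close> under \<open>S ^^ 2\<close>, reduced modulo
    5 to match the exponent 3 in the condition on \<open>B\<close>.\<close>
  have b8: "(S ^^ 8) b = (S ^^ 3) b" using P.Spow_reduce[of 8 b] by simp
  have cB: "pg_span {(\<sigma> ^^ 3) B, (\<sigma> ^^ 4) B} \<inter> \<Gamma> \<noteq> {} \<longleftrightarrow> P.shift_collinear 2"
  proof -
    have "P.shift_collinear 2 \<longleftrightarrow> (\<exists>\<alpha> \<beta>. \<alpha> *s (S ^^ 4) b + \<beta> *s (S ^^ 3) b \<noteq> 0 \<and>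
        \<alpha> *s (S ^^ 4) b + \<beta> *s (S ^^ 3) b \<in> W)"
      unfolding P.shift_collinear_iff[OF b] by (simp add: proj_eq_0_iff b8)
    also have "\<dots> \<longleftrightarrow> (\<exists>\<alpha> \<beta>. \<alpha> *s (S ^^ 3) b + \<beta> *s (S ^^ 4) b \<noteq> 0 \<and>
        \<alpha> *s (S ^^ 3) b + \<beta> *s (S ^^ 4) b \<in> W)"
      by (subst add.commute, subst (2) add.commute) blast
    finally show ?thesis
      unfolding B \<sigma>pow[OF b(1)] \<Gamma> pg_span_pair_meets[OF W(1)] by simp
  qed
  show ?thesis using P.lp_type_iff_collinear[OF np] unfolding LP cA cB .
qed

end
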